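(* Under the Stationarity Assumption on $R$ (see context), every $\mathbf F=(F_t)_{t\ge0}\in\mathfrak R_{\mathrm{ac}}$ satisfies $$d_{\mathrm{TV}}(dF_t,\pi)\to0\quad\text{as }t\to\infty.$$ Furthermore, if $\mathcal M$ is a tight family of probability distributions on $(0,\infty)$, the convergence is uniform on the set $\{\mathbf F\in\mathfrak R_{\mathrm{ac}}: dF_0\in\mathcal M\}$.
   Context: Let $R:[0,\infty)\to[0,\infty)$ be a Borel function with $\int_0^kR(x)\,dx<\infty$ for all $k>0$. Let $L^1_{\mathrm{loc}}$ be the space of functions $f:[0,\infty)\to\mathbb R$ that are integrable on each $[0,k]$, with metric $d(f,g)=\sum_{k\ge1}2^{-k}\wedge\int_0^k|f(x)-g(x)|\,dx$. Let $\mathcal D\subset L^1_{\mathrm{loc}}$ be the set of c\`adl\`ag nondecreasing functions $F:[0,\infty]\to[0,1]$ (with $F(+\infty)=\lim_{x\to\infty}F(x)$), and let $\mathcal X$ be the set of Borel measurable maps $\mathbf F:t\mapsto F_t$ from $[0,\infty)$ to $\mathcal D$. For $F\in\mathcal D$, $dF$ denotes its Lebesgue–Stieltjes measure. $\mathfrak R$ is the set of $\mathbf F\in\mathcal X$ such that: $dF_t$ is absolutely continuous with respect to Lebesgue measure for every $t\ge 0$; $F_t(+\infty)=1$ and $F_t(0)=0$ for every $t\ge0$; the family $\{F_t\}_{t\ge0}$ is tight (for every $\epsilon>0$ there is $N>0$ with $F_t(N)>1-\epsilon$ for all $t\ge0$); and for all $t\ge0$, $x>0$, $$F_t(x)=F_0(e^{-t}x)+\int_0^t(e^{s-t}x)^2\left[\int_{e^{s-t}x}^\infty\frac{R(z)}{z}\,dF_s(z)\right]ds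 .$$ Stationarity Assumption: there is a distribution function $F$ such that the constant family $F_t=F$, $t\ge0$, belongs to $\mathfrak R$. The corresponding probability measure on $(0,\infty)$ is denoted $\pi$ (so $\pi=dF$). $\mathfrak R_{\mathrm{ac}}=\{\mathbf F\in\mathfrak R:\sup_{t\ge0}\|\tfrac{dF_t}{d\pi}\|_{L^\infty(\pi)}<\infty\}$ (in particular $dF_t\ll\pi$ for all $t$). $d_{\mathrm{TV}}$ is total variation distance. A family of probability measures on $(0,\infty)$ is tight if for every $\epsilon>0$ there is a compact $K\subset(0,\infty)$ whose complement has mass less than $\epsilon$ under each member. *)

theory Defs
  imports "HOL-Probability.Probability"
begin

text \<open>
  Functions on \<open>[0,\<infinity>)\<close> are represented by total functions on \<open>real\<close>. The values of
  \<open>R\<close>, and of a family \<open>F\<close> in its time variable, at negative arguments are never used.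
\<close>

definition rate_function :: "(real \<Rightarrow> real) \<Rightarrow> bool" where
  "rate_function R \<longleftrightarrow>
     R \<in> borel_measurable (restrict_space borel {0..}) \<and>
     (\<forall>x\<ge>0. R x \<ge> 0) \<and>
     (\<forall>k>0. (\<integral>\<^sup>+x\<in>{0..k}. ennreal (R x) \<partial>lborel) < \<infinity>)"

definition L1loc :: "(real \<Rightarrow> real) set" where
  "L1loc = {f. \<forall>k\<ge>0. set_integrable lborel {0..k} f}"

definition dL1loc :: "(real \<Rightarrow> real) \<Rightarrow> (real \<Rightarrow> real) \<Rightarrow> real" where
  "dL1loc f g =
     (\<Sum>k. min ((1/2) ^ Suc k) (LINT x:{0..real (Suc k)}|lborel. \<bar>f x - g x\<bar>))"

definition cadlag_on_nonneg :: "(real \<Rightarrow> real) \<Rightarrow> bool" where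
  "cadlag_on_nonneg f \<longleftrightarrow>
     (\<forall>x\<ge>0. continuous (at_right x) f) \<and>
     (\<forall>x>0. \<exists>l. (f \<longlongrightarrow> l) (at_left x))"

text \<open>
  Elements of \<open>Dsub\<close> are extended by \<open>0\<close> to negative arguments. Each function on \<open>[0,\<infinity>)\<close> then
  has exactly one representative, \<open>dL1loc\<close> is a metric and not just a pseudometric on \<open>Dsub\<close>, and
  \<open>interval_measure F\<close> is the Lebesgue--Stieltjes measure of \<open>F\<close>, with mass \<open>F 0\<close> at \<open>0\<close> and no mass
  on the negative half-line. The value at \<open>+\<infinity>\<close>, being determined by the others, is
  not stored; it is \<open>at_infty F\<close>.
\<close>

definition Dsub :: "(real \<Rightarrow> real) set" where
  "Dsub = {F \<in> L1loc.
     cadlag_on_nonneg F \<and> mono_on {0..} F \<and> F \<in> {0..} \<rightarrow> {0..1} \<and> (\<forall>x<0. F x = 0)}"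

definition at_infty :: "(real \<Rightarrow> real) \<Rightarrow> real" where
  "at_infty F = Lim at_top F"

definition borel_Dsub :: "(real \<Rightarrow> real) measure" where
  "borel_Dsub = sigma Dsub {U. openin (Metric_space.mtopology Dsub dL1loc) U}"

definition flows :: "(real \<Rightarrow> real \<Rightarrow> real) set" where
  "flows = (restrict_space borel {0..} \<rightarrow>\<^sub>M borel_Dsub)"

text \<open>
  The integral equation is stated in \<open>[0,\<infinity>]\<close>, so that its right-hand side is meaningful without
  integrability assumptions. The inner integral may exclude its lower endpoint because \<open>dF\<^sub>s\<close> has
  no atoms.
\<close>

definition solutions :: "(real \<Rightarrow> real) \<Rightarrow> (real \<Rightarrow> real \<Rightarrow> real) set" where
  "solutions R = {F \<in> flows.
     (\<forall>t\<ge>0. absolutely_continuous lborel (interval_measure (F t))) \<and>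
     (\<forall>t\<ge>0. at_infty (F t) = 1 \<and> F t 0 = 0) \<and>
     (\<forall>\<epsilon>>0. \<exists>N>0. \<forall>t\<ge>0. F t N > 1 - \<epsilon>) \<and>
     (\<forall>t\<ge>0. \<forall>x>0.
        ennreal (F t x) = ennreal (F 0 (exp (- t) * x)) +
          (\<integral>\<^sup>+s\<in>{0..t}. ennreal ((exp (s - t) * x)\<^sup>2) *
             (\<integral>\<^sup>+z\<in>{exp (s - t) * x<..}. ennreal (R z / z) \<partial>interval_measure (F s)) \<partial>lborel))}"

text \<open>
  \<open>RN_deriv\<close> is a density only under absolute continuity, which is therefore required explicitly.
\<close>

definition solutions_ac ::
    "(real \<Rightarrow> real) \<Rightarrow> real measure \<Rightarrow> (real \<Rightarrow> real \<Rightarrow> real) set" where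
  "solutions_ac R \<pi> = {F \<in> solutions R.
     (\<forall>t\<ge>0. absolutely_continuous \<pi> (interval_measure (F t))) \<and>
     (SUP t\<in>{0..}. esssup \<pi> (RN_deriv \<pi> (interval_measure (F t)))) < \<infinity>}"

definition tv_dist :: "'a measure \<Rightarrow> 'a measure \<Rightarrow> real" where
  "tv_dist \<mu> \<nu> = (SUP A\<in>sets \<mu>. \<bar>measure \<mu> A - measure \<nu> A\<bar>)"

text \<open>
  Probability distributions on \<open>(0,\<infinity>)\<close> are Borel probability measures on \<open>real\<close> that give full
  mass to \<open>(0,\<infinity>)\<close>.
\<close>

definition positive_distribution :: "real measure \<Rightarrow> bool" where
  "positive_distribution \<mu> \<longleftrightarrow> real_distribution \<mu> \<and> measure \<mu> {0<..} = 1"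

definition tight_on_positive :: "real measure set \<Rightarrow> bool" where
  "tight_on_positive \<M> \<longleftrightarrow>
     (\<forall>\<epsilon>>0. \<exists>K. compact K \<and> K \<subseteq> {0<..} \<and> (\<forall>\<mu>\<in>\<M>. measure \<mu> ({0<..} - K) < \<epsilon>))"

lemma Metric_space_Dsub: "Metric_space Dsub dL1loc"
proof -
  define I where "I f g k = (LINT x:{0..real (Suc k)}|lborel. \<bar>f x - g x\<bar>)" for f g :: "real \<Rightarrow> real" and k
  have I_nonneg: "0 \<le> I f g k" for f g k
    unfolding I_def set_lebesgue_integral_def by (intro integral_nonneg_AE) auto
  have summ: "summable (\<lambda>k. min ((1/2) ^ Suc k) (I f g k))" for f g
    by (rule summable_comparison_test'[where g="\<lambda>k. (1/2) ^ Suc k" and N=0])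
       (use I_nonneg in \<open>auto simp: summable_mult summable_geometric\<close>)
  have d: "dL1loc f g = (\<Sum>k. min ((1/2) ^ Suc k) (I f g k))" for f g
    unfolding dL1loc_def I_def ..
  have int: "set_integrable lborel {0..real (Suc k)} (\<lambda>x. \<bar>f x - g x\<bar>)"
    if "f \<in> Dsub" "g \<in> Dsub" for f g k
    using that unfolding Dsub_def L1loc_def
    by (intro set_integrable_abs set_integral_diff) auto
  show ?thesis
  proof
    show "0 \<le> dL1loc f g" for f g
      unfolding d by (intro suminf_nonneg summ) (use I_nonneg in auto)
    show "dL1loc f g = dL1loc g f" for f g
      unfolding dL1loc_def by (simp add: abs_minus_commute)
    show "dL1loc f h \<le> dL1loc f g + dL1loc g h" if fgh: "f \<in> Dsub" "g \<in> Dsub" "h \<in> Dsub" for f g h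
    proof -
      have tri: "I f h k \<le> I f g k + I g h k" for k
      proof -
        have "I f h k \<le> (LINT x:{0..real (Suc k)}|lborel. \<bar>f x - g x\<bar> + \<bar>g x - h x\<bar>)"
          unfolding I_def using fgh by (intro set_integral_mono int set_integral_add) auto
        also have "\<dots> = I f g k + I g h k"
          unfolding I_def using fgh by (intro set_integral_add int)
        finally show ?thesis .
      qed
      have "dL1loc f h \<le> (\<Sum>k. min ((1/2) ^ Suc k) (I f g k) + min ((1/2) ^ Suc k) (I g h k))"
        unfolding d
      proof (intro suminf_le summ summable_add)
        fix k
        show "min ((1/2) ^ Suc k) (I f h k) \<le> min ((1/2) ^ Suc k) (I f g k) + min ((1/2) ^ Suc k) (I g h k)"
          using tri[of k] I_nonneg[of f g k] I_nonneg[of g h k] zero_le_power[of "1/2::real" "Suc k"]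
          by linarith
      qed
      also have "\<dots> = dL1loc f g + dL1loc g h"
        unfolding d by (rule suminf_add[symmetric]) (rule summ)+
      finally show ?thesis .
    qed
    show "dL1loc f g = 0 \<longleftrightarrow> f = g" if fg: "f \<in> Dsub" "g \<in> Dsub" for f g
    proof
      assume "dL1loc f g = 0"
      then have "\<forall>k. min ((1/2) ^ Suc k) (I f g k) = 0"
        unfolding d by (subst (asm) suminf_eq_zero_iff[OF summ]) (use I_nonneg in auto)
      then have I0: "I f g k = 0" for k
        by (metis min_def power_eq_0_iff half_gt_zero_iff less_irrefl zero_less_one)
      have "AE x in lborel. x \<in> {0..real (Suc k)} \<longrightarrow> f x = g x" for k
      proof -
        have "AE x in lborel. indicator {0..real (Suc k)} x *\<^sub>R \<bar>f x - g x\<bar> = 0"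
          using I0[of k] int[OF fg, of k] unfolding I_def set_lebesgue_integral_def set_integrable_def
          by (subst (asm) integral_nonneg_eq_0_iff_AE) auto
        then show ?thesis by eventually_elim (auto simp: indicator_def split: if_splits)
      qed
      then have "AE x in lborel. \<forall>k. x \<in> {0..real (Suc k)} \<longrightarrow> f x = g x"
        unfolding AE_all_countable by blast
      then have ae: "AE x in lborel. x \<ge> 0 \<longrightarrow> f x = g x"
      proof eventually_elim
        case (elim x)
        then show ?case
          using real_arch_simple[of x] by (metis atLeastAtMost_iff of_nat_Suc add.commute le_add_same_cancel1 order_trans zero_le_one of_nat_0_le_iff)
      qed
      show "f = g"
      proof
        fix x :: real
        show "f x = g x"
        proof (cases "x < 0")
          case True then show ?thesis using fg by (simp add: Dsub_def)
        next
          case False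
          have cf: "(f \<longlongrightarrow> f x) (at_right x)" "(g \<longlongrightarrow> g x) (at_right x)"
            using fg False unfolding Dsub_def cadlag_on_nonneg_def by (auto simp: continuous_within)
          then have lim: "((\<lambda>y. f y - g y) \<longlongrightarrow> f x - g x) (at_right x)"
            by (rule tendsto_diff)
          show ?thesis
          proof (rule ccontr)
            assume "f x \<noteq> g x"
            then have "eventually (\<lambda>y. f y - g y \<noteq> 0) (at_right x)"
              using tendsto_imp_eventually_ne[OF lim, of 0] by simp
            then obtain b where b: "b > x" "\<And>y. y > x \<Longrightarrow> y < b \<Longrightarrow> f y \<noteq> g y"
              unfolding eventually_at_right_field by auto
            have "AE y in lborel. y \<notin> {x<..<b}"
              using ae by eventually_elim (use b False in force)
            then have "emeasure lborel {x<..<b} = 0"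
              by (subst (asm) AE_iff_measurable[OF _ refl]) (auto simp: Collect_conj_eq greaterThanLessThan_def greaterThan_def lessThan_def)
            with b show False by (simp add: ennreal_eq_0_iff)
          qed
        qed
      qed
    qed (simp add: d I_def)
  qed
qed

end

theory Submission
  imports Defs "HOL-Real_Asymp.Real_Asymp"
begin

text \<open>
  The equation is linear and its stationary law is explicit. Write \<open>h(x) = \<integral>\<^sub>x\<^sup>\<infinity> R(z)/z d\<pi>(z)\<close>;
  stationarity says that \<open>\<pi>\<close> has density \<open>x h(x)\<close>, hence \<open>h(x) = \<integral>\<^sub>x\<^sup>\<infinity> R h\<close>, and \<open>h > 0\<close>.
  The densities \<open>u\<^sub>t = dF\<^sub>t/d\<pi>\<close> then solve \<open>\<partial>\<^sub>t u + x \<partial>\<^sub>x u = 2 (Q u - u)\<close> with the Markov kernel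
  \<open>Q u(x) = h(x)\<inverse> \<integral>\<^sub>x\<^sup>\<infinity> R h u\<close>. This is the equation of the time-reversed process; its jump rate is
  the constant \<open>2\<close> even where \<open>R\<close> is unbounded, so that the mild form is harmless on bounded functions.

  Bounded nonnegative subsolutions contract in \<open>L\<^sup>1(\<pi>)\<close>. Applied to \<open>(u - B)\<^sup>+\<close>, this shows that the mass
  of \<open>u\<^sub>t\<close> above a level \<open>B\<close> does not increase, and, after a first jump has smoothed the law, that \<open>B\<close>
  can be chosen in terms of the tightness of the initial laws alone. As long as \<open>\<integral> (u - 1)\<^sup>+ d\<pi>\<close> is
  large, both \<open>(u - 1)\<^sup>+\<close> and \<open>(1 - u)\<^sup>+\<close> therefore have mass on a fixed compact set; in a fixed
  time one jump spreads both masses over a common interval, where a fixed amount cancels. So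
  \<open>\<integral> (u\<^sub>t - 1)\<^sup>+ d\<pi>\<close>, which bounds the total variation distance, tends to \<open>0\<close> uniformly.
\<close>

section \<open>Mild equation in logarithmic coordinates\<close>

text \<open>The rate \<open>2\<close> comes from the square in the equation. In the coordinate
  \<open>ln x\<close> growth is translation, the stationary density is
  \<open>exp (2 * x) * H x\<close>, and translation by \<open>t\<close> rescales its first factor by
  \<open>exp (2 * t)\<close>, which the factor \<open>exp (- 2 * t)\<close> of \<open>S\<close>
  undoes. Forward in time mass is lost at the possibly unbounded rate \<open>k / H\<close>; dividing
  by the stationary density trades this loss for the derivative of \<open>H\<close>.

  All quantities live in \<open>ennreal\<close>: Fubini then needs no integrability, truncated
  subtraction is the positive part, and negative terms are moved to the other side. Boundedness of
  the densities is what permits cancelling such terms later.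

  The obstacle before any contraction argument is regularity. The equation controls distribution
  functions at each time, and densities chosen time by time need not be measurable in time.
  Difference quotients give a jointly measurable version, the equation is differentiated along
  almost every characteristic, and the density is then redefined by the right-hand side of the mild
  equation, which makes that equation hold at every point.\<close>

lemma borel_measurable_curried:
  assumes "(\<lambda>p. y (fst p) (snd p)) \<in> borel_measurable (borel \<Otimes>\<^sub>M borel)"
    and "f \<in> M \<rightarrow>\<^sub>M borel" "g \<in> M \<rightarrow>\<^sub>M borel"
  shows "(\<lambda>p. y (f p) (g p)) \<in> borel_measurable M"
  using measurable_compose[OF measurable_Pair[OF assms(2,3)] assms(1)] by simp

lemma pred_interval [measurable (raw)]:
  fixes f g h :: "'a \<Rightarrow> real"
  assumes [measurable]: "f \<in> borel_measurable M" "g \<in> borel_measurable M" "h \<in> borel_measurable M"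
  shows "Measurable.pred M (\<lambda>x. f x \<in> {g x<..})" "Measurable.pred M (\<lambda>x. f x \<in> {g x..h x})"
    "Measurable.pred M (\<lambda>x. f x \<in> {g x<..h x})" "Measurable.pred M (\<lambda>x. f x \<in> {..g x})"
  by simp_all

lemma nn_integral_shift:
  fixes f :: "real \<Rightarrow> ennreal"
  assumes [measurable]: "f \<in> borel_measurable borel"
  shows "(\<integral>\<^sup>+x. f (x + a) \<partial>lborel) = (\<integral>\<^sup>+x. f x \<partial>lborel)"
  using nn_integral_real_affine[OF assms, of 1 a] by (simp add: add.commute)

lemma nn_integral_factor:
  assumes "\<And>x. f x = c * g x" "g \<in> borel_measurable M"
  shows "integral\<^sup>N M f = c * integral\<^sup>N M g"
  by (subst nn_integral_cmult[OF assms(2), symmetric]) (rule nn_integral_cong, rule assms(1))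

text \<open>In the original variable this is the integral of \<open>2 y dy\<close> from
  \<open>0\<close>. It is what matches the jump rate \<open>2\<close> with the weight
  \<open>exp (2 * x)\<close> in \<open>Q_balance\<close> and
  \<open>boundary_identity\<close>.\<close>

lemma nn_integral_exp_Iic: "(\<integral>\<^sup>+w. 2 * ennreal (exp (2 * w)) * indicator {..x} w \<partial>lborel) = ennreal (exp (2 * x))" for x :: real
proof -
  have "(\<integral>\<^sup>+w. 2 * ennreal (exp (2 * w)) * indicator {..x} w \<partial>lborel)
      = (\<integral>\<^sup>+w. ennreal (2 * exp (- 2 * w)) * indicator {- x..} w \<partial>lborel)"
    by (subst nn_integral_real_affine[of _ "-1" 0]) (auto simp: indicator_def ennreal_mult intro!: nn_integral_cong)
  also have "\<dots> = ennreal (0 - (- exp (- 2 * (- x))))"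
  proof (rule nn_integral_FTC_atLeast[where F="\<lambda>x. - exp (- 2 * x)"])
    have "((\<lambda>x::real. - exp (- 2 * x)) \<longlongrightarrow> - 0) at_top"
      by (intro tendsto_intros filterlim_compose[OF exp_at_bot])
         (auto simp: filterlim_uminus_at_bot intro!: filterlim_tendsto_pos_mult_at_top[OF tendsto_const] filterlim_ident)
    then show "((\<lambda>x::real. - exp (- 2 * x)) \<longlongrightarrow> 0) at_top" by simp
  qed (auto intro!: derivative_eq_intros)
  finally show ?thesis by simp
qed

lemma ennreal_le_add_diff: "(a::ennreal) \<le> b + (a - b)"
  by (auto simp: add_diff_self_ennreal)

lemma ennreal_inverse_antimono: "(b::ennreal) \<le> c \<Longrightarrow> inverse c \<le> inverse b"
  apply (cases b rule: ennreal_cases; cases c rule: ennreal_cases)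
     apply (auto simp: top_unique)
  subgoal for r q by (cases "r = 0") (auto simp: inverse_ennreal intro!: ennreal_leI le_imp_inverse_le)
  done

lemma ennreal_divide_left_mono: "(b::ennreal) \<le> c \<Longrightarrow> a / c \<le> a / b"
  unfolding divide_ennreal_def by (intro mult_left_mono ennreal_inverse_antimono) auto

lemma ennreal_mult_inverse_eq_1: "a \<noteq> 0 \<Longrightarrow> a < top \<Longrightarrow> a * inverse a = (1::ennreal)"
  using ennreal_divide_self[of a] by (simp add: divide_ennreal_def)

text \<open>
  With \<open>x\<close> the logarithm of the original variable and \<open>h\<close> as above, \<open>H x\<close> is \<open>h (exp x)\<close> and
  \<open>k x\<close> is \<open>exp x * R (exp x) * H x\<close>; the image of \<open>\<pi>\<close> has density \<open>exp (2 x) * H x\<close>.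
\<close>

locale stationary_profile =
  fixes k :: "real \<Rightarrow> ennreal" and H :: "real \<Rightarrow> ennreal"
  assumes k_measurable [measurable]: "k \<in> borel_measurable borel"
    and H_eq: "\<And>x. H x = (\<integral>\<^sup>+z. k z * indicator {x<..} z \<partial>lborel)"
    and H_pos: "\<And>x. 0 < H x"
    and H_finite: "\<And>x. H x < \<infinity>"
    and H_mass: "(\<integral>\<^sup>+x. ennreal (exp (2 * x)) * H x \<partial>lborel) = 1"
begin

section \<open>Regularity of the stationary profile\<close>

lemma H_measurable [measurable]: "H \<in> borel_measurable borel"
proof -
  have "(\<lambda>x. (\<integral>\<^sup>+z. k z * indicator {x<..} z \<partial>lborel)) \<in> borel_measurable borel"
    by measurable
  then show ?thesis by (simp add: H_eq[abs_def])
qed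

lemma H_antimono: "x \<le> y \<Longrightarrow> H y \<le> H x"
  unfolding H_eq[of x] H_eq[of y] by (intro nn_integral_mono) (auto simp: indicator_def)

text \<open>The integrated form of \<open>H' = - k\<close>, used along characteristics in
  \<open>S_balance\<close> and \<open>mild_from_integrated\<close>.\<close>

lemma H_split:
  assumes "x \<le> y"
  shows "H x = H y + (\<integral>\<^sup>+z. k z * indicator {x<..y} z \<partial>lborel)"
proof -
  have "H x = (\<integral>\<^sup>+z. k z * indicator {y<..} z + k z * indicator {x<..y} z \<partial>lborel)"
    unfolding H_eq[of x] using assms by (intro nn_integral_cong) (auto simp: indicator_def)
  then show ?thesis by (simp add: nn_integral_add H_eq[of y])
qed

text \<open>Finiteness of \<open>H 0\<close> makes \<open>k\<close> integrable on
  \<open>{0<..}\<close>, so dominated convergence applies along the integers; monotonicity fills the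
  gaps.\<close>

lemma H_tendsto_0: "(H \<longlongrightarrow> 0) at_top"
proof -
  have 1: "(\<lambda>n. H (real n)) \<longlonglongrightarrow> (\<integral>\<^sup>+(z::real). 0 \<partial>lborel)"
    unfolding H_eq
  proof (rule nn_integral_dominated_convergence[where w="\<lambda>z. k z * indicator {0<..} z"])
    show "(\<integral>\<^sup>+z. k z * indicator {0<..} z \<partial>lborel) < \<infinity>"
      using H_finite[of 0] by (simp add: H_eq)
    show "AE x in lborel. (\<lambda>i. k x * indicator {real i<..} x) \<longlonglongrightarrow> 0"
    proof (rule AE_I2)
      fix x :: real
      obtain n where n: "x \<le> real n" using real_arch_simple by blast
      have "eventually (\<lambda>i. k x * indicator {real i<..} x = 0) sequentially"
        using eventually_ge_at_top[of n]
        by eventually_elim (use n in \<open>auto simp: indicator_def\<close>)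
      then show "(\<lambda>i. k x * indicator {real i<..} x) \<longlonglongrightarrow> 0"
        by (rule tendsto_eventually)
    qed
  qed (auto simp: indicator_def)
  show ?thesis
  proof (rule order_tendstoI)
    fix a :: ennreal assume "0 < a"
    then obtain n where "H (real n) < a"
      using order_tendstoD(2)[OF 1, of a] by (auto simp: eventually_sequentially)
    then show "eventually (\<lambda>x. H x < a) at_top"
      unfolding eventually_at_top_linorder
      by (intro exI[of _ "real n"]) (auto intro: le_less_trans[OF H_antimono])
  qed simp
qed

definition stat :: "real measure" where
  "stat = density lborel (\<lambda>x. ennreal (exp (2 * x)) * H x)"

text \<open>
  The time-reversed process moves down at unit speed and jumps at rate \<open>2\<close>. \<open>S\<close> is the part of its
  semigroup without jumps, and \<open>u t = S t (u 0) + J u t\<close> is Duhamel's formula.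
\<close>

definition Q :: "(real \<Rightarrow> ennreal) \<Rightarrow> real \<Rightarrow> ennreal" where
  "Q f x = (\<integral>\<^sup>+z. f z * k z * indicator {x<..} z \<partial>lborel) / H x"

definition S :: "real \<Rightarrow> (real \<Rightarrow> ennreal) \<Rightarrow> real \<Rightarrow> ennreal" where
  "S t f x = ennreal (exp (- 2 * t)) * f (x - t)"

definition J :: "(real \<Rightarrow> real \<Rightarrow> ennreal) \<Rightarrow> real \<Rightarrow> real \<Rightarrow> ennreal" where
  "J y t x = (\<integral>\<^sup>+s. indicator {0..t} s * (2 * S (t - s) (Q (y s)) x) \<partial>lborel)"

abbreviation meas2 :: "(real \<Rightarrow> real \<Rightarrow> ennreal) \<Rightarrow> bool" where
  "meas2 y \<equiv> (\<lambda>p. y (fst p) (snd p)) \<in> borel_measurable (borel \<Otimes>\<^sub>M borel)"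

lemma sets_stat [measurable_cong, simp]: "sets stat = sets borel"
  by (simp add: stat_def)

lemma nn_integral_stat:
  assumes [measurable]: "f \<in> borel_measurable borel"
  shows "(\<integral>\<^sup>+x. f x \<partial>stat) = (\<integral>\<^sup>+x. ennreal (exp (2 * x)) * H x * f x \<partial>lborel)"
  unfolding stat_def by (subst nn_integral_density) (auto simp: mult_ac)

lemma measurable_slice: assumes y: "meas2 y" shows "y s \<in> borel_measurable borel"
proof -
  have "s \<in> space borel" by simp
  from borel_measurable_curried[OF y measurable_const[OF this] measurable_ident_sets[OF refl]]
  show ?thesis .
qed

lemma measurable_Q: assumes [measurable]: "f \<in> borel_measurable borel"
  shows "Q f \<in> borel_measurable borel"
  unfolding Q_def by measurable

lemma meas2_Q: assumes y: "meas2 y" shows "meas2 (\<lambda>s. Q (y s))"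
proof -
  note [measurable (raw)] = borel_measurable_curried[OF y]
  show ?thesis unfolding Q_def by measurable
qed

lemma meas2_S: assumes f: "f \<in> borel_measurable borel" shows "meas2 (\<lambda>t. S t f)"
  using f unfolding S_def by measurable

lemma meas2_J: assumes y: "meas2 y" shows "meas2 (J y)"
proof -
  note [measurable (raw)] = borel_measurable_curried[OF meas2_Q[OF y]]
  show ?thesis unfolding J_def S_def by measurable
qed

lemma measurable_S: "f \<in> borel_measurable borel \<Longrightarrow> S t f \<in> borel_measurable borel"
  by (rule measurable_slice[OF meas2_S])

lemma Q_add:
  assumes [measurable]: "f \<in> borel_measurable borel" "g \<in> borel_measurable borel"
  shows "Q (\<lambda>x. f x + g x) x = Q f x + Q g x"
  unfolding Q_def by (simp add: distrib_right nn_integral_add add_divide_distrib_ennreal)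

lemma Q_mono: "(\<And>x. f x \<le> g x) \<Longrightarrow> Q f x \<le> Q g x"
  unfolding Q_def by (intro divide_right_mono_ennreal nn_integral_mono mult_right_mono) auto

lemma Q_const: "Q (\<lambda>_. c) x = c"
proof -
  have "(\<integral>\<^sup>+z. c * k z * indicator {x<..} z \<partial>lborel) = c * H x"
    unfolding H_eq by (subst nn_integral_cmult[symmetric]) (auto simp: mult_ac)
  then show ?thesis unfolding Q_def using H_pos[of x] H_finite[of x]
    by (simp add: ennreal_mult_divide_eq)
qed

lemma J_add:
  assumes f: "meas2 f" and g: "meas2 g"
  shows "J (\<lambda>t x. f t x + g t x) t x = J f t x + J g t x"
proof -
  note [measurable (raw)] = borel_measurable_curried[OF meas2_Q[OF f]] borel_measurable_curried[OF meas2_Q[OF g]]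
  have *: "Q (\<lambda>x. f s x + g s x) x = Q (f s) x + Q (g s) x" for s x
    using measurable_slice f g by (intro Q_add) auto
  show ?thesis unfolding J_def S_def *
    by (simp add: distrib_left nn_integral_add)
qed

lemma J_mono:
  assumes "\<And>s x. 0 \<le> s \<Longrightarrow> s \<le> t \<Longrightarrow> f s x \<le> g s x"
  shows "J f t x \<le> J g t x"
  unfolding J_def S_def
  by (intro nn_integral_mono) (auto simp: indicator_def intro!: mult_left_mono Q_mono assms)

lemma S_add: "S t (\<lambda>x. f x + g x) x = S t f x + S t g x"
  by (simp add: S_def distrib_left)

text \<open>No jump has the weight \<open>exp (- 2 * t)\<close>, and since \<open>Q\<close>
  preserves constants the jump part carries the complementary weight. Constants therefore solve the
  mild equation, which is how bounds and levels are compared with solutions later.\<close>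

lemma const_mild:
  assumes "0 \<le> t"
  shows "S t (\<lambda>_. c) x + J (\<lambda>_ _. c) t x = c"
proof -
  have "(\<integral>\<^sup>+s. ennreal (2 * exp (- 2 * (t - s))) * indicator {0..t} s \<partial>lborel)
      = ennreal (exp (- 2 * (t - t)) - exp (- 2 * (t - 0)))"
    using assms by (intro nn_integral_FTC_Icc)
      (auto intro!: derivative_eq_intros)
  moreover have "J (\<lambda>_ _. c) t x = (\<integral>\<^sup>+s. c * (ennreal (2 * exp (- 2 * (t - s))) * indicator {0..t} s) \<partial>lborel)"
    unfolding J_def S_def Q_const by (intro nn_integral_cong) (simp add: ennreal_mult mult_ac)
  moreover have "\<dots> = c * (\<integral>\<^sup>+s. ennreal (2 * exp (- 2 * (t - s))) * indicator {0..t} s \<partial>lborel)"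
    by (rule nn_integral_cmult) measurable
  ultimately have "J (\<lambda>_ _. c) t x = c * ennreal (1 - exp (- 2 * t))" by simp
  then have "S t (\<lambda>_. c) x + J (\<lambda>_ _. c) t x = c * (ennreal (exp (- 2 * t)) + ennreal (1 - exp (- 2 * t)))"
    by (simp add: S_def distrib_left mult.commute)
  also have "ennreal (exp (- 2 * t)) + ennreal (1 - exp (- 2 * t)) = 1"
    using assms by (subst ennreal_plus[symmetric]) auto
  finally show ?thesis by simp
qed


text \<open>
  Integral of \<open>f\<close> times the jump rate of the forward process against the stationary law.
\<close>

definition flux :: "(real \<Rightarrow> ennreal) \<Rightarrow> ennreal" where
  "flux f = (\<integral>\<^sup>+x. ennreal (exp (2 * x)) * k x * f x \<partial>lborel)"

section \<open>Balance of mass and contraction of subsolutions\<close>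

lemma flux_mono: "(\<And>x. f x \<le> g x) \<Longrightarrow> flux f \<le> flux g"
  unfolding flux_def by (intro nn_integral_mono mult_left_mono) auto

lemma flux_add:
  assumes [measurable]: "f \<in> borel_measurable borel" "g \<in> borel_measurable borel"
  shows "flux (\<lambda>x. f x + g x) = flux f + flux g"
  unfolding flux_def by (simp add: distrib_left nn_integral_add)

lemma measurable_flux: assumes y: "meas2 y" shows "(\<lambda>s. flux (y s)) \<in> borel_measurable borel"
proof -
  note [measurable (raw)] = borel_measurable_curried[OF y]
  show ?thesis unfolding flux_def by measurable
qed

text \<open>Translation moves the weight onto \<open>H (x + t)\<close>, the exponential factors
  cancel, and \<open>H_split\<close> says that what \<open>H\<close> loses between \<open>x\<close>
  and \<open>x + t\<close> is the integral of \<open>k\<close>, that is, the flux emitted on the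
  way.\<close>

lemma S_balance:
  assumes f [measurable]: "f \<in> borel_measurable borel" and t: "0 \<le> t"
  shows "(\<integral>\<^sup>+x. S t f x \<partial>stat) + (\<integral>\<^sup>+s. indicator {0..t} s * flux (S s f) \<partial>lborel) = (\<integral>\<^sup>+x. f x \<partial>stat)"
proof -
  have shift: "ennreal (exp (2 * (x + s))) * a * S s f (x + s) = ennreal (exp (2 * x)) * f x * a" for x s a
  proof -
    have "ennreal (exp (2 * (x + s))) * ennreal (exp (- 2 * s)) = ennreal (exp (2 * x))"
      by (simp add: ennreal_mult[symmetric] exp_add[symmetric] algebra_simps)
    then have "ennreal (exp (2 * x)) * f x * a = (ennreal (exp (2 * (x + s))) * ennreal (exp (- 2 * s))) * f x * a"
      by simp
    then show ?thesis by (simp add: S_def mult_ac)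
  qed
  have "(\<integral>\<^sup>+x. S t f x \<partial>stat) = (\<integral>\<^sup>+x. ennreal (exp (2 * x)) * H x * S t f x \<partial>lborel)"
    by (rule nn_integral_stat) (rule measurable_S[OF f])
  also have "\<dots> = (\<integral>\<^sup>+x. ennreal (exp (2 * (x + t))) * H (x + t) * S t f (x + t) \<partial>lborel)"
    by (rule nn_integral_shift[symmetric]) (use measurable_S[OF f] in measurable)
  also have "\<dots> = (\<integral>\<^sup>+x. ennreal (exp (2 * x)) * f x * H (x + t) \<partial>lborel)"
    by (simp only: shift)
  finally have 1: "(\<integral>\<^sup>+x. S t f x \<partial>stat) = (\<integral>\<^sup>+x. ennreal (exp (2 * x)) * f x * H (x + t) \<partial>lborel)" .
  have flux_S: "flux (S s f) = (\<integral>\<^sup>+x. ennreal (exp (2 * x)) * f x * k (x + s) \<partial>lborel)" for s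
  proof -
    have "flux (S s f) = (\<integral>\<^sup>+x. ennreal (exp (2 * (x + s))) * k (x + s) * S s f (x + s) \<partial>lborel)"
      unfolding flux_def by (rule nn_integral_shift[symmetric]) (use measurable_S[OF f] in measurable)
    also have "\<dots> = (\<integral>\<^sup>+x. ennreal (exp (2 * x)) * f x * k (x + s) \<partial>lborel)"
      by (simp only: shift)
    finally show ?thesis .
  qed
  have inner: "(\<integral>\<^sup>+s. indicator {0..t} s * k (x + s) \<partial>lborel) = (\<integral>\<^sup>+z. k z * indicator {x<..x + t} z \<partial>lborel)" for x
  proof -
    have "(\<integral>\<^sup>+s. indicator {0..t} s * k (x + s) \<partial>lborel)
        = (\<integral>\<^sup>+s. k (s + x) * indicator {x..x + t} (s + x) \<partial>lborel)"
      by (intro nn_integral_cong) (auto simp: indicator_def add.commute)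
    also have "\<dots> = (\<integral>\<^sup>+z. k z * indicator {x..x + t} z \<partial>lborel)"
      by (rule nn_integral_shift[of "\<lambda>z. k z * indicator {x..x + t} z"]) simp
    also have "\<dots> = (\<integral>\<^sup>+z. k z * indicator {x<..x + t} z \<partial>lborel)"
      by (rule nn_integral_cong_AE) (use AE_lborel_singleton[of x] in \<open>auto simp: indicator_def\<close>)
    finally show ?thesis .
  qed
  have "(\<integral>\<^sup>+s. indicator {0..t} s * flux (S s f) \<partial>lborel)
      = (\<integral>\<^sup>+s. (\<integral>\<^sup>+x. indicator {0..t} s * (ennreal (exp (2 * x)) * f x * k (x + s)) \<partial>lborel) \<partial>lborel)"
    unfolding flux_S by (intro nn_integral_cong nn_integral_cmult[symmetric]) measurable
  also have "\<dots> = (\<integral>\<^sup>+x. (\<integral>\<^sup>+s. indicator {0..t} s * (ennreal (exp (2 * x)) * f x * k (x + s)) \<partial>lborel) \<partial>lborel)"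
    by (rule lborel_pair.Fubini') measurable
  also have "\<dots> = (\<integral>\<^sup>+x. ennreal (exp (2 * x)) * f x * (\<integral>\<^sup>+z. k z * indicator {x<..x + t} z \<partial>lborel) \<partial>lborel)"
    unfolding inner[symmetric]
    by (intro nn_integral_cong nn_integral_factor) (simp add: mult_ac, measurable)
  finally have 2: "(\<integral>\<^sup>+s. indicator {0..t} s * flux (S s f) \<partial>lborel) =
     (\<integral>\<^sup>+x. ennreal (exp (2 * x)) * f x * (\<integral>\<^sup>+z. k z * indicator {x<..x + t} z \<partial>lborel) \<partial>lborel)" .
  show ?thesis
    unfolding 1 2 nn_integral_stat[OF f] using t
    by (subst nn_integral_add[symmetric]; (measurable)?)
       (intro nn_integral_cong, subst H_split[of _ "_ + t"], auto simp: distrib_left mult_ac)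
qed

text \<open>By Fubini each \<open>z\<close> receives the weight of all \<open>x < z\<close>, and
  twice the integral of \<open>exp (2 * x)\<close> up to \<open>z\<close> is
  \<open>exp (2 * z)\<close>. So jumps put back the mass that the flux removes.\<close>

lemma Q_balance:
  assumes f [measurable]: "f \<in> borel_measurable borel"
  shows "2 * (\<integral>\<^sup>+x. Q f x \<partial>stat) = flux f"
proof -
  have half: "2 * (\<integral>\<^sup>+x. ennreal (exp (2 * x)) * indicator {x<..} z \<partial>lborel) = ennreal (exp (2 * z))" for z :: real
  proof -
    have "(\<integral>\<^sup>+x. ennreal (exp (2 * x)) * indicator {x<..} z \<partial>lborel)
        = (\<integral>\<^sup>+x. ennreal (exp (2 * x)) * indicator {..z} x \<partial>lborel)"
      by (rule nn_integral_cong_AE) (use AE_lborel_singleton[of z] in \<open>auto simp: indicator_def\<close>)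
    then show ?thesis
      using nn_integral_exp_Iic[of z] by (simp add: mult.assoc nn_integral_cmult)
  qed
  have "H x * (a / H x) = a" for x a
    using H_pos[of x] H_finite[of x] by (simp add: ennreal_times_divide mult.commute ennreal_mult_divide_eq)
  then have "(\<integral>\<^sup>+x. Q f x \<partial>stat) = (\<integral>\<^sup>+x. (\<integral>\<^sup>+z. ennreal (exp (2 * x)) * (f z * k z * indicator {x<..} z) \<partial>lborel) \<partial>lborel)"
    by (subst nn_integral_stat[OF measurable_Q[OF f]])
       (auto simp: Q_def mult.assoc nn_integral_cmult intro!: nn_integral_cong)
  also have "\<dots> = (\<integral>\<^sup>+z. (\<integral>\<^sup>+x. ennreal (exp (2 * x)) * (f z * k z * indicator {x<..} z) \<partial>lborel) \<partial>lborel)"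
    by (rule lborel_pair.Fubini') measurable
  also have "\<dots> = (\<integral>\<^sup>+z. f z * k z * (\<integral>\<^sup>+x. ennreal (exp (2 * x)) * indicator {x<..} z \<partial>lborel) \<partial>lborel)"
    by (intro nn_integral_cong nn_integral_factor) (simp add: mult_ac, measurable)
  finally have "2 * (\<integral>\<^sup>+x. Q f x \<partial>stat) = (\<integral>\<^sup>+z. 2 * (f z * k z * (\<integral>\<^sup>+x. ennreal (exp (2 * x)) * indicator {x<..} z \<partial>lborel)) \<partial>lborel)"
    by (subst nn_integral_cmult) simp_all
  also have "\<dots> = flux f"
    unfolding flux_def
  proof (rule nn_integral_cong)
    fix z
    have "2 * (f z * k z * a) = (2 * a) * k z * f z" for a
      by (simp add: mult_ac)
    then show "2 * (f z * k z * (\<integral>\<^sup>+x. ennreal (exp (2 * x)) * indicator {x<..} z \<partial>lborel))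
        = ennreal (exp (2 * z)) * k z * f z"
      by (simp only: half)
  qed
  finally show ?thesis .
qed

lemma emeasure_stat: "emeasure stat (space stat) = 1"
  using nn_integral_stat[of "\<lambda>_. 1"] H_mass by simp

lemma flux_const: "flux (\<lambda>_. c) = 2 * c"
  using Q_balance[of "\<lambda>_. c"] emeasure_stat by (simp add: Q_const[abs_def])

text \<open>
  Integrating the inequality at time \<open>T\<close>, and its flux over \<open>[0, T]\<close>, gives by \<open>S_balance\<close> and
  \<open>Q_balance\<close> the same total flux on both sides. It is finite because \<open>y\<close> is bounded, and cancels.
\<close>

lemma subsolution_contraction:
  assumes y: "meas2 y" and f: "f \<in> borel_measurable borel" and T: "0 \<le> T"
    and K: "K < \<infinity>" and bound: "\<And>t x. 0 \<le> t \<Longrightarrow> t \<le> T \<Longrightarrow> y t x \<le> K"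
    and sub: "\<And>t x. 0 \<le> t \<Longrightarrow> t \<le> T \<Longrightarrow> y t x \<le> S t f x + J y t x"
  shows "(\<integral>\<^sup>+x. y T x \<partial>stat) \<le> (\<integral>\<^sup>+x. f x \<partial>stat)"
proof -
  note slice = measurable_slice
  note [measurable (raw)] = borel_measurable_curried[OF meas2_Q[OF y]]
  have [measurable]: "(\<lambda>t. flux (y t)) \<in> borel_measurable borel"
    "(\<lambda>t. flux (S t f)) \<in> borel_measurable borel"
    "(\<lambda>t. flux (J y t)) \<in> borel_measurable borel"
    by (intro measurable_flux y meas2_S meas2_J f)+
  define X where "X = (\<integral>\<^sup>+t. indicator {0..T} t * flux (y t) \<partial>lborel)"
  have "X \<le> (\<integral>\<^sup>+t. indicator {0..T} t * (2 * K) \<partial>lborel)"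
    unfolding X_def flux_const[symmetric]
    by (intro nn_integral_mono) (auto simp: indicator_def intro!: flux_mono bound)
  also have "\<dots> = 2 * K * ennreal T"
    using T by (subst nn_integral_multc) (auto simp: mult_ac)
  also have "\<dots> < \<infinity>" using K by (simp add: ennreal_mult_less_top)
  finally have X_fin: "X < \<infinity>" .
  have flux_J: "flux (J y t) = (\<integral>\<^sup>+s. indicator {0..t} s * (2 * flux (S (t - s) (Q (y s)))) \<partial>lborel)" for t
  proof -
    have "flux (J y t) = (\<integral>\<^sup>+x. (\<integral>\<^sup>+s. ennreal (exp (2 * x)) * k x * (indicator {0..t} s * (2 * S (t - s) (Q (y s)) x)) \<partial>lborel) \<partial>lborel)"
      unfolding flux_def J_def S_def
      by (intro nn_integral_cong nn_integral_cmult[symmetric]) measurable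
    also have "\<dots> = (\<integral>\<^sup>+s. (\<integral>\<^sup>+x. ennreal (exp (2 * x)) * k x * (indicator {0..t} s * (2 * S (t - s) (Q (y s)) x)) \<partial>lborel) \<partial>lborel)"
      unfolding S_def by (rule lborel_pair.Fubini') measurable
    also have "\<dots> = (\<integral>\<^sup>+s. indicator {0..t} s * (2 * flux (S (t - s) (Q (y s)))) \<partial>lborel)"
      unfolding flux_def S_def
      unfolding mult.assoc[symmetric, of "indicator _ _" 2]
      by (intro nn_integral_cong nn_integral_factor) (simp add: mult_ac, measurable)
    finally show ?thesis .
  qed
  have stat_J: "(\<integral>\<^sup>+x. J y T x \<partial>stat) = (\<integral>\<^sup>+s. indicator {0..T} s * (2 * (\<integral>\<^sup>+x. S (T - s) (Q (y s)) x \<partial>stat)) \<partial>lborel)"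
  proof -
    have "(\<integral>\<^sup>+x. J y T x \<partial>stat) = (\<integral>\<^sup>+x. (\<integral>\<^sup>+s. ennreal (exp (2 * x)) * H x * (indicator {0..T} s * (2 * S (T - s) (Q (y s)) x)) \<partial>lborel) \<partial>lborel)"
      unfolding nn_integral_stat[OF slice[OF meas2_J[OF y]]] unfolding J_def S_def
      by (intro nn_integral_cong nn_integral_cmult[symmetric]) measurable
    also have "\<dots> = (\<integral>\<^sup>+s. (\<integral>\<^sup>+x. ennreal (exp (2 * x)) * H x * (indicator {0..T} s * (2 * S (T - s) (Q (y s)) x)) \<partial>lborel) \<partial>lborel)"
      unfolding S_def by (rule lborel_pair.Fubini') measurable
    also have "\<dots> = (\<integral>\<^sup>+s. indicator {0..T} s * (2 * (\<integral>\<^sup>+x. S (T - s) (Q (y s)) x \<partial>stat)) \<partial>lborel)"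
      unfolding nn_integral_stat[OF measurable_S[OF measurable_Q[OF slice[OF y]]]]
      unfolding S_def mult.assoc[symmetric, of "indicator _ _" 2]
      by (intro nn_integral_cong nn_integral_factor) (simp add: mult_ac, measurable)
    finally show ?thesis .
  qed
  have flux2 [measurable]: "(\<lambda>p. flux (S (fst p - snd p) (Q (y (snd p))))) \<in> borel_measurable (borel \<Otimes>\<^sub>M borel)"
    unfolding flux_def S_def by measurable
  note [measurable (raw)] = borel_measurable_curried[of "\<lambda>t s. flux (S (t - s) (Q (y s)))", OF flux2]
  have "(\<lambda>p. \<integral>\<^sup>+x. S (fst p - snd p) (Q (y (snd p))) x \<partial>stat) \<in> borel_measurable (borel \<Otimes>\<^sub>M borel)"
    unfolding nn_integral_stat[OF measurable_S[OF measurable_Q[OF slice[OF y]]]] unfolding S_def by measurable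
  note [measurable (raw)] = borel_measurable_curried[of "\<lambda>t s. \<integral>\<^sup>+x. S (t - s) (Q (y s)) x \<partial>stat", OF this]
  have [measurable]: "(\<lambda>r. flux (S r (Q (y s)))) \<in> borel_measurable borel" for s
    by (intro measurable_flux meas2_S measurable_Q slice y)
  \<comment> \<open>Exchange the two times and set \<open>r = t - s\<close>, the time elapsed since
    the jump at \<open>s\<close>.\<close>
  have int_flux_J: "(\<integral>\<^sup>+t. indicator {0..T} t * flux (J y t) \<partial>lborel)
      = (\<integral>\<^sup>+s. indicator {0..T} s * (2 * (\<integral>\<^sup>+r. indicator {0..T - s} r * flux (S r (Q (y s))) \<partial>lborel)) \<partial>lborel)"
  proof -
    have "(\<integral>\<^sup>+t. indicator {0..T} t * flux (J y t) \<partial>lborel)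
       = (\<integral>\<^sup>+t. (\<integral>\<^sup>+s. indicator {0..T} t * (indicator {0..t} s * (2 * flux (S (t - s) (Q (y s))))) \<partial>lborel) \<partial>lborel)"
      unfolding flux_J by (intro nn_integral_cong nn_integral_cmult[symmetric]) measurable
    also have "\<dots> = (\<integral>\<^sup>+s. (\<integral>\<^sup>+t. indicator {0..T} t * (indicator {0..t} s * (2 * flux (S (t - s) (Q (y s))))) \<partial>lborel) \<partial>lborel)"
      by (rule lborel_pair.Fubini') measurable
    also have "\<dots> = (\<integral>\<^sup>+s. (\<integral>\<^sup>+r. indicator {0..T} s * 2 * (indicator {0..T - s} r * flux (S r (Q (y s)))) \<partial>lborel) \<partial>lborel)"
    proof (rule nn_integral_cong)
      fix s
      have "(\<integral>\<^sup>+t. indicator {0..T} t * (indicator {0..t} s * (2 * flux (S (t - s) (Q (y s))))) \<partial>lborel)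
         = (\<integral>\<^sup>+r. indicator {0..T} (r + s) * (indicator {0..r + s} s * (2 * flux (S (r + s - s) (Q (y s))))) \<partial>lborel)"
        by (rule nn_integral_shift[symmetric]) measurable
      also have "\<dots> = (\<integral>\<^sup>+r. indicator {0..T} s * 2 * (indicator {0..T - s} r * flux (S r (Q (y s)))) \<partial>lborel)"
        by (intro nn_integral_cong) (auto simp: indicator_def)
      finally show "(\<integral>\<^sup>+t. indicator {0..T} t * (indicator {0..t} s * (2 * flux (S (t - s) (Q (y s))))) \<partial>lborel)
         = (\<integral>\<^sup>+r. indicator {0..T} s * 2 * (indicator {0..T - s} r * flux (S r (Q (y s)))) \<partial>lborel)" .
    qed
    also have "\<dots> = (\<integral>\<^sup>+s. indicator {0..T} s * (2 * (\<integral>\<^sup>+r. indicator {0..T - s} r * flux (S r (Q (y s))) \<partial>lborel)) \<partial>lborel)"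
      unfolding mult.assoc[symmetric, of "indicator _ _" 2]
      by (intro nn_integral_cong nn_integral_factor refl) measurable
    finally show ?thesis .
  qed
  have [measurable]: "(\<lambda>s. \<integral>\<^sup>+r. indicator {0..T - s} r * flux (S r (Q (y s))) \<partial>lborel) \<in> borel_measurable borel"
    unfolding flux_def S_def by measurable
  \<comment> \<open>Mass created at time \<open>s\<close> has either not jumped again by
    \<open>T\<close> or has been emitted before; \<open>S_balance\<close> on
    \<open>[0, T - s]\<close> adds the two, and \<open>Q_balance\<close> identifies the created mass
    with the flux of \<open>y s\<close>.\<close>
  have total: "(\<integral>\<^sup>+x. J y T x \<partial>stat) + (\<integral>\<^sup>+t. indicator {0..T} t * flux (J y t) \<partial>lborel) = X"
  proof -
    have "(\<integral>\<^sup>+x. J y T x \<partial>stat) + (\<integral>\<^sup>+t. indicator {0..T} t * flux (J y t) \<partial>lborel)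
      = (\<integral>\<^sup>+s. indicator {0..T} s * (2 * (\<integral>\<^sup>+x. S (T - s) (Q (y s)) x \<partial>stat)) +
           indicator {0..T} s * (2 * (\<integral>\<^sup>+r. indicator {0..T - s} r * flux (S r (Q (y s))) \<partial>lborel)) \<partial>lborel)"
      unfolding stat_J int_flux_J by (rule nn_integral_add[symmetric]) measurable
    also have "\<dots> = X"
      unfolding X_def
    proof (rule nn_integral_cong)
      fix s
      show "indicator {0..T} s * (2 * (\<integral>\<^sup>+x. S (T - s) (Q (y s)) x \<partial>stat)) +
           indicator {0..T} s * (2 * (\<integral>\<^sup>+r. indicator {0..T - s} r * flux (S r (Q (y s))) \<partial>lborel))
          = indicator {0..T} s * flux (y s)"
      proof (cases "s \<in> {0..T}")
        case True
        then have "2 * ((\<integral>\<^sup>+x. S (T - s) (Q (y s)) x \<partial>stat) + (\<integral>\<^sup>+r. indicator {0..T - s} r * flux (S r (Q (y s))) \<partial>lborel))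
            = flux (y s)"
          using S_balance[OF measurable_Q[OF slice[OF y, of s]], of "T - s"] Q_balance[OF slice[OF y, of s]]
          by simp
        with True show ?thesis unfolding distrib_left by simp
      qed simp
    qed
    finally show ?thesis .
  qed
  have "(\<integral>\<^sup>+x. y T x \<partial>stat) \<le> (\<integral>\<^sup>+x. S T f x + J y T x \<partial>stat)"
    using T by (intro nn_integral_mono sub) auto
  also have "\<dots> = (\<integral>\<^sup>+x. S T f x \<partial>stat) + (\<integral>\<^sup>+x. J y T x \<partial>stat)"
    using measurable_S[OF f, of T] slice[OF meas2_J[OF y], of T] by (intro nn_integral_add) auto
  finally have A: "(\<integral>\<^sup>+x. y T x \<partial>stat) \<le> (\<integral>\<^sup>+x. S T f x \<partial>stat) + (\<integral>\<^sup>+x. J y T x \<partial>stat)" .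
  have "X \<le> (\<integral>\<^sup>+t. indicator {0..T} t * flux (S t f) + indicator {0..T} t * flux (J y t) \<partial>lborel)"
    unfolding X_def
  proof (rule nn_integral_mono)
    fix t
    have "flux (y t) \<le> flux (\<lambda>x. S t f x + J y t x)" if "0 \<le> t" "t \<le> T"
      using that by (intro flux_mono sub) auto
    then show "indicator {0..T} t * flux (y t) \<le> indicator {0..T} t * flux (S t f) + indicator {0..T} t * flux (J y t)"
      using flux_add[OF measurable_S[OF f] slice[OF meas2_J[OF y]], of t t] by (auto simp: indicator_def)
  qed
  also have "\<dots> = (\<integral>\<^sup>+t. indicator {0..T} t * flux (S t f) \<partial>lborel) + (\<integral>\<^sup>+t. indicator {0..T} t * flux (J y t) \<partial>lborel)"
    by (rule nn_integral_add) measurable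
  finally have B: "X \<le> \<dots>" .
  have "(\<integral>\<^sup>+x. y T x \<partial>stat) + X \<le> ((\<integral>\<^sup>+x. S T f x \<partial>stat) + (\<integral>\<^sup>+t. indicator {0..T} t * flux (S t f) \<partial>lborel)) +
      ((\<integral>\<^sup>+x. J y T x \<partial>stat) + (\<integral>\<^sup>+t. indicator {0..T} t * flux (J y t) \<partial>lborel))"
    using add_mono[OF A B] by (simp add: add_ac)
  also have "\<dots> = (\<integral>\<^sup>+x. f x \<partial>stat) + X"
    unfolding total S_balance[OF f T] ..
  finally show ?thesis
    using X_fin by (auto simp: add.commute[of _ X])
qed

subsection \<open>Decay of the excess over the stationary density\<close>

text \<open>The equation is imposed at every point and not almost everywhere, so that it yields the
  pointwise inequalities which \<open>subsolution_contraction\<close> takes as input.\<close>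

definition mild :: "ennreal \<Rightarrow> (real \<Rightarrow> real \<Rightarrow> ennreal) \<Rightarrow> bool" where
  "mild K u \<longleftrightarrow> meas2 u \<and> K < \<infinity> \<and> (\<forall>t\<ge>0. \<forall>x. u t x \<le> K) \<and>
     (\<forall>t\<ge>0. \<forall>x. u t x = S t (u 0) x + J u t x)"

lemma mildD:
  assumes "mild K u"
  shows "meas2 u" "K < \<infinity>" "0 \<le> t \<Longrightarrow> u t x \<le> K" "0 \<le> t \<Longrightarrow> u t x = S t (u 0) x + J u t x"
  using assms unfolding mild_def by blast+

text \<open>The semigroup law of \<open>S\<close> allows splitting \<open>J\<close> at time
  \<open>r\<close>; the instant \<open>s = r\<close> counted in both pieces is a null set. Estimates
  that start at time \<open>0\<close> can thus be restarted at any time.\<close>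

lemma mild_shift:
  assumes u: "mild K u" and r: "0 \<le> r"
  shows "mild K (\<lambda>t. u (r + t))"
proof -
  note m = mildD(1)[OF u]
  note [measurable (raw)] = borel_measurable_curried[OF m] borel_measurable_curried[OF meas2_Q[OF m]]
  have S_S: "S (p + q) f x = S p (S q f) x" for p q f x
  proof -
    have "exp (- 2 * (p + q)) = exp (- 2 * p) * exp (- 2 * q)"
      by (simp add: exp_add[symmetric] algebra_simps)
    then show ?thesis by (simp add: S_def ennreal_mult mult.assoc diff_diff_eq)
  qed
  have J_split: "J u (r + t) x = S t (J u r) x + J (\<lambda>t. u (r + t)) t x" if t: "0 \<le> t" for t x
  proof -
    have "J u (r + t) x = (\<integral>\<^sup>+s. indicator {0..r} s * (2 * S (r + t - s) (Q (u s)) x) +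
        indicator {r..r + t} s * (2 * S (r + t - s) (Q (u s)) x) \<partial>lborel)"
      unfolding J_def using r t
      by (intro nn_integral_cong_AE) (use AE_lborel_singleton[of r] in \<open>auto simp: indicator_def\<close>)
    also have "\<dots> = (\<integral>\<^sup>+s. indicator {0..r} s * (2 * S (r + t - s) (Q (u s)) x) \<partial>lborel) +
        (\<integral>\<^sup>+s. indicator {r..r + t} s * (2 * S (r + t - s) (Q (u s)) x) \<partial>lborel)"
      unfolding S_def by (rule nn_integral_add) measurable
    also have "(\<integral>\<^sup>+s. indicator {0..r} s * (2 * S (r + t - s) (Q (u s)) x) \<partial>lborel) = S t (J u r) x"
      unfolding S_def[of t] J_def
    proof (rule nn_integral_factor)
      show "indicator {0..r} s * (2 * S (r + t - s) (Q (u s)) x) =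
         ennreal (exp (- 2 * t)) * (indicator {0..r} s * (2 * S (r - s) (Q (u s)) (x - t)))" for s
      proof -
        have "S (r + t - s) (Q (u s)) x = ennreal (exp (- 2 * t)) * S (r - s) (Q (u s)) (x - t)"
          using S_S[of t "r - s" "Q (u s)" x] by (simp only: S_def[of t]) (simp add: algebra_simps)
        then show ?thesis by (simp only: mult_ac)
      qed
    qed (unfold S_def, measurable)
    also have "(\<integral>\<^sup>+s. indicator {r..r + t} s * (2 * S (r + t - s) (Q (u s)) x) \<partial>lborel)
      = (\<integral>\<^sup>+s. indicator {r..r + t} (s + r) * (2 * S (r + t - (s + r)) (Q (u (s + r))) x) \<partial>lborel)"
      by (rule nn_integral_shift[symmetric]) (unfold S_def, measurable)
    also have "\<dots> = J (\<lambda>t. u (r + t)) t x"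
      unfolding J_def by (intro nn_integral_cong) (auto simp: indicator_def add.commute)
    finally show ?thesis .
  qed
  have "u (r + t) x = S t (u (r + 0)) x + J (\<lambda>t. u (r + t)) t x" if t: "0 \<le> t" for t x
  proof -
    have ur: "u r = (\<lambda>x. S r (u 0) x + J u r x)"
      using mildD(4)[OF u r] by (rule ext)
    have "u (r + t) x = S (t + r) (u 0) x + J u (r + t) x"
      using mildD(4)[OF u, of "r + t" x] r t by (simp add: add.commute)
    also have "\<dots> = S t (u r) x + J (\<lambda>t. u (r + t)) t x"
      unfolding J_split[OF t] S_S by (subst ur) (simp add: S_add add.assoc)
    finally show ?thesis by simp
  qed
  moreover have "meas2 (\<lambda>t. u (r + t))" by measurable
  moreover have "u (r + t) x \<le> K" if "0 \<le> t" for t x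
    using r that by (intro mildD(3)[OF u]) simp
  ultimately show ?thesis using mildD(2)[OF u] unfolding mild_def by blast
qed

lemma S_mono: "(\<And>x. f x \<le> g x) \<Longrightarrow> S t f x \<le> S t g x"
  unfolding S_def by (intro mult_left_mono) auto

lemma S_le: assumes "\<And>x. f x \<le> K" "0 \<le> t" shows "S t f x \<le> K"
  using const_mild[of t K x] S_mono[of f "\<lambda>_. K" t x] assms
  by (metis add_increasing2 dual_order.trans le_iff_add)

lemma J_le: assumes "\<And>s x. 0 \<le> s \<Longrightarrow> s \<le> t \<Longrightarrow> f s x \<le> K" "0 \<le> t" shows "J f t x \<le> K"
  using const_mild[of t K x] J_mono[of t f "\<lambda>_ _. K" x] assms
  by (metis add.commute dual_order.trans le_iff_add)

text \<open>From \<open>u \<le> B + (u - B)\<close>, monotonicity and linearity of \<open>S\<close>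
  and \<open>J\<close>, and \<open>const_mild\<close> for \<open>B\<close>, the excess over
  \<open>B\<close> is a subsolution; finiteness of \<open>B\<close> permits the
  cancellation.\<close>

lemma excess_contraction:
  assumes u: "mild K u" and B: "B < \<infinity>" and T: "0 \<le> T"
  shows "(\<integral>\<^sup>+x. u T x - B \<partial>stat) \<le> (\<integral>\<^sup>+x. u 0 x - B \<partial>stat)"
proof (rule subsolution_contraction[where K=K])
  note m = mildD(1)[OF u]
  note [measurable (raw)] = borel_measurable_curried[OF m]
  show m2: "meas2 (\<lambda>t x. u t x - B)" by measurable
  show "(\<lambda>x. u 0 x - B) \<in> borel_measurable borel" by measurable
  show "K < \<infinity>" by (rule mildD(2)[OF u])
  show "u t x - B \<le> K" if "0 \<le> t" for t x
    by (intro ennreal_diff_le_mono_left mildD(3)[OF u] that)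
  show "u t x - B \<le> S t (\<lambda>x. u 0 x - B) x + J (\<lambda>t x. u t x - B) t x" if t: "0 \<le> t" for t x
  proof -
    have "u t x = S t (u 0) x + J u t x" by (rule mildD(4)[OF u t])
    also have "\<dots> \<le> S t (\<lambda>x. B + (u 0 x - B)) x + J (\<lambda>t x. B + (u t x - B)) t x"
      by (intro add_mono S_mono J_mono ennreal_le_add_diff)
    also have "\<dots> = (S t (\<lambda>_. B) x + J (\<lambda>_ _. B) t x) + (S t (\<lambda>x. u 0 x - B) x + J (\<lambda>t x. u t x - B) t x)"
      using m2 by (simp add: S_add J_add add_ac)
    also have "\<dots> = B + (S t (\<lambda>x. u 0 x - B) x + J (\<lambda>t x. u t x - B) t x)"
      using const_mild[OF t] by simp
    finally show ?thesis using B by (auto simp: ennreal_minus_le_iff)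
  qed
qed fact

text \<open>
  Let \<open>p\<close> and \<open>q\<close> collect what at most one jump makes of \<open>f\<close> and \<open>g\<close>. The remaining part \<open>r\<close> of the
  excess makes \<open>p + r\<close> a subsolution started from \<open>f\<close>, while the excess itself is at most
  \<open>p - min p q + r\<close>.
\<close>

lemma excess_decrement:
  assumes u: "mild K u" and T: "0 \<le> T"
  defines "f \<equiv> \<lambda>x. u 0 x - 1" and "g \<equiv> \<lambda>x. 1 - u 0 x"
  shows "(\<integral>\<^sup>+x. u T x - 1 \<partial>stat) + (\<integral>\<^sup>+x. min (J (\<lambda>s. S s f) T x) (J (\<lambda>s. S s g) T x) \<partial>stat)
    \<le> (\<integral>\<^sup>+x. f x \<partial>stat)"
proof -
  have m: "meas2 u" and K: "K < \<infinity>" and uK: "\<And>t x. 0 \<le> t \<Longrightarrow> u t x \<le> K"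
    and eq: "\<And>t x. 0 \<le> t \<Longrightarrow> u t x = S t (u 0) x + J u t x"
    using mildD[OF u] by auto
  have [measurable]: "f \<in> borel_measurable borel" "g \<in> borel_measurable borel"
    unfolding f_def g_def using measurable_slice[OF m, of 0] by measurable
  have mS: "meas2 (\<lambda>s. S s f)" "meas2 (\<lambda>s. S s g)" by (simp_all add: meas2_S)
  note mJ = mS[THEN meas2_J]
  define p where "p t x = S t f x + J (\<lambda>s. S s f) t x" for t x
  define q where "q t x = S t g x + J (\<lambda>s. S s g) t x" for t x
  define r where "r t x = (u t x + q t x) - (1 + p t x)" for t x
  note [measurable (raw)] = borel_measurable_curried[OF m] mS[THEN borel_measurable_curried]
    mJ[THEN borel_measurable_curried]
  have mp: "meas2 p" and mq: "meas2 q" and mr: "meas2 r"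
    unfolding r_def p_def q_def by measurable
  have fK: "f x \<le> K" for x unfolding f_def using uK[of 0 x] by (simp add: ennreal_diff_le_mono_left)
  have g1: "g x \<le> 1" for x unfolding g_def by simp
  have pK: "p t x \<le> K + K" if "0 \<le> t" for t x
    unfolding p_def using that by (intro add_mono J_le S_le fK) auto
  have qK: "q t x \<le> 1 + 1" if "0 \<le> t" for t x
    unfolding q_def using that by (intro add_mono J_le S_le g1) auto
  have p_fin: "p t x < top" if "0 \<le> t" for t x
    using pK[OF that, of x] K by (auto simp: ennreal_add_less_top intro: le_less_trans)
  \<comment> \<open>The starting values match since \<open>u 0 + g = 1 + f\<close>. Inside
    \<open>J\<close>, \<open>u s + S s g\<close> is at most \<open>u s + q s\<close>, hence at most
    \<open>1 + p s + r s\<close>; unfolding \<open>p s\<close> once and using that \<open>1\<close>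
    is a mild solution leaves exactly \<open>1 + p t\<close> outside the double jump term.\<close>
  have rec: "u t x + q t x \<le> (1 + p t x) + J (\<lambda>s x. J (\<lambda>s. S s f) s x + r s x) t x" if t: "0 \<le> t" for t x
  proof -
    have u0: "u 0 x + g x = 1 + f x" for x
      unfolding f_def g_def by (auto simp: add_diff_self_ennreal)
    have le: "u s x + S s g x \<le> 1 + S s f x + (J (\<lambda>s. S s f) s x + r s x)" for s x
    proof -
      have "u s x + S s g x \<le> u s x + q s x" unfolding q_def by (simp add: add_left_mono)
      also have "\<dots> \<le> (1 + p s x) + r s x" unfolding r_def by (rule ennreal_le_add_diff)
      finally show ?thesis by (simp add: p_def add_ac)
    qed
    have one: "1 = S t (\<lambda>_. 1) x + J (\<lambda>_ _. 1) t x" using const_mild[OF t] by simp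
    have m1: "meas2 (\<lambda>s x. J (\<lambda>s. S s f) s x + r s x)" and m2: "meas2 (\<lambda>s x. 1 + S s f x)"
      using mr by measurable
    have "u t x + q t x = (S t (u 0) x + S t g x) + (J u t x + J (\<lambda>s. S s g) t x)"
      unfolding q_def by (subst eq[OF t]) (simp add: add_ac)
    also have "\<dots> = S t (\<lambda>x. 1 + f x) x + J (\<lambda>s x. u s x + S s g x) t x"
      by (simp add: S_add[symmetric] J_add[symmetric] m mS u0)
    also have "\<dots> \<le> S t (\<lambda>x. 1 + f x) x + J (\<lambda>s x. 1 + S s f x + (J (\<lambda>s. S s f) s x + r s x)) t x"
      by (intro add_left_mono J_mono le)
    also have "\<dots> = (1 + p t x) + J (\<lambda>s x. J (\<lambda>s. S s f) s x + r s x) t x"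
      unfolding J_add[OF m2 m1] p_def by (subst one) (simp add: S_add J_add mS add_ac)
    finally show ?thesis .
  qed
  have "(\<integral>\<^sup>+x. p T x + r T x \<partial>stat) \<le> (\<integral>\<^sup>+x. f x \<partial>stat)"
  proof (rule subsolution_contraction[where K="K + K + (K + (1 + 1))"])
    show "meas2 (\<lambda>t x. p t x + r t x)" using mp mr by measurable
    show "p t x + r t x \<le> K + K + (K + (1 + 1))" if "0 \<le> t" for t x
      unfolding r_def using pK[OF that] qK[OF that] uK[OF that]
      by (intro add_mono) (auto intro!: ennreal_diff_le_mono_left add_mono)
    show "p t x + r t x \<le> S t f x + J (\<lambda>t x. p t x + r t x) t x" if t: "0 \<le> t" for t x
    proof -
      have m1: "meas2 (\<lambda>s x. J (\<lambda>s. S s f) s x + r s x)" using mr by measurable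
      have "r t x \<le> J (\<lambda>s x. J (\<lambda>s. S s f) s x + r s x) t x"
        using rec[OF t, of x] p_fin[OF t, of x] unfolding r_def
        by (auto simp: ennreal_minus_le_iff)
      then have "p t x + r t x \<le> S t f x + (J (\<lambda>s. S s f) t x + J (\<lambda>s x. J (\<lambda>s. S s f) s x + r s x) t x)"
        unfolding p_def by (simp add: add_ac add_left_mono)
      also have "\<dots> = S t f x + J (\<lambda>t x. p t x + r t x) t x"
        unfolding J_add[OF mS(1) m1, symmetric] p_def by (simp add: add_ac)
      finally show ?thesis .
    qed
  qed (use K T in \<open>simp_all\<close>)
  \<comment> \<open>Subtraction is truncated, hence two cases. If \<open>u T x \<ge> 1\<close>,
    adding \<open>1\<close> reduces the claim to
    \<open>u + min p q \<le> u + q \<le> 1 + p + r\<close>; otherwise the excess is \<open>0\<close>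
    and the minimum is below \<open>p\<close>.\<close>
  moreover have "(u T x - 1) + min (J (\<lambda>s. S s f) T x) (J (\<lambda>s. S s g) T x) \<le> p T x + r T x" for x
  proof -
    let ?m = "min (J (\<lambda>s. S s f) T x) (J (\<lambda>s. S s g) T x)"
    have mp: "?m \<le> p T x" and mq: "?m \<le> q T x"
      unfolding p_def q_def by (auto intro: min.coboundedI1 min.coboundedI2 add_increasing)
    show ?thesis
    proof (cases "1 \<le> u T x")
      case True
      have "1 + ((u T x - 1) + ?m) = u T x + ?m"
        using True by (simp add: add.assoc[symmetric] add_diff_self_ennreal)
      also have "\<dots> \<le> u T x + q T x" by (intro add_left_mono mq)
      also have "\<dots> \<le> 1 + p T x + r T x" unfolding r_def by (rule ennreal_le_add_diff)
      finally show ?thesis by (simp add: add.assoc)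
    next
      case False
      then have "u T x - 1 = 0" by (auto simp: diff_eq_0_iff_ennreal not_le less_imp_le intro: less_trans[OF _ ennreal_one_less_top])
      then show ?thesis using mp by (simp add: add_increasing2)
    qed
  qed
  then have "(\<integral>\<^sup>+x. (u T x - 1) + min (J (\<lambda>s. S s f) T x) (J (\<lambda>s. S s g) T x) \<partial>stat) \<le> (\<integral>\<^sup>+x. p T x + r T x \<partial>stat)"
    by (rule nn_integral_mono)
  moreover have "(\<integral>\<^sup>+x. (u T x - 1) + min (J (\<lambda>s. S s f) T x) (J (\<lambda>s. S s g) T x) \<partial>stat)
     = (\<integral>\<^sup>+x. u T x - 1 \<partial>stat) + (\<integral>\<^sup>+x. min (J (\<lambda>s. S s f) T x) (J (\<lambda>s. S s g) T x) \<partial>stat)"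
    by (rule nn_integral_add) measurable
  ultimately show ?thesis by simp
qed


section \<open>Effect of a single jump: smoothing and spreading of mass\<close>

lemma nn_integral_reflect:
  assumes f [measurable]: "f \<in> borel_measurable borel"
  shows "(\<integral>\<^sup>+s. f (z - s) \<partial>lborel) = (\<integral>\<^sup>+s. f s \<partial>(lborel :: real measure))"
  using nn_integral_real_affine[of f "-1" z] by simp

text \<open>Exactly one jump smooths: integrating \<open>f (z - s)\<close> over the jump time
  \<open>s\<close> replaces the pointwise values of \<open>f\<close> by its integral, so an
  integrable \<open>f\<close> with bounded support acquires a bounded one-jump part.\<close>

lemma J_S_upper:
  assumes f [measurable]: "f \<in> borel_measurable borel"
    and supp: "\<And>x. x \<notin> {a..b} \<Longrightarrow> f x = 0"
    and t: "t \<le> T"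
  shows "J (\<lambda>s. S s f) t x \<le> 2 / H (b + T) * (H (a - 1) * (\<integral>\<^sup>+x. f x \<partial>lborel))"
proof -
  note [measurable (raw)] = borel_measurable_curried[OF meas2_Q[OF meas2_S[OF f]]]
  \<comment> \<open>For \<open>y\<close> at or above \<open>b + T\<close> the integrand vanishes,
    and below it \<open>H y\<close> is at least \<open>H (b + T)\<close>. Every contributing
    \<open>z\<close> is at least \<open>a\<close>, hence strictly above \<open>a - 1\<close>, as the
    open half-line in \<open>H_eq\<close> requires.\<close>
  have Q_le: "Q (S s f) y \<le> (\<integral>\<^sup>+z. k z * indicator {a - 1<..} z * f (z - s) \<partial>lborel) / H (b + T)"
    if s: "0 \<le> s" "s \<le> T" for s y
  proof (cases "y < b + T")
    case True
    have "ennreal (exp (- 2 * s)) \<le> 1" using s by simp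
    from mult_right_mono[OF this] have "S s f z \<le> f (z - s)" for z
      unfolding S_def by (metis mult_1 zero_le)
    moreover have "f (z - s) = 0" if "z \<le> a - 1" for z using supp[of "z - s"] s that by auto
    ultimately have "S s f z * k z * indicator {y<..} z \<le> k z * indicator {a - 1<..} z * f (z - s)" for z
      by (cases "z \<le> a - 1") (auto simp: indicator_def mult.commute[of "k z"] S_def intro!: mult_right_mono)
    then have "Q (S s f) y \<le> (\<integral>\<^sup>+z. k z * indicator {a - 1<..} z * f (z - s) \<partial>lborel) / H y"
      unfolding Q_def by (intro divide_right_mono_ennreal nn_integral_mono)
    also have "\<dots> \<le> (\<integral>\<^sup>+z. k z * indicator {a - 1<..} z * f (z - s) \<partial>lborel) / H (b + T)"
      using True by (intro ennreal_divide_left_mono H_antimono) simp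
    finally show ?thesis .
  next
    case False
    have *: "S s f z * k z * indicator {y<..} z = 0" for z
      using False s supp[of "z - s"] by (auto simp: indicator_def S_def)
    show ?thesis unfolding Q_def * by simp
  qed
  have "J (\<lambda>s. S s f) t x \<le> (\<integral>\<^sup>+s. (\<integral>\<^sup>+z. k z * indicator {a - 1<..} z * f (z - s) \<partial>lborel) * (2 / H (b + T)) \<partial>lborel)"
    unfolding J_def
  proof (rule nn_integral_mono)
    fix s
    have "S (t - s) (Q (S s f)) x \<le> (\<integral>\<^sup>+z. k z * indicator {a - 1<..} z * f (z - s) \<partial>lborel) / H (b + T)"
      if s: "0 \<le> s" "s \<le> t"
      using s t by (intro S_le Q_le) auto
    from mult_left_mono[OF this, of 2]
    show "indicator {0..t} s * (2 * S (t - s) (Q (S s f)) x) \<le> (\<integral>\<^sup>+z. k z * indicator {a - 1<..} z * f (z - s) \<partial>lborel) * (2 / H (b + T))"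
      by (auto simp: indicator_def divide_ennreal_def mult_ac)
  qed
  also have "\<dots> = (\<integral>\<^sup>+s. (\<integral>\<^sup>+z. k z * indicator {a - 1<..} z * f (z - s) \<partial>lborel) \<partial>lborel) * (2 / H (b + T))"
    by (rule nn_integral_multc) measurable
  also have "(\<integral>\<^sup>+s. (\<integral>\<^sup>+z. k z * indicator {a - 1<..} z * f (z - s) \<partial>lborel) \<partial>lborel)
     = (\<integral>\<^sup>+z. (\<integral>\<^sup>+s. k z * indicator {a - 1<..} z * f (z - s) \<partial>lborel) \<partial>lborel)"
    by (rule lborel_pair.Fubini') measurable
  also have "\<dots> = (\<integral>\<^sup>+z. k z * indicator {a - 1<..} z * (\<integral>\<^sup>+x. f x \<partial>lborel) \<partial>lborel)"
    by (intro nn_integral_cong, subst nn_integral_cmult) (simp_all add: nn_integral_reflect[OF f])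
  also have "\<dots> = H (a - 1) * (\<integral>\<^sup>+x. f x \<partial>lborel)"
    unfolding H_eq[of "a - 1"] by (rule nn_integral_multc) measurable
  finally show ?thesis by (simp add: mult.commute)
qed

text \<open>Both factors of the stationary density are monotone, in opposite directions, so on
  \<open>{a..b}\<close> each is bounded by its value at an end point. The next lemma is the matching
  upper bound.\<close>

lemma lborel_le_stat:
  assumes f [measurable]: "f \<in> borel_measurable borel"
    and supp: "\<And>x. x \<notin> {a..b} \<Longrightarrow> f x = 0"
  shows "ennreal (exp (2 * a)) * H b * (\<integral>\<^sup>+x. f x \<partial>lborel) \<le> (\<integral>\<^sup>+x. f x \<partial>stat)"
proof -
  have "ennreal (exp (2 * a)) * H b * f x \<le> ennreal (exp (2 * x)) * H x * f x" for x
  proof (cases "x \<in> {a..b}")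
    case True
    then show ?thesis by (intro mult_right_mono mult_mono H_antimono) (auto intro: ennreal_leI)
  qed (simp add: supp)
  then show ?thesis
    unfolding nn_integral_stat[OF f] by (subst nn_integral_cmult[symmetric]) (auto intro!: nn_integral_mono)
qed

lemma stat_le_lborel:
  assumes f [measurable]: "f \<in> borel_measurable borel"
    and supp: "\<And>x. x \<notin> {a..b} \<Longrightarrow> f x = 0"
  shows "(\<integral>\<^sup>+x. f x \<partial>stat) \<le> ennreal (exp (2 * b)) * H a * (\<integral>\<^sup>+x. f x \<partial>lborel)"
proof -
  have "ennreal (exp (2 * x)) * H x * f x \<le> ennreal (exp (2 * b)) * H a * f x" for x
  proof (cases "x \<in> {a..b}")
    case True
    then show ?thesis by (intro mult_right_mono mult_mono H_antimono) (auto intro: ennreal_leI)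
  qed (simp add: supp)
  then show ?thesis
    unfolding nn_integral_stat[OF f] by (subst nn_integral_cmult[symmetric]) (auto intro!: nn_integral_mono)
qed

text \<open>Mass at \<open>x\<close> that has not jumped by time \<open>T\<close> is the fraction
  \<open>H (x + T) / H x\<close>, which on \<open>{a..b}\<close> is at most
  \<open>H (a + T) / H b\<close>. This tends to \<open>0\<close> as \<open>T\<close> grows.\<close>

lemma S_upper:
  assumes f [measurable]: "f \<in> borel_measurable borel" and T: "0 \<le> T"
    and supp: "\<And>x. x \<notin> {a..b} \<Longrightarrow> f x = 0"
  shows "(\<integral>\<^sup>+x. S T f x \<partial>stat) \<le> H (a + T) / H b * (\<integral>\<^sup>+x. f x \<partial>stat)"
proof -
  have eq: "ennreal (exp (2 * (x + T))) * ennreal (exp (- 2 * T)) = ennreal (exp (2 * x))" for x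
    by (simp add: ennreal_mult[symmetric] exp_add[symmetric] algebra_simps)
  have "(\<integral>\<^sup>+x. S T f x \<partial>stat) = (\<integral>\<^sup>+x. ennreal (exp (2 * x)) * H x * S T f x \<partial>lborel)"
    by (rule nn_integral_stat) (rule measurable_S[OF f])
  also have "\<dots> = (\<integral>\<^sup>+x. ennreal (exp (2 * (x + T))) * H (x + T) * S T f (x + T) \<partial>lborel)"
    by (rule nn_integral_shift[symmetric]) (use measurable_S[OF f] in measurable)
  also have "\<dots> \<le> (\<integral>\<^sup>+x. H (a + T) / H b * (ennreal (exp (2 * x)) * H x * f x) \<partial>lborel)"
  proof (rule nn_integral_mono)
    fix x
    have "ennreal (exp (2 * (x + T))) * H (x + T) * S T f (x + T) = (ennreal (exp (2 * (x + T))) * ennreal (exp (- 2 * T))) * (H (x + T) * f x)"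
      unfolding S_def by (simp add: mult_ac)
    also have "\<dots> = ennreal (exp (2 * x)) * (H (x + T) * f x)" unfolding eq ..
    finally have 1: "ennreal (exp (2 * (x + T))) * H (x + T) * S T f (x + T) = ennreal (exp (2 * x)) * (H (x + T) * f x)" .
    have "H (x + T) * f x \<le> H (a + T) / H b * (H x * f x)"
    proof (cases "x \<in> {a..b}")
      case True
      have "H b / H b = 1" using H_pos[of b] H_finite[of b] by simp
      then have "1 \<le> H x / H b"
        using divide_right_mono_ennreal[OF H_antimono[of x b], of "H b"] True by simp
      then have "H (x + T) * 1 \<le> H (a + T) * (H x / H b)"
        using True by (intro mult_mono H_antimono) auto
      from mult_right_mono[OF this, of "f x"]
      show ?thesis by (simp add: divide_ennreal_def mult_ac)
    qed (simp add: supp)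
    then have "ennreal (exp (2 * x)) * (H (x + T) * f x) \<le> ennreal (exp (2 * x)) * (H (a + T) / H b * (H x * f x))"
      by (rule mult_left_mono) simp
    also have "\<dots> = H (a + T) / H b * (ennreal (exp (2 * x)) * H x * f x)"
      by (simp only: mult_ac)
    finally show "ennreal (exp (2 * (x + T))) * H (x + T) * S T f (x + T) \<le> H (a + T) / H b * (ennreal (exp (2 * x)) * H x * f x)"
      unfolding 1 .
  qed
  also have "\<dots> = H (a + T) / H b * (\<integral>\<^sup>+x. f x \<partial>stat)"
    unfolding nn_integral_stat[OF f] by (rule nn_integral_cmult) measurable
  finally show ?thesis .
qed

text \<open>The level absorbs everything that stems from a jump of \<open>f1\<close>. Above it there
  remain only the part of \<open>f1\<close> that never jumped and what stems from \<open>f2\<close>: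
  with \<open>e\<close> the excess of \<open>J u\<close> over the level, \<open>S f2 + e\<close> is
  a subsolution started from \<open>f2\<close>.\<close>

lemma excess_bounded_part:
  assumes u: "mild K u" and f1 [measurable]: "f1 \<in> borel_measurable borel" and f2 [measurable]: "f2 \<in> borel_measurable borel"
    and u0: "\<And>x. u 0 x = f1 x + f2 x"
    and T: "0 \<le> T" and C: "\<And>t x. 0 \<le> t \<Longrightarrow> t \<le> T \<Longrightarrow> J (\<lambda>s. S s f1) t x \<le> C" and C_fin: "C < \<infinity>"
  shows "(\<integral>\<^sup>+x. u T x - ennreal (exp (2 * T)) * C \<partial>stat) \<le> (\<integral>\<^sup>+x. S T f1 x \<partial>stat) + (\<integral>\<^sup>+x. f2 x \<partial>stat)"
proof -
  note m = mildD(1)[OF u]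
  have u0': "u 0 = (\<lambda>x. f1 x + f2 x)" by (rule ext) (rule u0)
  define B where "B = ennreal (exp (2 * T)) * C"
  have B: "B < \<infinity>" unfolding B_def using C_fin by (simp add: ennreal_mult_less_top)
  define e where "e t x = J u t x - B" for t x
  have mJ: "meas2 (J u)" by (rule meas2_J[OF m])
  have mS: "meas2 (\<lambda>s. S s f1)" "meas2 (\<lambda>s. S s f2)" by (simp_all add: meas2_S)
  note [measurable (raw)] = borel_measurable_curried[OF mJ] mS[THEN borel_measurable_curried]
  have me: "meas2 e" unfolding e_def by measurable
  have f2K: "f2 x \<le> K" for x
    using mildD(3)[OF u, of 0 x] u0[of x] by (metis add.commute le_iff_add order.trans order_refl)
  have JK: "J u t x \<le> K" if "0 \<le> t" for t x using that by (intro J_le mildD(3)[OF u])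
  \<comment> \<open>The factor \<open>exp (2 * T)\<close> is chosen so that
    \<open>C \<le> S t B\<close> for all \<open>t \<le> T\<close>; then \<open>const_mild\<close>
    makes \<open>B\<close> a supersolution with source \<open>C\<close>.\<close>
  have sup: "C + J (\<lambda>_ _. B) t x \<le> B" if t: "0 \<le> t" "t \<le> T" for t x
  proof -
    have "(1::ennreal) \<le> ennreal (exp (- 2 * t)) * ennreal (exp (2 * T))"
      using t by (simp add: ennreal_mult[symmetric] exp_add[symmetric] ennreal_1[symmetric] del: ennreal_1)
    from mult_right_mono[OF this, of C] have "C \<le> S t (\<lambda>_. B) x"
      unfolding S_def B_def by (simp add: mult.assoc)
    then show ?thesis using const_mild[OF t(1), of B x] by (metis add_right_mono)
  qed
  have rec: "e t x \<le> J (\<lambda>s x. S s f2 x + e s x) t x" if t: "0 \<le> t" "t \<le> T" for t x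
  proof -
    have "J u t x \<le> J (\<lambda>s x. S s f1 x + (S s f2 x + (B + e s x))) t x"
    proof (rule J_mono)
      fix s x :: real assume "0 \<le> s"
      then have "u s x = S s (\<lambda>x. f1 x + f2 x) x + J u s x"
        using mildD(4)[OF u, of s x] unfolding u0' by simp
      also have "\<dots> \<le> S s (\<lambda>x. f1 x + f2 x) x + (B + e s x)"
        unfolding e_def by (intro add_left_mono ennreal_le_add_diff)
      finally show "u s x \<le> S s f1 x + (S s f2 x + (B + e s x))"
        by (simp add: S_add add.assoc)
    qed
    also have "\<dots> = J (\<lambda>s. S s f1) t x + J (\<lambda>_ _. B) t x + J (\<lambda>s x. S s f2 x + e s x) t x"
    proof -
      have m1: "meas2 (\<lambda>s x. B + e s x)" and m2: "meas2 (\<lambda>s x. S s f2 x + (B + e s x))"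
        and m3: "meas2 (\<lambda>(s::real) (x::real). B)"
        using me by measurable
      show ?thesis
        unfolding J_add[OF mS(1) m2] J_add[OF mS(2) m1] J_add[OF m3 me] J_add[OF mS(2) me]
        by (simp add: add_ac)
    qed
    also have "\<dots> \<le> C + J (\<lambda>_ _. B) t x + J (\<lambda>s x. S s f2 x + e s x) t x"
      by (intro add_right_mono C t)
    also have "\<dots> \<le> B + J (\<lambda>s x. S s f2 x + e s x) t x"
      by (intro add_right_mono sup t)
    finally show ?thesis unfolding e_def using B by (auto simp: ennreal_minus_le_iff)
  qed
  have contr: "(\<integral>\<^sup>+x. S T f2 x + e T x \<partial>stat) \<le> (\<integral>\<^sup>+x. f2 x \<partial>stat)"
  proof (rule subsolution_contraction[where K="K + K"])
    show "meas2 (\<lambda>t x. S t f2 x + e t x)" using me by measurable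
    show "S t f2 x + e t x \<le> K + K" if "0 \<le> t" for t x
      unfolding e_def using that JK by (intro add_mono S_le f2K ennreal_diff_le_mono_left) auto
  qed (use T mildD(2)[OF u] rec in \<open>auto intro: add_left_mono\<close>)
  have "u T x - B \<le> S T f1 x + (S T f2 x + e T x)" for x
  proof -
    have "u T x = S T (\<lambda>x. f1 x + f2 x) x + J u T x"
      using mildD(4)[OF u T, of x] unfolding u0' .
    also have "\<dots> \<le> S T (\<lambda>x. f1 x + f2 x) x + (B + e T x)"
      unfolding e_def by (intro add_left_mono ennreal_le_add_diff)
    also have "\<dots> = B + (S T f1 x + (S T f2 x + e T x))"
      by (simp add: S_add add_ac)
    finally show ?thesis using B by (auto simp: ennreal_minus_le_iff)
  qed
  then have "(\<integral>\<^sup>+x. u T x - B \<partial>stat) \<le> (\<integral>\<^sup>+x. S T f1 x + (S T f2 x + e T x) \<partial>stat)"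
    by (rule nn_integral_mono)
  also have "\<dots> = (\<integral>\<^sup>+x. S T f1 x \<partial>stat) + (\<integral>\<^sup>+x. S T f2 x + e T x \<partial>stat)"
    using measurable_slice[OF me, of T] measurable_S[OF f1, of T] measurable_S[OF f2, of T]
    by (intro nn_integral_add) simp_all
  finally show ?thesis
    unfolding B_def[symmetric] using add_left_mono[OF contr] by (rule order_trans)
qed

text \<open>Mass at a point of \<open>{-L..L}\<close> is carried up to some \<open>z\<close> in
  \<open>{L<..M}\<close>, where it jumps. The jump time \<open>s\<close>, the distance between the
  two points, lies between \<open>0\<close> and \<open>L + M\<close>, so \<open>T\<close>
  accommodates all of them. Fubini separates the integral of \<open>k\<close> from that of
  \<open>f\<close>, and the bound does not depend on \<open>x\<close>.\<close>

lemma J_S_lower: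
  assumes f [measurable]: "f \<in> borel_measurable borel"
    and LM: "0 < L" "L < M" and x: "0 < x" "x < M"
  defines "T \<equiv> L + M"
  shows "2 * ennreal (exp (- 2 * T)) * (\<integral>\<^sup>+z. k z * indicator {L<..M} z \<partial>lborel) / H (- T) *
    (\<integral>\<^sup>+x. f x * indicator {-L..L} x \<partial>lborel) \<le> J (\<lambda>s. S s f) T x"
proof -
  let ?c = "2 * ennreal (exp (- 2 * T)) / H (- T)"
  let ?g = "\<lambda>s z. k z * indicator {L<..M} z * (f (z - s) * indicator {-L..L} (z - s))"
  note [measurable (raw)] = borel_measurable_curried[OF meas2_Q[OF meas2_S[OF f]]]
  have "(\<integral>\<^sup>+z. k z * indicator {L<..M} z \<partial>lborel) * (\<integral>\<^sup>+x. f x * indicator {-L..L} x \<partial>lborel)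
     = (\<integral>\<^sup>+z. k z * indicator {L<..M} z * (\<integral>\<^sup>+x. f x * indicator {-L..L} x \<partial>lborel) \<partial>lborel)"
    by (rule nn_integral_multc[symmetric]) measurable
  also have "\<dots> = (\<integral>\<^sup>+z. (\<integral>\<^sup>+s. ?g s z \<partial>lborel) \<partial>lborel)"
    by (intro nn_integral_cong, subst nn_integral_cmult)
       (simp_all add: nn_integral_reflect[of "\<lambda>x. f x * indicator {-L..L} x"])
  also have "\<dots> = (\<integral>\<^sup>+s. (\<integral>\<^sup>+z. ?g s z \<partial>lborel) \<partial>lborel)"
    by (rule lborel_pair.Fubini') measurable
  finally have "?c * ((\<integral>\<^sup>+z. k z * indicator {L<..M} z \<partial>lborel) * (\<integral>\<^sup>+x. f x * indicator {-L..L} x \<partial>lborel))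
     = ?c * (\<integral>\<^sup>+s. (\<integral>\<^sup>+z. ?g s z \<partial>lborel) \<partial>lborel)" by simp
  also have "\<dots> = (\<integral>\<^sup>+s. ?c * (\<integral>\<^sup>+z. ?g s z \<partial>lborel) \<partial>lborel)"
    by (rule nn_integral_cmult[symmetric]) measurable
  also have "\<dots> \<le> J (\<lambda>s. S s f) T x"
    unfolding J_def
  proof (rule nn_integral_mono)
    fix s
    show "?c * (\<integral>\<^sup>+z. ?g s z \<partial>lborel) \<le> indicator {0..T} s * (2 * S (T - s) (Q (S s f)) x)"
    proof (cases "s \<in> {0..T}")
      case False
      then have "?g s z = 0" for z unfolding T_def by (auto simp: indicator_def)
      then have "(\<integral>\<^sup>+z. ?g s z \<partial>lborel) = (\<integral>\<^sup>+(z::real). 0 \<partial>lborel)"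
        by (intro nn_integral_cong) blast
      then show ?thesis by simp
    next
      case True
      \<comment> \<open>If \<open>z - s \<ge> - L\<close>, then \<open>?y < s - L \<le> z\<close>
        because \<open>x < M\<close>, so the indicator in \<open>Q\<close> is \<open>1\<close>; and
        \<open>?y > - T\<close> bounds \<open>H ?y\<close> by \<open>H (- T)\<close>.\<close>
      let ?y = "x - (T - s)"
      have "ennreal (exp (- 2 * s)) * (\<integral>\<^sup>+z. ?g s z \<partial>lborel) \<le> (\<integral>\<^sup>+z. S s f z * k z * indicator {?y<..} z \<partial>lborel)"
        using x True unfolding T_def S_def
        by (subst nn_integral_cmult[symmetric]; (measurable)?)
           (intro nn_integral_mono, auto simp: indicator_def mult_ac)
      then have "ennreal (exp (- 2 * s)) * (\<integral>\<^sup>+z. ?g s z \<partial>lborel) / H ?y \<le> Q (S s f) ?y"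
        unfolding Q_def by (rule divide_right_mono_ennreal)
      moreover have "ennreal (exp (- 2 * s)) * (\<integral>\<^sup>+z. ?g s z \<partial>lborel) / H (- T) \<le> ennreal (exp (- 2 * s)) * (\<integral>\<^sup>+z. ?g s z \<partial>lborel) / H ?y"
        using x True by (intro ennreal_divide_left_mono H_antimono) auto
      ultimately have "ennreal (exp (- 2 * s)) * (\<integral>\<^sup>+z. ?g s z \<partial>lborel) / H (- T) \<le> Q (S s f) ?y" by simp
      from mult_left_mono[OF this, of "2 * ennreal (exp (- 2 * (T - s)))"]
      have "2 * (ennreal (exp (- 2 * (T - s))) * ennreal (exp (- 2 * s))) * (\<integral>\<^sup>+z. ?g s z \<partial>lborel) / H (- T) \<le> 2 * S (T - s) (Q (S s f)) x"
        unfolding S_def[of "T - s"] by (simp add: ennreal_times_divide mult.assoc)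
      also have "ennreal (exp (- 2 * (T - s))) * ennreal (exp (- 2 * s)) = ennreal (exp (- 2 * T))"
        by (simp add: ennreal_mult[symmetric] exp_add[symmetric] algebra_simps)
      finally show ?thesis using True by (simp add: divide_ennreal_def mult_ac)
    qed
  qed
  finally show ?thesis by (simp add: divide_ennreal_def mult_ac)
qed

section \<open>Uniform choice of level, window and decrement\<close>

lemma H_nonzero [simp]: "H x \<noteq> 0" and H_not_top [simp]: "H x \<noteq> top"
  using H_pos[of x] H_finite[of x] by auto

lemma prob_space_stat: "prob_space stat"
  by (rule prob_spaceI) (rule emeasure_stat)

lemma emeasure_stat_Ioo_pos:
  assumes "0 < (M::real)"
  shows "0 < emeasure stat {0<..<M}"
proof (rule ccontr)
  assume "\<not> 0 < emeasure stat {0<..<M}"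
  then have "(\<integral>\<^sup>+x. indicator {0<..<M} x \<partial>stat) = 0" by simp
  then have "AE x in lborel. ennreal (exp (2 * x)) * H x * indicator {0<..<M} x = 0"
    by (subst (asm) nn_integral_stat; (subst (asm) nn_integral_0_iff_AE)?) auto
  then have "AE x in lborel. x \<notin> {0<..<M}"
    by eventually_elim (auto simp: indicator_def split: if_splits)
  then have "emeasure lborel {0<..<M} = 0"
    by (subst (asm) AE_iff_measurable[OF _ refl]) (auto simp: Collect_conj_eq greaterThanLessThan_def greaterThan_def lessThan_def)
  with assms show False by simp
qed

lemma stat_tail:
  assumes "0 < (e::ennreal)"
  shows "\<exists>L>0. emeasure stat (- {-L..L}) < e"
proof -
  interpret prob_space stat by (rule prob_space_stat)
  have "(\<lambda>n. emeasure stat (- {- real n..real n})) \<longlonglongrightarrow> emeasure stat (\<Inter>n. - {- real n..real n})"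
    by (rule Lim_emeasure_decseq) (auto simp: decseq_def)
  also have "(\<Inter>n. - {- real n..real n}) = {}"
  proof -
    have "\<exists>n. x \<in> {- real n..real n}" for x :: real
      using real_arch_simple[of "\<bar>x\<bar>"] by (auto simp: abs_le_iff) (smt (verit))
    then show ?thesis by blast
  qed
  finally have "eventually (\<lambda>n. emeasure stat (- {- real n..real n}) < e) sequentially"
    using assms by (intro order_tendstoD) auto
  then obtain N where N: "\<And>n. n \<ge> N \<Longrightarrow> emeasure stat (- {- real n..real n}) < e"
    by (auto simp: eventually_sequentially)
  show ?thesis by (intro exI[of _ "real (Suc N)"] conjI N) auto
qed

text \<open>Split the initial density at a window \<open>{a..b}\<close> given by tightness. The
  outside contributes \<open>d / 2\<close>, the unjumped inside another \<open>d / 2\<close>, and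
  the rest lies below a level computed from \<open>a\<close>, \<open>b\<close> and \<open>T\<close>
  alone, hence common to all of \<open>U\<close>. \<open>excess_contraction\<close> preserves the
  bound after \<open>T\<close>.\<close>

lemma excess_eventually_small:
  assumes tight: "\<And>e::real. 0 < e \<Longrightarrow> \<exists>a b. \<forall>u\<in>U. (\<integral>\<^sup>+x. u 0 x * indicator (- {a..b}) x \<partial>stat) \<le> ennreal e"
    and mild: "\<And>u. u \<in> U \<Longrightarrow> \<exists>K. mild K u"
    and mass: "\<And>u t. u \<in> U \<Longrightarrow> 0 \<le> t \<Longrightarrow> (\<integral>\<^sup>+x. u t x \<partial>stat) = 1"
    and d: "0 < d"
  shows "\<exists>T\<ge>0. \<exists>B::real. 0 \<le> B \<and> (\<forall>u\<in>U. \<forall>t\<ge>T. (\<integral>\<^sup>+x. u t x - ennreal B \<partial>stat) \<le> ennreal d)"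
proof -
  obtain a b where ab: "\<And>u. u \<in> U \<Longrightarrow> (\<integral>\<^sup>+x. u 0 x * indicator (- {a..b}) x \<partial>stat) \<le> ennreal (d / 2)"
    using tight[of "d / 2"] d by auto
  have Hb: "0 < ennreal (d / 2) * H b" using d H_pos[of b] by (simp add: ennreal_zero_less_mult_iff)
  have "eventually (\<lambda>x. H x < ennreal (d / 2) * H b) at_top"
    using H_tendsto_0 Hb by (rule order_tendstoD)
  then obtain N where N: "\<And>x. N \<le> x \<Longrightarrow> H x < ennreal (d / 2) * H b"
    by (auto simp: eventually_at_top_linorder)
  \<comment> \<open>Then \<open>a + T \<ge> N\<close>, so the share of unjumped mass in
    \<open>S_upper\<close> is at most \<open>d / 2\<close>.\<close>
  define T where "T = max 0 (N - a)"
  have T: "0 \<le> T" and HT: "H (a + T) / H b \<le> ennreal (d / 2)"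
    using N[of "a + T"] H_pos[of b] H_finite[of b] by (auto simp: T_def intro!: less_imp_le simp: divide_less_ennreal)
  \<comment> \<open>The bound of \<open>J_S_upper\<close> with the Lebesgue integral of
    \<open>f1\<close> replaced by the largest value that total mass \<open>1\<close> allows, by
    \<open>lborel_le_stat\<close>.\<close>
  define C where "C = 2 / H (b + T) * (H (a - 1) * inverse (ennreal (exp (2 * a)) * H b))"
  have C: "C < \<infinity>"
    unfolding C_def
    by (auto simp: ennreal_mult_less_top divide_ennreal_def less_top[symmetric] ennreal_mult_eq_top_iff)
  define B where "B = enn2real (ennreal (exp (2 * T)) * C)"
  have B: "ennreal B = ennreal (exp (2 * T)) * C"
    unfolding B_def using C by (intro ennreal_enn2real) (simp add: ennreal_mult_less_top)
  have "(\<integral>\<^sup>+x. u t x - ennreal B \<partial>stat) \<le> ennreal d" if u: "u \<in> U" and t: "T \<le> t" for u t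
  proof -
    obtain K where K: "mild K u" using mild[OF u] by auto
    note [measurable (raw)] = borel_measurable_curried[OF mildD(1)[OF K]]
    define f1 where "f1 x = u 0 x * indicator {a..b} x" for x
    define f2 where "f2 x = u 0 x * indicator (- {a..b}) x" for x
    have [measurable]: "f1 \<in> borel_measurable borel" "f2 \<in> borel_measurable borel"
      unfolding f1_def f2_def by measurable
    have f1_le: "(\<integral>\<^sup>+x. f1 x \<partial>stat) \<le> 1"
      unfolding f1_def mass[OF u order_refl, symmetric]
      by (intro nn_integral_mono) (auto simp: indicator_def)
    have "ennreal (exp (2 * a)) * H b * (\<integral>\<^sup>+x. f1 x \<partial>lborel) \<le> 1"
      using lborel_le_stat[of f1 a b] f1_le by (auto simp: f1_def)
    then have f1_leb: "(\<integral>\<^sup>+x. f1 x \<partial>lborel) \<le> inverse (ennreal (exp (2 * a)) * H b)"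
    proof -
      let ?c = "ennreal (exp (2 * a)) * H b"
      assume "?c * (\<integral>\<^sup>+x. f1 x \<partial>lborel) \<le> 1"
      from mult_right_mono[OF this, of "inverse ?c"]
      have "(?c * inverse ?c) * (\<integral>\<^sup>+x. f1 x \<partial>lborel) \<le> inverse ?c" by (simp add: mult_ac)
      moreover have "?c * inverse ?c = 1"
        by (intro ennreal_mult_inverse_eq_1) (auto simp: ennreal_mult_less_top less_top[symmetric] ennreal_mult_eq_top_iff)
      ultimately show ?thesis by simp
    qed
    have "(\<integral>\<^sup>+x. u T x - ennreal (exp (2 * T)) * C \<partial>stat) \<le> (\<integral>\<^sup>+x. S T f1 x \<partial>stat) + (\<integral>\<^sup>+x. f2 x \<partial>stat)"
    proof (rule excess_bounded_part[OF K])
      show "u 0 x = f1 x + f2 x" for x by (auto simp: f1_def f2_def indicator_def)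
      show "J (\<lambda>s. S s f1) t x \<le> C" if "t \<le> T" for t x
      proof -
        have "J (\<lambda>s. S s f1) t x \<le> 2 / H (b + T) * (H (a - 1) * (\<integral>\<^sup>+x. f1 x \<partial>lborel))"
          by (rule J_S_upper) (auto simp: f1_def that)
        also have "\<dots> \<le> C" unfolding C_def by (intro mult_left_mono f1_leb) auto
        finally show ?thesis .
      qed
    qed (use T C in auto)
    also have "(\<integral>\<^sup>+x. S T f1 x \<partial>stat) \<le> H (a + T) / H b * (\<integral>\<^sup>+x. f1 x \<partial>stat)"
      by (rule S_upper) (auto simp: f1_def T)
    also have "\<dots> \<le> ennreal (d / 2) * 1"
      by (intro mult_mono HT f1_le) auto
    also have "(\<integral>\<^sup>+x. f2 x \<partial>stat) \<le> ennreal (d / 2)"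
      unfolding f2_def by (rule ab[OF u])
    finally have "(\<integral>\<^sup>+x. u T x - ennreal B \<partial>stat) \<le> ennreal d"
      unfolding B using d by (simp add: ennreal_plus[symmetric] del: ennreal_plus)
    moreover have "(\<integral>\<^sup>+x. u t x - ennreal B \<partial>stat) \<le> (\<integral>\<^sup>+x. u T x - ennreal B \<partial>stat)"
      using excess_contraction[OF mild_shift[OF K T], of "ennreal B" "t - T"] t by simp
    ultimately show ?thesis by simp
  qed
  then show ?thesis using T by (intro exI[of _ T] conjI exI[of _ B]) (auto simp: B_def)
qed

text \<open>Since \<open>T\<close> and \<open>c\<close> are fixed before \<open>K\<close> and
  \<open>u\<close>, the same decrement applies again after every restart. It is the integral of the
  minimum in \<open>excess_decrement\<close>, bounded below on \<open>{0<..<M}\<close> by one jump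
  from a window \<open>{-L..L}\<close>.\<close>

lemma excess_uniform_decrement:
  assumes B: "0 \<le> B" and d: "0 < d"
  shows "\<exists>T\<ge>0. \<exists>c>0. \<forall>K u. mild K u \<longrightarrow> (\<integral>\<^sup>+x. u 0 x \<partial>stat) = 1 \<longrightarrow>
    (\<integral>\<^sup>+x. u 0 x - ennreal B \<partial>stat) \<le> ennreal d \<longrightarrow> ennreal (3 * d) \<le> (\<integral>\<^sup>+x. u 0 x - 1 \<partial>stat) \<longrightarrow>
    (\<integral>\<^sup>+x. u T x - 1 \<partial>stat) + ennreal c \<le> (\<integral>\<^sup>+x. u 0 x - 1 \<partial>stat)"
proof -
  interpret prob_space stat by (rule prob_space_stat)
  obtain L where L: "0 < L" and tail: "emeasure stat (- {-L..L}) < ennreal (d / (B + 1))"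
    using stat_tail[of "ennreal (d / (B + 1))"] B d by auto
  have "eventually (\<lambda>x. H x < H L) at_top" using H_tendsto_0 H_pos by (rule order_tendstoD)
  then obtain N where N: "\<And>x. N \<le> x \<Longrightarrow> H x < H L" by (auto simp: eventually_at_top_linorder)
  \<comment> \<open>At \<open>M\<close> the profile has dropped below \<open>H L\<close>, so
    \<open>k\<close> has a positive integral over \<open>{L<..M}\<close>, the jump points of
    \<open>J_S_lower\<close>.\<close>
  define M where "M = max N (L + 1)"
  define \<kappa> where "\<kappa> = (\<integral>\<^sup>+z. k z * indicator {L<..M} z \<partial>lborel)"
  have M: "L < M" and HM: "H M < H L" using N[of M] by (auto simp: M_def)
  then have \<kappa>: "\<kappa> \<noteq> 0" using H_split[of L M] unfolding \<kappa>_def by auto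
  define T where "T = L + M"
  define c1 where "c1 = 2 * ennreal (exp (- 2 * T)) * \<kappa> / H (- T)"
  define c2 where "c2 = inverse (ennreal (exp (2 * L)) * H (- L))"
  \<comment> \<open>\<open>c2 * d\<close> bounds from below the Lebesgue integral over the window of
    a function with stationary mass \<open>d\<close> there; \<open>c1\<close> turns it into a
    one-jump density on \<open>{0<..<M}\<close>.\<close>
  define c where "c = c1 * (c2 * ennreal d) * emeasure stat {0<..<M}"
  have c1: "0 < c1" using \<kappa> H_finite[of "- T"] unfolding c1_def by (auto simp: zero_less_iff_neq_zero)
  have c2: "0 < c2" using H_finite[of "- L"] unfolding c2_def
    by (auto simp: zero_less_iff_neq_zero ennreal_mult_eq_top_iff)
  have c: "0 < c"
    unfolding c_def using c1 c2 d emeasure_stat_Ioo_pos[of M] L M by (auto simp: ennreal_zero_less_mult_iff)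
  \<comment> \<open>Cutting at \<open>1\<close> produces a positive real number without deciding
    whether \<open>c\<close> is finite.\<close>
  define c' where "c' = enn2real (min c 1)"
  have c'_eq: "ennreal c' = min c 1" unfolding c'_def by (intro ennreal_enn2real) (simp add: min_less_iff_disj)
  then have c': "0 < c'" "ennreal c' \<le> c"
    using c by (simp_all add: c'_eq flip: ennreal_less_zero_iff)
  have "(\<integral>\<^sup>+x. u T x - 1 \<partial>stat) + ennreal c' \<le> (\<integral>\<^sup>+x. u 0 x - 1 \<partial>stat)"
    if u: "mild K u" and mass: "(\<integral>\<^sup>+x. u 0 x \<partial>stat) = 1"
      and exc: "(\<integral>\<^sup>+x. u 0 x - ennreal B \<partial>stat) \<le> ennreal d"
      and big: "ennreal (3 * d) \<le> (\<integral>\<^sup>+x. u 0 x - 1 \<partial>stat)" for K u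
  proof -
    define f where "f x = u 0 x - 1" for x
    define g where "g x = 1 - u 0 x" for x
    let ?I = "{-L..L}"
    note [measurable (raw)] = borel_measurable_curried[OF mildD(1)[OF u]]
    have [measurable]: "f \<in> borel_measurable borel" "g \<in> borel_measurable borel"
      unfolding f_def g_def by measurable
    note [measurable (raw)] = meas2_J[OF meas2_S, THEN borel_measurable_curried]
    have "(\<integral>\<^sup>+x. u 0 x + g x \<partial>stat) = (\<integral>\<^sup>+x. 1 + f x \<partial>stat)"
      unfolding f_def g_def by (intro nn_integral_cong) (auto simp: add_diff_self_ennreal)
    then have "1 + (\<integral>\<^sup>+x. g x \<partial>stat) = 1 + (\<integral>\<^sup>+x. f x \<partial>stat)"
      by (simp add: nn_integral_add mass emeasure_space_1)
    \<comment> \<open>Total mass \<open>1\<close> makes the positive and the negative part of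
      \<open>u 0 - 1\<close> equally large.\<close>
    then have fg: "(\<integral>\<^sup>+x. g x \<partial>stat) = (\<integral>\<^sup>+x. f x \<partial>stat)" by simp
    \<comment> \<open>Outside the window \<open>v\<close> carries at most \<open>2 * d\<close>: one
      \<open>d\<close> from the level \<open>B + 1\<close>, by the choice of \<open>L\<close>, and
      one from the excess over \<open>B\<close>. Of the assumed \<open>3 * d\<close> at least
      \<open>d\<close> remains inside.\<close>
    have small: "ennreal d \<le> (\<integral>\<^sup>+x. v x * indicator ?I x \<partial>stat)"
      if [measurable]: "v \<in> borel_measurable borel" and v: "ennreal (3 * d) \<le> (\<integral>\<^sup>+x. v x \<partial>stat)"
        and v_le: "\<And>x. v x \<le> ennreal (B + 1) + (u 0 x - ennreal B)" for v
    proof -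
      have "(\<integral>\<^sup>+x. v x * indicator (- ?I) x \<partial>stat) \<le> (\<integral>\<^sup>+x. ennreal (B + 1) * indicator (- ?I) x + (u 0 x - ennreal B) \<partial>stat)"
        by (intro nn_integral_mono) (use v_le in \<open>auto simp: indicator_def\<close>)
      also have "\<dots> = ennreal (B + 1) * emeasure stat (- ?I) + (\<integral>\<^sup>+x. u 0 x - ennreal B \<partial>stat)"
        by (simp add: nn_integral_add nn_integral_cmult)
      also have "\<dots> \<le> ennreal (B + 1) * ennreal (d / (B + 1)) + ennreal d"
        using tail exc by (intro add_mono mult_left_mono) auto
      also have "\<dots> = ennreal (2 * d)"
        using B d by (simp add: ennreal_mult[symmetric] ennreal_plus[symmetric] del: ennreal_plus)
      finally have out: "(\<integral>\<^sup>+x. v x * indicator (- ?I) x \<partial>stat) \<le> ennreal (2 * d)" .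
      have "ennreal d + ennreal (2 * d) \<le> (\<integral>\<^sup>+x. v x \<partial>stat)"
        using v d by (simp add: ennreal_plus[symmetric] del: ennreal_plus)
      also have "\<dots> = (\<integral>\<^sup>+x. v x * indicator ?I x + v x * indicator (- ?I) x \<partial>stat)"
        by (intro nn_integral_cong) (auto simp: indicator_def)
      also have "\<dots> = (\<integral>\<^sup>+x. v x * indicator ?I x \<partial>stat) + (\<integral>\<^sup>+x. v x * indicator (- ?I) x \<partial>stat)"
        by (rule nn_integral_add) measurable
      also have "\<dots> \<le> (\<integral>\<^sup>+x. v x * indicator ?I x \<partial>stat) + ennreal (2 * d)"
        by (intro add_left_mono out)
      finally show ?thesis by (auto simp: add.commute[of _ "ennreal (2 * d)"])
    qed
    have leb: "c2 * ennreal d \<le> (\<integral>\<^sup>+x. v x * indicator ?I x \<partial>lborel)"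
      if [measurable]: "v \<in> borel_measurable borel" and v: "ennreal d \<le> (\<integral>\<^sup>+x. v x * indicator ?I x \<partial>stat)" for v
    proof -
      let ?c = "ennreal (exp (2 * L)) * H (- L)"
      have "ennreal d \<le> ?c * (\<integral>\<^sup>+x. v x * indicator ?I x \<partial>lborel)"
        by (rule order_trans[OF v stat_le_lborel]) auto
      from mult_left_mono[OF this, of c2] have "c2 * ennreal d \<le> (c2 * ?c) * (\<integral>\<^sup>+x. v x * indicator ?I x \<partial>lborel)"
        by (simp add: mult.assoc)
      moreover have "c2 * ?c = 1"
        unfolding c2_def using H_pos[of "- L"] H_finite[of "- L"]
        by (subst mult.commute, intro ennreal_mult_inverse_eq_1) (auto simp: ennreal_mult_less_top)
      ultimately show ?thesis by simp
    qed
    have low: "c1 * (c2 * ennreal d) \<le> J (\<lambda>s. S s v) T x"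
      if [measurable]: "v \<in> borel_measurable borel" and v: "ennreal d \<le> (\<integral>\<^sup>+x. v x * indicator ?I x \<partial>stat)"
        and x: "x \<in> {0<..<M}" for v x
    proof -
      have "c1 * (c2 * ennreal d) \<le> c1 * (\<integral>\<^sup>+x. v x * indicator ?I x \<partial>lborel)"
        by (intro mult_left_mono leb v) auto
      also have "\<dots> \<le> J (\<lambda>s. S s v) T x"
        unfolding c1_def \<kappa>_def T_def using J_S_lower[of v L M x] L M x by simp
      finally show ?thesis .
    qed
    have Bdiff: "u 0 x \<le> ennreal (B + 1) + (u 0 x - ennreal B)" for x
    proof -
      have "u 0 x \<le> ennreal B + (u 0 x - ennreal B)" by (rule ennreal_le_add_diff)
      also have "\<dots> \<le> ennreal (B + 1) + (u 0 x - ennreal B)" by (intro add_right_mono ennreal_leI) simp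
      finally show ?thesis .
    qed
    have f_le: "f x \<le> ennreal (B + 1) + (u 0 x - ennreal B)" for x
      unfolding f_def by (rule ennreal_diff_le_mono_left) (rule Bdiff)
    have g_le: "g x \<le> ennreal (B + 1) + (u 0 x - ennreal B)" for x
    proof -
      have "g x \<le> 1" by (simp add: g_def)
      also have "1 \<le> ennreal (B + 1)" using B by (simp add: ennreal_1[symmetric] del: ennreal_1)
      finally show ?thesis by (simp add: add_increasing2)
    qed
    have If: "ennreal d \<le> (\<integral>\<^sup>+x. f x * indicator ?I x \<partial>stat)"
      by (rule small) (use big f_le in \<open>auto simp: f_def[abs_def]\<close>)
    have Ig: "ennreal d \<le> (\<integral>\<^sup>+x. g x * indicator ?I x \<partial>stat)"
      by (rule small) (use big g_le fg in \<open>auto simp: f_def[abs_def]\<close>)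
    have "c = (\<integral>\<^sup>+x. c1 * (c2 * ennreal d) * indicator {0<..<M} x \<partial>stat)"
      unfolding c_def by (simp add: nn_integral_cmult)
    also have "\<dots> \<le> (\<integral>\<^sup>+x. min (J (\<lambda>s. S s f) T x) (J (\<lambda>s. S s g) T x) \<partial>stat)"
      by (intro nn_integral_mono) (auto simp: indicator_def intro!: low If Ig)
    finally have "ennreal c' \<le> (\<integral>\<^sup>+x. min (J (\<lambda>s. S s f) T x) (J (\<lambda>s. S s g) T x) \<partial>stat)"
      using c'(2) by simp
    then show ?thesis
      using excess_decrement[OF u, of T] L M add_left_mono
      unfolding T_def f_def g_def by (meson add_pos_pos less_imp_le order_trans less_trans)
  qed
  then show ?thesis using c' L M unfolding T_def by (intro exI[of _ "L + M"] conjI exI[of _ c']) auto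
qed

text \<open>The excess over \<open>1\<close> starts at most \<open>1\<close> and never increases.
  While it is at least \<open>e = 3 * d\<close>, every block of length \<open>T\<close> after
  \<open>T0\<close> costs the fixed amount \<open>c\<close>, so it cannot survive \<open>n\<close>
  blocks when \<open>n * c > 1\<close>.\<close>

theorem excess_uniformly_tendsto_0:
  assumes tight: "\<And>e::real. 0 < e \<Longrightarrow> \<exists>a b. \<forall>u\<in>U. (\<integral>\<^sup>+x. u 0 x * indicator (- {a..b}) x \<partial>stat) \<le> ennreal e"
    and mild: "\<And>u. u \<in> U \<Longrightarrow> \<exists>K. mild K u"
    and mass: "\<And>u t. u \<in> U \<Longrightarrow> 0 \<le> t \<Longrightarrow> (\<integral>\<^sup>+x. u t x \<partial>stat) = 1"
    and e: "0 < (e::real)"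
  shows "\<exists>T\<ge>0. \<forall>u\<in>U. \<forall>t\<ge>T. (\<integral>\<^sup>+x. u t x - 1 \<partial>stat) < ennreal e"
proof -
  define d where "d = e / 3"
  have d: "0 < d" using e by (simp add: d_def)
  have "\<exists>T\<ge>0. \<exists>B::real. 0 \<le> B \<and> (\<forall>u\<in>U. \<forall>t\<ge>T. (\<integral>\<^sup>+x. u t x - ennreal B \<partial>stat) \<le> ennreal d)"
    by (rule excess_eventually_small, erule tight, erule mild, erule (1) mass, rule d)
  then obtain T0 B where T0: "0 \<le> T0" and B: "0 \<le> B"
    and exc: "\<And>u t. u \<in> U \<Longrightarrow> T0 \<le> t \<Longrightarrow> (\<integral>\<^sup>+x. u t x - ennreal B \<partial>stat) \<le> ennreal d"
    by blast
  obtain T c where T: "0 \<le> T" and c: "0 < c"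
    and dec: "\<And>K u. mild K u \<Longrightarrow> (\<integral>\<^sup>+x. u 0 x \<partial>stat) = 1 \<Longrightarrow>
      (\<integral>\<^sup>+x. u 0 x - ennreal B \<partial>stat) \<le> ennreal d \<Longrightarrow> ennreal (3 * d) \<le> (\<integral>\<^sup>+x. u 0 x - 1 \<partial>stat) \<Longrightarrow>
      (\<integral>\<^sup>+x. u T x - 1 \<partial>stat) + ennreal c \<le> (\<integral>\<^sup>+x. u 0 x - 1 \<partial>stat)"
    using excess_uniform_decrement[OF B d] by blast
  obtain n :: nat where n: "1 < real n * c" using c reals_Archimedean3 by blast
  have "(\<integral>\<^sup>+x. u t x - 1 \<partial>stat) < ennreal e" if u: "u \<in> U" and t: "T0 + real n * T \<le> t" for u t
  proof (rule ccontr)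
    assume "\<not> (\<integral>\<^sup>+x. u t x - 1 \<partial>stat) < ennreal e"
    then have big: "ennreal (3 * d) \<le> (\<integral>\<^sup>+x. u t x - 1 \<partial>stat)" by (simp add: d_def)
    obtain K where K: "mild K u" using mild[OF u] by auto
    have anti: "(\<integral>\<^sup>+x. u s' x - 1 \<partial>stat) \<le> (\<integral>\<^sup>+x. u s x - 1 \<partial>stat)" if "0 \<le> s" "s \<le> s'" for s s'
      using excess_contraction[OF mild_shift[OF K that(1)], of 1 "s' - s"] that by simp
    have "(\<integral>\<^sup>+x. u (T0 + real j * T) x - 1 \<partial>stat) + ennreal (real j * c) \<le> 1" if "j \<le> n" for j
      using that
    proof (induction j)
      case 0
      have "(\<integral>\<^sup>+x. u T0 x - 1 \<partial>stat) \<le> (\<integral>\<^sup>+x. u T0 x \<partial>stat)" by (intro nn_integral_mono) simp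
      then show ?case using mass[OF u T0] by simp
    next
      case (Suc j)
      let ?r = "T0 + real j * T"
      have r: "0 \<le> ?r" using T0 T by simp
      have "?r \<le> t" using Suc.prems T t by (smt (verit) Suc_leD mult_right_mono of_nat_mono)
      then have "ennreal (3 * d) \<le> (\<integral>\<^sup>+x. u ?r x - 1 \<partial>stat)"
        using order_trans[OF big anti[OF r]] by simp
      then have "(\<integral>\<^sup>+x. u (?r + T) x - 1 \<partial>stat) + ennreal c \<le> (\<integral>\<^sup>+x. u ?r x - 1 \<partial>stat)"
        using dec[OF mild_shift[OF K r]] mass[OF u r] exc[OF u, of ?r] T0 T by simp
      note step = add_right_mono[OF this, of "ennreal (real j * c)"]
      have "(\<integral>\<^sup>+x. u (?r + T) x - 1 \<partial>stat) + (ennreal c + ennreal (real j * c)) \<le> 1"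
        using order_trans[OF step Suc.IH[OF Suc_leD[OF Suc.prems]]] by (simp add: add.assoc)
      then show ?case using c
        by (simp add: ennreal_plus[symmetric] algebra_simps del: ennreal_plus)
    qed
    from this[of n] have "ennreal (real n * c) \<le> 1" by (metis add_increasing order.refl order.trans zero_le add.commute le_iff_add)
    with n show False by (simp add: ennreal_le_1)
  qed
  then show ?thesis using T0 T by (intro exI[of _ "T0 + real n * T"]) auto
qed

end

section \<open>From the integrated to the mild equation\<close>

text \<open>For \<open>\<eta>' = - \<kappa>\<close> and \<open>a = c + \<integral> b\<close> this is
  the integral of \<open>(\<eta> a)' = \<eta> b - \<kappa> a\<close>, with the negative term moved
  to the left so that it makes sense in \<open>ennreal\<close>. The proof is Fubini on the triangle
  \<open>r \<le> s \<le> t\<close>.\<close>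

lemma product_rule:
  fixes \<eta> \<kappa> b :: "real \<Rightarrow> ennreal"
  assumes [measurable]: "\<kappa> \<in> borel_measurable borel" "b \<in> borel_measurable borel" "\<eta> \<in> borel_measurable borel"
    and split: "\<And>s. 0 \<le> s \<Longrightarrow> s \<le> t \<Longrightarrow> \<eta> s = \<eta> t + (\<integral>\<^sup>+r. indicator {s..t} r * \<kappa> r \<partial>lborel)"
    and t: "0 \<le> t"
  shows "\<eta> t * (c + (\<integral>\<^sup>+s. indicator {0..t} s * b s \<partial>lborel)) +
      (\<integral>\<^sup>+s. indicator {0..t} s * (\<kappa> s * (c + (\<integral>\<^sup>+r. indicator {0..s} r * b r \<partial>lborel))) \<partial>lborel)
    = \<eta> 0 * c + (\<integral>\<^sup>+s. indicator {0..t} s * (\<eta> s * b s) \<partial>lborel)"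
proof -
  have "(\<integral>\<^sup>+s. indicator {0..t} s * (\<kappa> s * (c + (\<integral>\<^sup>+r. indicator {0..s} r * b r \<partial>lborel))) \<partial>lborel)
    = (\<integral>\<^sup>+s. indicator {0..t} s * \<kappa> s * c + (\<integral>\<^sup>+r. indicator {0..t} s * \<kappa> s * (indicator {0..s} r * b r) \<partial>lborel) \<partial>lborel)"
    by (intro nn_integral_cong) (simp add: distrib_left mult.assoc nn_integral_cmult)
  also have "\<dots> = (\<integral>\<^sup>+s. indicator {0..t} s * \<kappa> s * c \<partial>lborel) +
      (\<integral>\<^sup>+s. (\<integral>\<^sup>+r. indicator {0..t} s * \<kappa> s * (indicator {0..s} r * b r) \<partial>lborel) \<partial>lborel)"
    by (rule nn_integral_add) measurable
  also have "(\<integral>\<^sup>+s. (\<integral>\<^sup>+r. indicator {0..t} s * \<kappa> s * (indicator {0..s} r * b r) \<partial>lborel) \<partial>lborel)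
      = (\<integral>\<^sup>+r. (\<integral>\<^sup>+s. indicator {0..t} s * \<kappa> s * (indicator {0..s} r * b r) \<partial>lborel) \<partial>lborel)"
    by (rule lborel_pair.Fubini') measurable
  also have "\<dots> = (\<integral>\<^sup>+r. indicator {0..t} r * b r * (\<integral>\<^sup>+s. indicator {r..t} s * \<kappa> s \<partial>lborel) \<partial>lborel)"
    by (intro nn_integral_cong nn_integral_factor) (auto simp: indicator_def mult_ac)
  finally have 1: "(\<integral>\<^sup>+s. indicator {0..t} s * (\<kappa> s * (c + (\<integral>\<^sup>+r. indicator {0..s} r * b r \<partial>lborel))) \<partial>lborel)
    = (\<integral>\<^sup>+s. indicator {0..t} s * \<kappa> s \<partial>lborel) * c +
      (\<integral>\<^sup>+r. indicator {0..t} r * b r * (\<integral>\<^sup>+s. indicator {r..t} s * \<kappa> s \<partial>lborel) \<partial>lborel)"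
    by (simp add: nn_integral_multc)
  have "(\<integral>\<^sup>+s. indicator {0..t} s * (\<eta> s * b s) \<partial>lborel)
     = (\<integral>\<^sup>+s. \<eta> t * (indicator {0..t} s * b s) + indicator {0..t} s * b s * (\<integral>\<^sup>+r. indicator {s..t} r * \<kappa> r \<partial>lborel) \<partial>lborel)"
  proof (rule nn_integral_cong)
    fix s
    show "indicator {0..t} s * (\<eta> s * b s) = \<eta> t * (indicator {0..t} s * b s) + indicator {0..t} s * b s * (\<integral>\<^sup>+r. indicator {s..t} r * \<kappa> r \<partial>lborel)"
      using split[of s] by (cases "s \<in> {0..t}") (auto simp: distrib_left distrib_right mult.commute)
  qed
  also have "\<dots> = \<eta> t * (\<integral>\<^sup>+s. indicator {0..t} s * b s \<partial>lborel) +
      (\<integral>\<^sup>+r. indicator {0..t} r * b r * (\<integral>\<^sup>+s. indicator {r..t} s * \<kappa> s \<partial>lborel) \<partial>lborel)"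
    by (simp add: nn_integral_add nn_integral_cmult)
  finally have 2: "(\<integral>\<^sup>+s. indicator {0..t} s * (\<eta> s * b s) \<partial>lborel) = \<dots>" .
  show ?thesis
    unfolding 1 2 using split[OF order_refl t] by (simp add: distrib_left distrib_right add_ac)
qed

text \<open>
  Both \<open>a\<close> and \<open>a'\<close>, the right-hand side of the claim, solve the same equation. Their distance \<open>D\<close>
  satisfies \<open>\<eta> D \<le> m\<close> with \<open>m t = \<integral>\<^sub>0\<^sup>t \<kappa> D\<close>, and the product rule for \<open>\<eta> m\<close>, where \<open>\<eta>' = - \<kappa>\<close>, then forces
  \<open>m = 0\<close>. This replaces the integrating factor \<open>1 / \<eta>\<close>.
\<close>

lemma ode_unique:
  fixes \<eta> \<kappa> a b :: "real \<Rightarrow> ennreal"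
  assumes [measurable]: "\<kappa> \<in> borel_measurable borel" "b \<in> borel_measurable borel"
      "\<eta> \<in> borel_measurable borel" "a \<in> borel_measurable borel"
    and split: "\<And>s t. 0 \<le> s \<Longrightarrow> s \<le> t \<Longrightarrow> \<eta> s = \<eta> t + (\<integral>\<^sup>+r. indicator {s..t} r * \<kappa> r \<partial>lborel)"
    and T: "0 \<le> T" and \<eta>0: "\<And>s. \<eta> s \<noteq> 0" and \<eta>_fin: "\<And>s. \<eta> s < top"
    and A: "A < top" "\<And>s. 0 \<le> s \<Longrightarrow> s \<le> T \<Longrightarrow> a s \<le> A"
    and b: "(\<integral>\<^sup>+s. indicator {0..T} s * b s \<partial>lborel) < top"
    and eq: "AE t in lborel. t \<in> {0..T} \<longrightarrow> \<eta> t * a t + (\<integral>\<^sup>+s. indicator {0..t} s * (\<kappa> s * a s) \<partial>lborel)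
      = \<eta> 0 * a 0 + (\<integral>\<^sup>+s. indicator {0..t} s * (\<eta> s * b s) \<partial>lborel)"
    and eqT: "\<eta> T * a T + (\<integral>\<^sup>+s. indicator {0..T} s * (\<kappa> s * a s) \<partial>lborel)
      = \<eta> 0 * a 0 + (\<integral>\<^sup>+s. indicator {0..T} s * (\<eta> s * b s) \<partial>lborel)"
  shows "a T = a 0 + (\<integral>\<^sup>+s. indicator {0..T} s * b s \<partial>lborel)"
proof -
  define a' where "a' t = a 0 + (\<integral>\<^sup>+s. indicator {0..t} s * b s \<partial>lborel)" for t
  have [measurable]: "a' \<in> borel_measurable borel" unfolding a'_def by measurable
  \<comment> \<open>One of the two truncated differences is \<open>0\<close>, so the sum is the
    absolute difference.\<close>
  define D where "D t = (a t - a' t) + (a' t - a t)" for t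
  have [measurable]: "D \<in> borel_measurable borel" unfolding D_def by measurable
  define m where "m t = (\<integral>\<^sup>+s. indicator {0..t} s * (\<kappa> s * D s) \<partial>lborel)" for t
  have [measurable]: "m \<in> borel_measurable borel" unfolding m_def by measurable
  have a'_le: "a' t \<le> a' T" if "t \<le> T" for t
    unfolding a'_def by (intro add_left_mono nn_integral_mono) (use that in \<open>auto simp: indicator_def\<close>)
  have a'_fin: "a' T < top" unfolding a'_def using b A(2)[of 0] A(1) T by (auto intro: le_less_trans)
  have D_le: "D t \<le> A + a' T" if "0 \<le> t" "t \<le> T" for t
    unfolding D_def using that by (intro add_mono ennreal_diff_le_mono_left A a'_le)
  have \<kappa>_fin: "(\<integral>\<^sup>+s. indicator {0..t} s * \<kappa> s \<partial>lborel) < top" if "0 \<le> t" for t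
    using split[OF order_refl that] \<eta>_fin[of 0] by (auto simp: ennreal_add_less_top)
  have fin: "(\<integral>\<^sup>+s. indicator {0..t} s * (\<kappa> s * f s) \<partial>lborel) < top"
    if C: "C < top" "\<And>s. 0 \<le> s \<Longrightarrow> s \<le> T \<Longrightarrow> f s \<le> C" and t: "0 \<le> t" "t \<le> T" for f C t
  proof -
    have "(\<integral>\<^sup>+s. indicator {0..t} s * (\<kappa> s * f s) \<partial>lborel) \<le> (\<integral>\<^sup>+s. (indicator {0..t} s * \<kappa> s) * C \<partial>lborel)"
      using t by (intro nn_integral_mono) (auto simp: indicator_def intro!: mult_left_mono C)
    also have "\<dots> = (\<integral>\<^sup>+s. indicator {0..t} s * \<kappa> s \<partial>lborel) * C" by (rule nn_integral_multc) measurable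
    also have "\<dots> < top" using \<kappa>_fin[OF t(1)] C by (simp add: ennreal_mult_less_top)
    finally show ?thesis .
  qed
  have bound: "\<eta> t * D t \<le> m t" if t: "0 \<le> t" "t \<le> T"
    and e: "\<eta> t * a t + (\<integral>\<^sup>+s. indicator {0..t} s * (\<kappa> s * a s) \<partial>lborel)
      = \<eta> 0 * a 0 + (\<integral>\<^sup>+s. indicator {0..t} s * (\<eta> s * b s) \<partial>lborel)" for t
  proof -
    have "\<eta> t * a' t + (\<integral>\<^sup>+s. indicator {0..t} s * (\<kappa> s * a' s) \<partial>lborel)
        = \<eta> 0 * a 0 + (\<integral>\<^sup>+s. indicator {0..t} s * (\<eta> s * b s) \<partial>lborel)"
      unfolding a'_def by (rule product_rule) (use split t in auto)
    with e have e': "\<eta> t * a t + (\<integral>\<^sup>+s. indicator {0..t} s * (\<kappa> s * a s) \<partial>lborel) =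
        \<eta> t * a' t + (\<integral>\<^sup>+s. indicator {0..t} s * (\<kappa> s * a' s) \<partial>lborel)" by simp
    have le: "(\<integral>\<^sup>+s. indicator {0..t} s * (\<kappa> s * f s) \<partial>lborel) \<le> (\<integral>\<^sup>+s. indicator {0..t} s * (\<kappa> s * g s) \<partial>lborel) + m t"
      if [measurable]: "f \<in> borel_measurable borel" "g \<in> borel_measurable borel" and "\<And>s. f s \<le> g s + D s" for f g
      unfolding m_def using that(3)
      by (subst nn_integral_add[symmetric]) (auto simp: distrib_left[symmetric] indicator_def intro!: nn_integral_mono mult_left_mono)
    have D1: "a' s \<le> a s + D s" "a s \<le> a' s + D s" for s
      unfolding D_def using ennreal_le_add_diff[of "a' s" "a s"] ennreal_le_add_diff[of "a s" "a' s"]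
      by (auto intro: order_trans add_left_mono simp: add_increasing add_increasing2)
    have f1: "(\<integral>\<^sup>+s. indicator {0..t} s * (\<kappa> s * a s) \<partial>lborel) < top"
      by (rule fin[OF A t])
    have f2: "(\<integral>\<^sup>+s. indicator {0..t} s * (\<kappa> s * a' s) \<partial>lborel) < top"
      by (rule fin[OF a'_fin a'_le t])
    have "\<eta> t * a t + (\<integral>\<^sup>+s. indicator {0..t} s * (\<kappa> s * a s) \<partial>lborel)
        \<le> (\<eta> t * a' t + m t) + (\<integral>\<^sup>+s. indicator {0..t} s * (\<kappa> s * a s) \<partial>lborel)"
      unfolding e' using le[of a' a] D1 by (simp add: add_ac add_left_mono)
    then have 1: "\<eta> t * a t \<le> \<eta> t * a' t + m t"
      using f1 by (auto simp: add.commute[of _ "\<integral>\<^sup>+s. indicator {0..t} s * (\<kappa> s * a s) \<partial>lborel"])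
    have "\<eta> t * a' t + (\<integral>\<^sup>+s. indicator {0..t} s * (\<kappa> s * a' s) \<partial>lborel)
        \<le> (\<eta> t * a t + m t) + (\<integral>\<^sup>+s. indicator {0..t} s * (\<kappa> s * a' s) \<partial>lborel)"
      unfolding e'[symmetric] using le[of a a'] D1 by (simp add: add_ac add_left_mono)
    then have 2: "\<eta> t * a' t \<le> \<eta> t * a t + m t"
      using f2 by (auto simp: add.commute[of _ "\<integral>\<^sup>+s. indicator {0..t} s * (\<kappa> s * a' s) \<partial>lborel"])
    have sub: "\<eta> t * (x - y) \<le> m t" if "\<eta> t * x \<le> \<eta> t * y + m t" "x < top" "y < top" for x y
    proof -
      show ?thesis
      proof (cases "x \<le> y")
        case False
        then have "x = y + (x - y)" by (auto simp: add_diff_self_ennreal)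
        then have "\<eta> t * y + \<eta> t * (x - y) \<le> \<eta> t * y + m t"
          using that(1) by (metis distrib_left)
        then show ?thesis using that(3) \<eta>_fin[of t]
          by (auto simp: ennreal_mult_eq_top_iff)
      qed (use that in \<open>simp add: diff_eq_0_ennreal\<close>)
    qed
    have "a t < top" "a' t < top" using A t a'_le[of t] a'_fin by (auto intro: le_less_trans)
    show ?thesis
    proof (cases "a t \<le> a' t")
      case True
      then show ?thesis unfolding D_def using sub[OF 2] \<open>a t < top\<close> \<open>a' t < top\<close> by (simp add: diff_eq_0_ennreal)
    next
      case False
      then show ?thesis unfolding D_def using sub[OF 1] \<open>a t < top\<close> \<open>a' t < top\<close> by (simp add: diff_eq_0_ennreal)
    qed
  qed
  \<comment> \<open>The product rule with \<open>c = 0\<close> and source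
    \<open>\<kappa> * D\<close>. As \<open>\<eta> * D \<le> m\<close> almost everywhere, the
    right-hand side is at most the integral of \<open>\<kappa> * m\<close>, which is finite and also
    occurs on the left.\<close>
  have m_eq: "\<eta> T * m T + (\<integral>\<^sup>+s. indicator {0..T} s * (\<kappa> s * m s) \<partial>lborel) = (\<integral>\<^sup>+s. indicator {0..T} s * (\<eta> s * (\<kappa> s * D s)) \<partial>lborel)"
    using product_rule[of \<kappa> "\<lambda>s. \<kappa> s * D s" \<eta> T 0] split T unfolding m_def by simp
  also have "\<dots> \<le> (\<integral>\<^sup>+s. indicator {0..T} s * (\<kappa> s * m s) \<partial>lborel)"
  proof (rule nn_integral_mono_AE)
    show "AE s in lborel. indicator {0..T} s * (\<eta> s * (\<kappa> s * D s)) \<le> indicator {0..T} s * (\<kappa> s * m s)"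
      using eq
    proof eventually_elim
      case (elim s)
      show ?case
      proof (cases "s \<in> {0..T}")
        case True
        then have "\<kappa> s * (\<eta> s * D s) \<le> \<kappa> s * m s" using elim by (intro mult_left_mono bound) auto
        then show ?thesis using True by (simp add: mult_ac)
      qed simp
    qed
  qed
  finally have le: "\<eta> T * m T + (\<integral>\<^sup>+s. indicator {0..T} s * (\<kappa> s * m s) \<partial>lborel) \<le> (\<integral>\<^sup>+s. indicator {0..T} s * (\<kappa> s * m s) \<partial>lborel)" .
  have m_fin: "m T < top"
    unfolding m_def by (rule fin[OF _ D_le]) (use A a'_fin T in \<open>auto simp: ennreal_add_less_top\<close>)
  have m_mono: "m s \<le> m T" if "s \<le> T" for s
    unfolding m_def by (intro nn_integral_mono) (use that in \<open>auto simp: indicator_def\<close>)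
  have "(\<integral>\<^sup>+s. indicator {0..T} s * (\<kappa> s * m s) \<partial>lborel) < top"
    by (rule fin[OF m_fin m_mono]) (use T in auto)
  with le have "\<eta> T * m T \<le> 0"
    by (metis add.commute add.right_neutral ennreal_add_left_cancel_le infinity_ennreal_def less_irrefl)
  \<comment> \<open>Here the equation at the single time \<open>T\<close> enters: the value
    \<open>D T\<close> is not seen by a statement for almost every time.\<close>
  then have "\<eta> T * D T = 0" using bound[OF T order_refl eqT] \<eta>0[of T] by auto
  then have "D T = 0" using \<eta>0[of T] by simp
  then have "a T - a' T = 0" "a' T - a T = 0" unfolding D_def by auto
  then have "a T = a' T" using A(1) A(2)[OF T order_refl] a'_fin
    by (auto simp: diff_eq_0_iff_ennreal intro: antisym)
  then show ?thesis by (simp add: a'_def)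
qed


section \<open>Differentiation along characteristics\<close>

lemma AE_lborel_shift:
  fixes P :: "real \<Rightarrow> bool"
  assumes [measurable]: "Measurable.pred borel P" and AE: "AE x in lborel. P (x + a)"
  shows "AE x in lborel. P x"
proof -
  have "AE x in distr lborel borel ((+) a). P x"
    by (subst AE_distr_iff) (use AE in \<open>auto simp: add.commute\<close>)
  then show ?thesis unfolding lborel_distr_plus .
qed

lemma measure_eqI_atMost:
  fixes M N :: "real measure"
  assumes sets: "sets M = sets borel" "sets N = sets borel"
    and eq: "\<And>x. emeasure M {..x} = emeasure N {..x}"
    and fin: "\<And>x. emeasure M {..x} < top"
  shows "M = N"
proof (rule measure_eqI_generator_eq[where E="range (\<lambda>x. {..x})" and \<Omega>=UNIV and A="\<lambda>n. {..real n}"])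
  show "Int_stable (range (\<lambda>x::real. {..x}))"
    by (auto simp: Int_stable_def)
  show "sets M = sigma_sets UNIV (range (\<lambda>x. {..x}))" "sets N = sigma_sets UNIV (range (\<lambda>x. {..x}))"
    by (simp_all add: sets borel_eq_atMost[where 'a=real])
  show "(\<Union>n. {..real n}) = UNIV" using real_arch_simple by auto
  show "emeasure M {..real n} \<noteq> \<infinity>" for n using fin[of "real n"] by simp
qed (use eq in auto)

lemma density_lborel_eqI:
  fixes f g :: "real \<Rightarrow> ennreal"
  assumes f [measurable]: "f \<in> borel_measurable borel" and g [measurable]: "g \<in> borel_measurable borel"
    and eq: "\<And>x. (\<integral>\<^sup>+y. f y * indicator {..x} y \<partial>lborel) = (\<integral>\<^sup>+y. g y * indicator {..x} y \<partial>lborel)"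
    and fin: "\<And>x. (\<integral>\<^sup>+y. f y * indicator {..x} y \<partial>lborel) < top"
  shows "AE x in lborel. f x = g x"
proof -
  have "density lborel f = density lborel g"
    by (rule measure_eqI_atMost) (use eq fin in \<open>auto simp: emeasure_density\<close>)
  then show ?thesis
    using sigma_finite_measure.density_unique[OF sigma_finite_lborel, of f g] f g by simp
qed

context stationary_profile
begin

lemma H_Q: "H x * Q f x = (\<integral>\<^sup>+z. f z * k z * indicator {x<..} z \<partial>lborel)"
  unfolding Q_def using H_pos[of x] H_finite[of x]
  by (simp add: ennreal_times_divide mult.commute[of "H x"] ennreal_mult_divide_eq)

text \<open>With \<open>g = H * Q f\<close>, so that \<open>g' = - k f\<close>, this integrates
  \<open>(exp (2 y) g)' = 2 exp (2 y) g - exp (2 y) k f\<close> from minus infinity. It converts the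
  boundary term in the equation for distribution functions into an integral over
  \<open>{..y}\<close>, so that densities can be compared.\<close>

lemma boundary_identity:
  assumes f [measurable]: "f \<in> borel_measurable borel"
  shows "ennreal (exp (2 * y)) * (H y * Q f y) + (\<integral>\<^sup>+w. ennreal (exp (2 * w)) * (k w * f w) * indicator {..y} w \<partial>lborel)
    = (\<integral>\<^sup>+w. 2 * (ennreal (exp (2 * w)) * (H w * Q f w)) * indicator {..y} w \<partial>lborel)"
proof -
  have inner: "(\<integral>\<^sup>+w. 2 * ennreal (exp (2 * w)) * (indicator {w<..} z * indicator {..y} w) \<partial>lborel)
     = ennreal (exp (2 * z)) * indicator {..y} z + ennreal (exp (2 * y)) * indicator {y<..} z" for z
  proof -
    have "(\<integral>\<^sup>+w. 2 * ennreal (exp (2 * w)) * (indicator {w<..} z * indicator {..y} w) \<partial>lborel)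
      = (\<integral>\<^sup>+w. 2 * ennreal (exp (2 * w)) * indicator {..min z y} w \<partial>lborel)"
      by (rule nn_integral_cong_AE) (use AE_lborel_singleton[of z] in \<open>auto simp: indicator_def\<close>)
    then show ?thesis unfolding nn_integral_exp_Iic by (auto simp: indicator_def min_def)
  qed
  have "(\<integral>\<^sup>+w. 2 * (ennreal (exp (2 * w)) * (H w * Q f w)) * indicator {..y} w \<partial>lborel)
     = (\<integral>\<^sup>+w. (\<integral>\<^sup>+z. 2 * ennreal (exp (2 * w)) * indicator {..y} w * (f z * k z * indicator {w<..} z) \<partial>lborel) \<partial>lborel)"
    unfolding H_Q by (intro nn_integral_cong, subst nn_integral_cmult) (simp_all add: mult_ac)
  also have "\<dots> = (\<integral>\<^sup>+z. (\<integral>\<^sup>+w. 2 * ennreal (exp (2 * w)) * indicator {..y} w * (f z * k z * indicator {w<..} z) \<partial>lborel) \<partial>lborel)"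
    by (rule lborel_pair.Fubini') measurable
  also have "\<dots> = (\<integral>\<^sup>+z. f z * k z * (ennreal (exp (2 * z)) * indicator {..y} z + ennreal (exp (2 * y)) * indicator {y<..} z) \<partial>lborel)"
    unfolding inner[symmetric]
    by (intro nn_integral_cong nn_integral_factor) (simp add: mult_ac, measurable)
  also have "\<dots> = (\<integral>\<^sup>+z. ennreal (exp (2 * y)) * (f z * k z * indicator {y<..} z) + ennreal (exp (2 * z)) * (k z * f z) * indicator {..y} z \<partial>lborel)"
    by (intro nn_integral_cong) (simp add: distrib_left mult_ac add_ac)
  also have "\<dots> = ennreal (exp (2 * y)) * (H y * Q f y) + (\<integral>\<^sup>+w. ennreal (exp (2 * w)) * (k w * f w) * indicator {..y} w \<partial>lborel)"
    unfolding H_Q by (subst nn_integral_add) (simp_all add: nn_integral_cmult)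
  finally show ?thesis by simp
qed

text \<open>\<open>A t w\<close> and \<open>B t w\<close> are the two sides of the equation for the
  density along the characteristic through \<open>w\<close>, with the loss term kept on the left.
  Equality of their integrals over all \<open>{..x}\<close> gives equality for almost every
  \<open>w\<close>, and \<open>ode_unique\<close> then removes the factor \<open>H\<close> and the
  loss term.\<close>

lemma mild_from_integrated:
  assumes m: "meas2 u" and K: "K < \<infinity>" and bound: "\<And>t x. u t x \<le> K"
    and eq: "\<And>t x. 0 \<le> t \<Longrightarrow> (\<integral>\<^sup>+y. u t y * indicator {..x} y \<partial>stat) =
       (\<integral>\<^sup>+y. u 0 y * indicator {..x - t} y \<partial>stat) +
       (\<integral>\<^sup>+s. indicator {0..t} s * (ennreal (exp (2 * (x - t + s))) * (H (x - t + s) * Q (u s) (x - t + s))) \<partial>lborel)"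
    and T: "0 \<le> T"
  shows "AE x in lborel. u T x = S T (u 0) x + J u T x"
proof -
  note [measurable (raw)] = borel_measurable_curried[OF m] borel_measurable_curried[OF meas2_Q[OF m]]
  have Q_bound: "Q (u s) x \<le> K" for s x
    using Q_mono[of "u s" "\<lambda>_. K" x] bound by (simp add: Q_const)
  define E where "E x = ennreal (exp (2 * x))" for x :: real
  have [measurable]: "E \<in> borel_measurable borel" unfolding E_def by measurable
  have E_add: "E (x + s) = E x * E s" for x s
    unfolding E_def by (simp add: ennreal_mult[symmetric] exp_add[symmetric] algebra_simps)
  define A where "A t w = E (w + t) * (H (w + t) * u t (w + t)) + (\<integral>\<^sup>+s. indicator {0..t} s * (E (w + s) * (k (w + s) * u s (w + s))) \<partial>lborel)" for t w
  define B where "B t w = E w * (H w * u 0 w) + (\<integral>\<^sup>+s. indicator {0..t} s * (2 * (E (w + s) * (H (w + s) * Q (u s) (w + s)))) \<partial>lborel)" for t w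
  have mA: "meas2 A" and mB: "meas2 B" unfolding A_def B_def by measurable
  note [measurable (raw)] = borel_measurable_curried[OF mA] borel_measurable_curried[OF mB]
  have shift_Iic: "(\<integral>\<^sup>+w. f (w + s) * indicator {..x} w \<partial>lborel) = (\<integral>\<^sup>+w. f w * indicator {..x + s} w \<partial>lborel)"
    if [measurable]: "f \<in> borel_measurable borel" for f :: "real \<Rightarrow> ennreal" and s x :: real
  proof -
    have "(\<integral>\<^sup>+w. f (w + s) * indicator {..x} w \<partial>lborel) = (\<integral>\<^sup>+w. f (w + s) * indicator {..x + s} (w + s) \<partial>lborel)"
      by (intro nn_integral_cong) (auto simp: indicator_def)
    also have "\<dots> = (\<integral>\<^sup>+w. f w * indicator {..x + s} w \<partial>lborel)"
      by (rule nn_integral_shift[of "\<lambda>w. f w * indicator {..x + s} w"]) measurable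
    finally show ?thesis .
  qed
  have swap: "(\<integral>\<^sup>+w. (\<integral>\<^sup>+s. indicator {0..t} s * g s (w + s) \<partial>lborel) * indicator {..x} w \<partial>lborel)
     = (\<integral>\<^sup>+s. indicator {0..t} s * (\<integral>\<^sup>+w. g s w * indicator {..x + s} w \<partial>lborel) \<partial>lborel)"
    if mg: "meas2 g" for g :: "real \<Rightarrow> real \<Rightarrow> ennreal" and t x :: real
  proof -
    note [measurable (raw)] = borel_measurable_curried[OF mg]
    have "(\<integral>\<^sup>+w. (\<integral>\<^sup>+s. indicator {0..t} s * g s (w + s) \<partial>lborel) * indicator {..x} w \<partial>lborel)
      = (\<integral>\<^sup>+w. (\<integral>\<^sup>+s. indicator {0..t} s * g s (w + s) * indicator {..x} w \<partial>lborel) \<partial>lborel)"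
      by (intro nn_integral_cong nn_integral_multc[symmetric]) measurable
    also have "\<dots> = (\<integral>\<^sup>+s. (\<integral>\<^sup>+w. indicator {0..t} s * g s (w + s) * indicator {..x} w \<partial>lborel) \<partial>lborel)"
      by (rule lborel_pair.Fubini') measurable
    also have "\<dots> = (\<integral>\<^sup>+s. indicator {0..t} s * (\<integral>\<^sup>+w. g s (w + s) * indicator {..x} w \<partial>lborel) \<partial>lborel)"
      by (intro nn_integral_cong nn_integral_factor) (simp add: mult_ac, measurable)
    also have "\<dots> = (\<integral>\<^sup>+s. indicator {0..t} s * (\<integral>\<^sup>+w. g s w * indicator {..x + s} w \<partial>lborel) \<partial>lborel)"
      by (intro nn_integral_cong arg_cong2[where f="(*)"] refl shift_Iic measurable_slice[OF mg])
    finally show ?thesis .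
  qed
  have stat_Iic: "(\<integral>\<^sup>+y. f y * indicator {..x} y \<partial>stat) = (\<integral>\<^sup>+y. E y * (H y * f y) * indicator {..x} y \<partial>lborel)"
    if [measurable]: "f \<in> borel_measurable borel" for f x
    by (subst nn_integral_stat) (auto simp: E_def mult_ac)
  have AB: "AE w in lborel. A t w = B t w" if t: "0 \<le> t" for t
  proof (rule density_lborel_eqI)
    fix x
    \<comment> \<open>The loss by jumps is added to both sides instead of being subtracted; it is
      finite because the flux of the constant \<open>K\<close> is \<open>2 * K\<close>.\<close>
    define W where "W = (\<integral>\<^sup>+s. indicator {0..t} s * (\<integral>\<^sup>+w. E w * (k w * u s w) * indicator {..x + s} w \<partial>lborel) \<partial>lborel)"
    have A_int: "(\<integral>\<^sup>+w. A t w * indicator {..x} w \<partial>lborel) = (\<integral>\<^sup>+y. u t y * indicator {..x + t} y \<partial>stat) + W"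
    proof -
      have "(\<integral>\<^sup>+w. A t w * indicator {..x} w \<partial>lborel) = (\<integral>\<^sup>+w. E (w + t) * (H (w + t) * u t (w + t)) * indicator {..x} w \<partial>lborel)
         + (\<integral>\<^sup>+w. (\<integral>\<^sup>+s. indicator {0..t} s * (E (w + s) * (k (w + s) * u s (w + s))) \<partial>lborel) * indicator {..x} w \<partial>lborel)"
        unfolding A_def distrib_right by (rule nn_integral_add) measurable
      also have "(\<integral>\<^sup>+w. (\<integral>\<^sup>+s. indicator {0..t} s * (E (w + s) * (k (w + s) * u s (w + s))) \<partial>lborel) * indicator {..x} w \<partial>lborel) = W"
        unfolding W_def by (rule swap[of "\<lambda>s w. E w * (k w * u s w)"]) measurable
      also have "(\<integral>\<^sup>+w. E (w + t) * (H (w + t) * u t (w + t)) * indicator {..x} w \<partial>lborel) = (\<integral>\<^sup>+y. u t y * indicator {..x + t} y \<partial>stat)"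
        unfolding stat_Iic[OF measurable_slice[OF m]]
        by (rule shift_Iic[of "\<lambda>w. E w * (H w * u t w)"]) measurable
      finally show ?thesis .
    qed
    have B_int: "(\<integral>\<^sup>+w. B t w * indicator {..x} w \<partial>lborel) = (\<integral>\<^sup>+y. u 0 y * indicator {..x} y \<partial>stat) +
        (\<integral>\<^sup>+s. indicator {0..t} s * (\<integral>\<^sup>+w. 2 * (E w * (H w * Q (u s) w)) * indicator {..x + s} w \<partial>lborel) \<partial>lborel)"
    proof -
      have "(\<integral>\<^sup>+w. B t w * indicator {..x} w \<partial>lborel) = (\<integral>\<^sup>+w. E w * (H w * u 0 w) * indicator {..x} w \<partial>lborel)
         + (\<integral>\<^sup>+w. (\<integral>\<^sup>+s. indicator {0..t} s * (2 * (E (w + s) * (H (w + s) * Q (u s) (w + s)))) \<partial>lborel) * indicator {..x} w \<partial>lborel)"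
        unfolding B_def distrib_right by (rule nn_integral_add) measurable
      also have "(\<integral>\<^sup>+w. (\<integral>\<^sup>+s. indicator {0..t} s * (2 * (E (w + s) * (H (w + s) * Q (u s) (w + s)))) \<partial>lborel) * indicator {..x} w \<partial>lborel)
         = (\<integral>\<^sup>+s. indicator {0..t} s * (\<integral>\<^sup>+w. 2 * (E w * (H w * Q (u s) w)) * indicator {..x + s} w \<partial>lborel) \<partial>lborel)"
        by (rule swap[of "\<lambda>s w. 2 * (E w * (H w * Q (u s) w))"]) measurable
      finally show ?thesis unfolding stat_Iic[OF measurable_slice[OF m]] .
    qed
    have "(\<integral>\<^sup>+s. indicator {0..t} s * (\<integral>\<^sup>+w. 2 * (E w * (H w * Q (u s) w)) * indicator {..x + s} w \<partial>lborel) \<partial>lborel)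
      = (\<integral>\<^sup>+s. indicator {0..t} s * (E (x + s) * (H (x + s) * Q (u s) (x + s))) +
           indicator {0..t} s * (\<integral>\<^sup>+w. E w * (k w * u s w) * indicator {..x + s} w \<partial>lborel) \<partial>lborel)"
      unfolding E_def boundary_identity[OF measurable_slice[OF m], symmetric] distrib_left ..
    also have "\<dots> = (\<integral>\<^sup>+s. indicator {0..t} s * (E (x + s) * (H (x + s) * Q (u s) (x + s))) \<partial>lborel) + W"
      unfolding W_def by (rule nn_integral_add) measurable
    finally show "(\<integral>\<^sup>+w. A t w * indicator {..x} w \<partial>lborel) = (\<integral>\<^sup>+w. B t w * indicator {..x} w \<partial>lborel)"
      unfolding A_int B_int eq[OF t] by (simp add: E_def add.assoc)
    have "W \<le> (\<integral>\<^sup>+s. indicator {0..t} s * flux (\<lambda>_. K) \<partial>lborel)"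
      unfolding W_def flux_def using bound
      by (intro nn_integral_mono mult_left_mono) (auto simp: indicator_def E_def mult.assoc intro!: mult_left_mono)
    also have "\<dots> < top" using K t by (simp add: nn_integral_multc flux_const ennreal_mult_less_top)
    finally have "W < top" .
    moreover have "(\<integral>\<^sup>+y. u t y * indicator {..x + t} y \<partial>stat) < top"
    proof -
      have "(\<integral>\<^sup>+y. u t y * indicator {..x + t} y \<partial>stat) \<le> (\<integral>\<^sup>+y. K \<partial>stat)"
        by (intro nn_integral_mono) (auto simp: indicator_def bound)
      then show ?thesis using K emeasure_stat by (auto intro: le_less_trans)
    qed
    ultimately show "(\<integral>\<^sup>+w. A t w * indicator {..x} w \<partial>lborel) < top"
      unfolding A_int by simp
  qed measurable
  \<comment> \<open>The exceptional set of \<open>w\<close> depends on \<open>t\<close>. Exchanging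
    the quantifiers gives, for almost every characteristic, the equation at almost all times; the
    equation at \<open>T\<close> is kept separately through \<open>AB[OF T]\<close>.\<close>
  have "AE t in lborel. AE w in lborel. 0 \<le> t \<longrightarrow> A t w = B t w"
    by (rule AE_I2) (use AB in auto)
  then have "AE w in lborel. AE t in lborel. 0 \<le> t \<longrightarrow> A t w = B t w"
    by (subst lborel_pair.AE_commute) measurable
  with AB[OF T] have "AE w in lborel. u T (w + T) = S T (u 0) (w + T) + J u T (w + T)"
  proof eventually_elim
    case (elim w)
    have E_cancel: "E w * x = E w * y \<Longrightarrow> x = y" for x y
      unfolding E_def by (subst (asm) ennreal_mult_cancel_left) auto
    have eq_w: "H (w + t) * (E t * u t (w + t)) + (\<integral>\<^sup>+s. indicator {0..t} s * (k (w + s) * (E s * u s (w + s))) \<partial>lborel)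
        = H (w + 0) * (E 0 * u 0 (w + 0)) + (\<integral>\<^sup>+s. indicator {0..t} s * (H (w + s) * (2 * E s * Q (u s) (w + s))) \<partial>lborel)"
      if AB: "A t w = B t w" for t
    proof -
      have "A t w = E w * (H (w + t) * (E t * u t (w + t)) + (\<integral>\<^sup>+s. indicator {0..t} s * (k (w + s) * (E s * u s (w + s))) \<partial>lborel))"
        unfolding A_def distrib_left E_add
        by (intro arg_cong2[where f="(+)"] nn_integral_factor) (simp_all add: mult_ac)
      moreover have "B t w = E w * (H (w + 0) * (E 0 * u 0 (w + 0)) + (\<integral>\<^sup>+s. indicator {0..t} s * (H (w + s) * (2 * E s * Q (u s) (w + s))) \<partial>lborel))"
        unfolding B_def distrib_left E_add
        by (intro arg_cong2[where f="(+)"] nn_integral_factor) (simp_all add: mult_ac E_def)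
      ultimately show ?thesis using AB E_cancel by simp
    qed
    have E_le: "E s \<le> E T" if "s \<le> T" for s unfolding E_def using that by (intro ennreal_leI) simp
    have "E T * u T (w + T) = E 0 * u 0 (w + 0) + (\<integral>\<^sup>+s. indicator {0..T} s * (2 * E s * Q (u s) (w + s)) \<partial>lborel)"
    \<comment> \<open>The weight \<open>exp (2 * s)\<close> is the integrating factor for the loss
      rate \<open>2\<close> of the reversed process: along a characteristic
      \<open>exp (2 s) u\<close> has derivative \<open>2 exp (2 s) Q u\<close>.\<close>
    proof (rule ode_unique[where \<eta>="\<lambda>s. H (w + s)" and \<kappa>="\<lambda>s. k (w + s)" and a="\<lambda>s. E s * u s (w + s)" and A="E T * K"])
      show "H (w + s) = H (w + t) + (\<integral>\<^sup>+r. indicator {s..t} r * k (w + r) \<partial>lborel)" if "0 \<le> s" "s \<le> t" for s t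
      proof -
        have "(\<integral>\<^sup>+r. indicator {s..t} r * k (w + r) \<partial>lborel) = (\<integral>\<^sup>+r. k (r + w) * indicator {w + s..w + t} (r + w) \<partial>lborel)"
          by (intro nn_integral_cong) (auto simp: indicator_def add.commute)
        also have "\<dots> = (\<integral>\<^sup>+z. k z * indicator {w + s..w + t} z \<partial>lborel)"
          by (rule nn_integral_shift[of "\<lambda>z. k z * indicator {w + s..w + t} z"]) simp
        also have "\<dots> = (\<integral>\<^sup>+z. k z * indicator {w + s<..w + t} z \<partial>lborel)"
          by (rule nn_integral_cong_AE) (use AE_lborel_singleton[of "w + s"] in \<open>auto simp: indicator_def\<close>)
        finally show ?thesis using H_split[of "w + s" "w + t"] that by simp
      qed
      show "H (w + s) \<noteq> 0" "H (w + s) < top" for s using H_pos[of "w + s"] H_finite[of "w + s"] by auto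
      show "E T * K < top" using K by (simp add: E_def ennreal_mult_less_top)
      show "E s * u s (w + s) \<le> E T * K" if "s \<le> T" for s
        using that by (intro mult_mono E_le bound) auto
      have "(\<integral>\<^sup>+s. indicator {0..T} s * (2 * E s * Q (u s) (w + s)) \<partial>lborel) \<le> (\<integral>\<^sup>+s. indicator {0..T} s * (2 * E T * K) \<partial>lborel)"
        by (intro nn_integral_mono) (auto simp: indicator_def intro!: mult_mono E_le Q_bound)
      also have "\<dots> < top" using K T by (simp add: nn_integral_multc E_def ennreal_mult_less_top)
      finally show "(\<integral>\<^sup>+s. indicator {0..T} s * (2 * E s * Q (u s) (w + s)) \<partial>lborel) < top" .
      show "AE t in lborel. t \<in> {0..T} \<longrightarrow> H (w + t) * (E t * u t (w + t)) + (\<integral>\<^sup>+s. indicator {0..t} s * (k (w + s) * (E s * u s (w + s))) \<partial>lborel)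
        = H (w + 0) * (E 0 * u 0 (w + 0)) + (\<integral>\<^sup>+s. indicator {0..t} s * (H (w + s) * (2 * E s * Q (u s) (w + s))) \<partial>lborel)"
        using elim(2) by eventually_elim (use eq_w in auto)
    qed (use T eq_w[OF elim(1)] in measurable)
    then have "E (- T) * E T * u T (w + T) = E (- T) * (u 0 w + (\<integral>\<^sup>+s. indicator {0..T} s * (2 * E s * Q (u s) (w + s)) \<partial>lborel))"
      by (simp add: mult.assoc E_def[of 0])
    also have "E (- T) * E T = 1" unfolding E_add[symmetric] by (simp add: E_def)
    also have "E (- T) * (u 0 w + (\<integral>\<^sup>+s. indicator {0..T} s * (2 * E s * Q (u s) (w + s)) \<partial>lborel)) = S T (u 0) (w + T) + J u T (w + T)"
      unfolding distrib_left
    proof (intro arg_cong2[where f="(+)"])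
      show "E (- T) * u 0 w = S T (u 0) (w + T)" by (simp add: S_def E_def)
      show "E (- T) * (\<integral>\<^sup>+s. indicator {0..T} s * (2 * E s * Q (u s) (w + s)) \<partial>lborel) = J u T (w + T)"
        unfolding J_def
      proof (rule nn_integral_factor[symmetric])
        fix s
        have "ennreal (exp (- 2 * (T - s))) = E (- T) * E s"
          unfolding E_add[symmetric] by (simp add: E_def)
        then show "indicator {0..T} s * (2 * S (T - s) (Q (u s)) (w + T)) = E (- T) * (indicator {0..T} s * (2 * E s * Q (u s) (w + s)))"
          by (simp add: S_def mult_ac add.commute)
      qed measurable
    qed
    finally show ?case by simp
  qed
  then show ?thesis
    by (rule AE_lborel_shift[rotated])
       (use measurable_slice[OF meas2_J[OF m], of T] measurable_S[OF measurable_slice[OF m, of 0], of T] in measurable)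
qed

end

section \<open>Flows of distribution functions\<close>

text \<open>Recovers a density from increments of the distribution function by an explicit limit,
  which stays measurable in further parameters. An abstract Radon-Nikodym derivative chosen for each
  time would not provide this.\<close>

lemma lebesgue_differentiation_density:
  fixes f :: "real \<Rightarrow> ennreal"
  assumes f [measurable]: "f \<in> borel_measurable borel" and fin: "(\<integral>\<^sup>+x. f x \<partial>lborel) < top"
  shows "AE x in lborel. (\<lambda>n. emeasure (density lborel f) {x<..x + 1 / real (Suc n)} * ennreal (real (Suc n))) \<longlonglongrightarrow> f x"
proof -
  define g where "g x = enn2real (f x)" for x
  have [measurable]: "g \<in> borel_measurable borel" unfolding g_def by measurable
  have fg: "AE x in lborel. f x = ennreal (g x)"
    using nn_integral_PInf_AE[of f lborel] fin unfolding g_def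
    by (auto elim!: eventually_mono simp: less_top[symmetric])
  have int: "integrable lborel g"
  proof (rule integrableI_nonneg)
    have "(\<integral>\<^sup>+x. ennreal (g x) \<partial>lborel) = (\<integral>\<^sup>+x. f x \<partial>lborel)"
      using fg by (intro nn_integral_cong_AE) auto
    then show "(\<integral>\<^sup>+x. ennreal (g x) \<partial>lborel) < \<infinity>" using fin by simp
  qed (auto simp: g_def)
  have sint: "set_integrable lborel {a..b} g" for a b
    unfolding set_integrable_def using int by (intro integrable_mult_indicator) auto
  have "g integrable_on cbox a b" for a b :: real
    using set_borel_integral_eq_integral(1)[OF sint, of a b] by simp
  then obtain N where N: "negligible N"
    and lim: "\<And>x e. x \<notin> N \<Longrightarrow> 0 < e \<Longrightarrow> \<exists>d>0. \<forall>h. 0 < h \<and> h < d \<longrightarrow>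
        norm (integral (cbox x (x + h *\<^sub>R One)) g /\<^sub>R h ^ DIM(real) - g x) < e"
    using integrable_ccontinuous_explicit[of g] by blast
  have "AE x in lborel. x \<notin> N"
    using N AE_not_in[of N lebesgue] by (simp add: negligible_iff_null_sets AE_completion_iff)
  with fg show ?thesis
  proof eventually_elim
    case (elim x)
    have em: "emeasure (density lborel f) {x<..x + h} = ennreal (integral {x..x + h} g)" if "0 < h" for h
    proof -
      have "emeasure (density lborel f) {x<..x + h} = (\<integral>\<^sup>+y. f y * indicator {x<..x + h} y \<partial>lborel)"
        by (rule emeasure_density) auto
      also have "\<dots> = (\<integral>\<^sup>+y. ennreal (g y * indicator {x..x + h} y) \<partial>lborel)"
      proof (rule nn_integral_cong_AE)
        show "AE y in lborel. f y * indicator {x<..x + h} y = ennreal (g y * indicator {x..x + h} y)"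
          using fg AE_lborel_singleton[of x] by eventually_elim (auto simp: indicator_def)
      qed
      also have "\<dots> = ennreal (LINT y:{x..x + h}|lborel. g y)"
        unfolding set_lebesgue_integral_def
        using sint[of x "x + h"] by (subst nn_integral_eq_integral)
          (auto simp: g_def set_integrable_def mult.commute)
      also have "(LINT y:{x..x + h}|lborel. g y) = integral {x..x + h} g"
        by (rule set_borel_integral_eq_integral(2)[OF sint])
      finally show ?thesis .
    qed
    have nonneg: "0 \<le> integral {x..x + h} g" for h
      by (rule integral_nonneg) (use set_borel_integral_eq_integral(1)[OF sint] in \<open>auto simp: g_def\<close>)
    have "(\<lambda>n. integral {x..x + 1 / real (Suc n)} g * real (Suc n)) \<longlonglongrightarrow> g x"
    proof (rule LIMSEQ_I)
      fix e :: real assume "0 < e"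
      then obtain d where d: "0 < d" and less: "\<And>h. 0 < h \<Longrightarrow> h < d \<Longrightarrow> norm (integral {x..x + h} g / h - g x) < e"
        using lim[OF elim(2) \<open>0 < e\<close>] by (auto simp: divide_inverse mult.commute)
      obtain n0 where n0: "1 / real (Suc n0) < d" using d nat_approx_posE by blast
      have "norm (integral {x..x + 1 / real (Suc n)} g * real (Suc n) - g x) < e" if "n0 \<le> n" for n
      proof -
        have "1 / real (Suc n) \<le> 1 / real (Suc n0)" using that by (intro divide_left_mono) auto
        then show ?thesis using less[of "1 / real (Suc n)"] n0 by simp
      qed
      then show "\<exists>n0. \<forall>n\<ge>n0. norm (integral {x..x + 1 / real (Suc n)} g * real (Suc n) - g x) < e" by blast
    qed
    then have "(\<lambda>n. ennreal (integral {x..x + 1 / real (Suc n)} g * real (Suc n))) \<longlonglongrightarrow> ennreal (g x)"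
      by (rule tendsto_ennrealI)
    then show ?case unfolding elim(1) by (simp add: em ennreal_mult nonneg del: of_nat_Suc)
  qed
qed

lemma
  assumes "G \<in> Dsub"
  shows Dsub_mono: "x \<le> y \<Longrightarrow> G x \<le> G y" and Dsub_range: "0 \<le> G x" "G x \<le> 1"
    and Dsub_right_cont: "continuous (at_right x) G" and Dsub_at_bot: "(G \<longlongrightarrow> 0) at_bot"
proof -
  have G: "cadlag_on_nonneg G" "mono_on {0..} G" "\<And>x. 0 \<le> x \<Longrightarrow> 0 \<le> G x \<and> G x \<le> 1" "\<And>x. x < 0 \<Longrightarrow> G x = 0"
    using assms by (auto simp: Dsub_def Pi_iff)
  show r: "0 \<le> G x" "G x \<le> 1" for x using G(3)[of x] G(4)[of x] by (cases "x < 0"; simp)+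
  show "G x \<le> G y" if "x \<le> y" for x y
    using G(2)[THEN mono_onD, of x y] G(4)[of x] r[of y] that by (cases "x < 0") auto
  show "(G \<longlongrightarrow> 0) at_bot"
    by (rule tendsto_eventually) (use G(4) eventually_gt_at_bot[of 0] eventually_at_bot_dense in blast)
  show "continuous (at_right x) G"
  proof (cases "x < 0")
    case True
    have "eventually (\<lambda>y. G y = 0) (at_right x)"
      using True G(4) by (auto simp: eventually_at_right_field intro!: exI[of _ 0])
    then show ?thesis using True by (simp add: continuous_within G(4) tendsto_eventually)
  qed (use G(1) in \<open>auto simp: cadlag_on_nonneg_def\<close>)
qed

definition df :: "(real \<Rightarrow> real) \<Rightarrow> bool" where
  "df G \<longleftrightarrow> G \<in> Dsub \<and> G 0 = 0 \<and> (G \<longlongrightarrow> 1) at_top"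

lemma df_real_distribution: "df G \<Longrightarrow> real_distribution (interval_measure G)"
  by (rule real_distribution_interval_measure) (auto simp: df_def Dsub_mono Dsub_right_cont Dsub_at_bot)

lemma df_emeasure_Iic: "df G \<Longrightarrow> emeasure (interval_measure G) {..x} = ennreal (G x)"
  by (rule emeasure_interval_measure_Iic) (auto simp: df_def Dsub_mono Dsub_right_cont Dsub_at_bot)

lemma df_AE_pos: assumes G: "df G" shows "AE x in interval_measure G. 0 < x"
proof -
  have "emeasure (interval_measure G) {..0} = 0" using df_emeasure_Iic[OF G, of 0] G by (simp add: df_def)
  then show ?thesis by (intro AE_I[where N="{..0}"]) auto
qed

lemma flow_in_Dsub: "F \<in> flows \<Longrightarrow> 0 \<le> t \<Longrightarrow> F t \<in> Dsub"
  unfolding flows_def borel_Dsub_def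
  by (drule measurable_space[where x=t]) (auto simp: space_restrict_space space_measure_of_conv)

text \<open>Convergence at infinity is derived from the tightness clause and monotonicity, because a
  bare \<open>Lim\<close> does not assert that a limit exists.\<close>

lemma solution_df:
  assumes F: "F \<in> solutions R" and t: "0 \<le> t"
  shows "df (F t)"
proof -
  have D: "F t \<in> Dsub" using F t by (auto simp: solutions_def intro: flow_in_Dsub)
  have tight: "\<exists>N>0. F t N > 1 - e" if "0 < e" for e
    using F t that unfolding solutions_def by blast
  have "(F t \<longlongrightarrow> 1) at_top"
  proof (rule order_tendstoI)
    fix a :: real assume "a < 1"
    then obtain N where "F t N > a" using tight[of "1 - a"] by auto
    then show "eventually (\<lambda>x. a < F t x) at_top"
      unfolding eventually_at_top_linorder by (intro exI[of _ N]) (auto intro: less_le_trans Dsub_mono[OF D])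
  next
    fix a :: real assume "1 < a"
    then show "eventually (\<lambda>x. F t x < a) at_top"
      by (auto intro!: always_eventually le_less_trans[OF Dsub_range(2)[OF D]])
  qed
  then show ?thesis using D F t by (auto simp: df_def solutions_def)
qed

text \<open>Averages over an interval are continuous for the distance \<open>dL1loc\<close>, whereas
  evaluation at a point is not; measurability of point values is obtained from these
  averages.\<close>

lemma openin_Dsub_integral:
  assumes q: "0 \<le> q" and h: "0 \<le> h" and U: "open U"
  shows "openin (Metric_space.mtopology Dsub dL1loc) {G \<in> Dsub. (LINT y:{q..q + h}|lborel. G y) \<in> U}"
proof -
  interpret M: Metric_space Dsub dL1loc by (rule Metric_space_Dsub)
  have int: "set_integrable lborel {a..b} G" if "0 \<le> a" "G \<in> Dsub" for G a b
  proof -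
    have "set_integrable lborel {0..max 0 b} G" using that by (auto simp: Dsub_def L1loc_def)
    then show ?thesis by (rule set_integrable_subset) (use that in auto)
  qed
  obtain k where k: "q + h \<le> real (Suc k)" using real_arch_simple[of "q + h"] by (metis le_Suc_eq of_nat_mono order_trans order_refl lessI less_imp_le)
  \<comment> \<open>When the distance is below the cap \<open>(1/2) ^ Suc k\<close>, the minimum in
    the summand \<open>k\<close> must be the integral itself, and that integral covers
    \<open>{q..q + h}\<close>.\<close>
  have close: "\<bar>(LINT y:{q..q + h}|lborel. G y) - (LINT y:{q..q + h}|lborel. G' y)\<bar> < e"
    if G: "G \<in> Dsub" "G' \<in> Dsub" and d: "dL1loc G G' < min e ((1/2) ^ Suc k)" for G G' e
  proof -
    define I where "I j = (LINT x:{0..real (Suc j)}|lborel. \<bar>G x - G' x\<bar>)" for j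
    have I_nonneg: "0 \<le> I j" for j
      unfolding I_def set_lebesgue_integral_def by (intro integral_nonneg_AE) auto
    have summ: "summable (\<lambda>k. min ((1/2) ^ Suc k) (I k))"
      by (rule summable_comparison_test'[where g="\<lambda>k. (1/2) ^ Suc k" and N=0])
         (use I_nonneg in \<open>auto simp: summable_mult summable_geometric\<close>)
    have "min ((1/2) ^ Suc k) (I k) \<le> dL1loc G G'"
      unfolding dL1loc_def I_def[symmetric]
      using sum_le_suminf[OF summ, of "{k}"] I_nonneg by simp
    with d have "I k < e" by linarith
    moreover have "\<bar>(LINT y:{q..q + h}|lborel. G y) - (LINT y:{q..q + h}|lborel. G' y)\<bar> \<le> I k"
    proof -
      have i: "set_integrable lborel {q..q + h} (\<lambda>y. G y - G' y)"
        using G q by (intro set_integral_diff int)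
      have i': "set_integrable lborel {0..real (Suc k)} (\<lambda>y. \<bar>G y - G' y\<bar>)"
        using G by (intro set_integrable_abs set_integral_diff int) auto
      have "(LINT y:{q..q + h}|lborel. G y) - (LINT y:{q..q + h}|lborel. G' y) = (LINT y:{q..q + h}|lborel. G y - G' y)"
        using G q by (intro set_integral_diff(2)[symmetric] int)
      moreover have "\<bar>LINT y:{q..q + h}|lborel. G y - G' y\<bar> \<le> (LINT y:{q..q + h}|lborel. \<bar>G y - G' y\<bar>)"
        using set_integral_norm_bound[OF i] by simp
      moreover have "(LINT y:{q..q + h}|lborel. \<bar>G y - G' y\<bar>) \<le> I k"
      proof -
        have "set_integrable lborel {q..q + h} (\<lambda>y. \<bar>G y - G' y\<bar>)"
          by (rule set_integrable_subset[OF i']) (use q k in auto)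
        then show ?thesis
          unfolding I_def set_lebesgue_integral_def using i' q k
          by (intro integral_mono) (auto simp: set_integrable_def indicator_def)
      qed
      ultimately show ?thesis by simp
    qed
    ultimately show ?thesis by simp
  qed
  show ?thesis
    unfolding M.openin_mtopology
  proof (intro conjI allI impI)
    fix G assume G: "G \<in> {G \<in> Dsub. (LINT y:{q..q + h}|lborel. G y) \<in> U}"
    then obtain e where e: "0 < e" "ball (LINT y:{q..q + h}|lborel. G y) e \<subseteq> U"
      using U by (auto simp: open_contains_ball)
    show "\<exists>r>0. M.mball G r \<subseteq> {G \<in> Dsub. (LINT y:{q..q + h}|lborel. G y) \<in> U}"
    proof (intro exI[of _ "min e ((1/2) ^ Suc k)"] conjI subsetI)
      fix G' assume "G' \<in> M.mball G (min e ((1/2) ^ Suc k))"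
      then have "G' \<in> Dsub" "(LINT y:{q..q + h}|lborel. G' y) \<in> ball (LINT y:{q..q + h}|lborel. G y) e"
        using close[of G G' e] by (auto simp: dist_real_def)
      then show "G' \<in> {G \<in> Dsub. (LINT y:{q..q + h}|lborel. G y) \<in> U}" using e by auto
    qed (use e in simp)
  qed auto
qed

text \<open>
  A flow is unconstrained at negative times, whence \<open>max 0 t\<close>.
\<close>

lemma flow_average_measurable:
  assumes F: "F \<in> flows" and q: "0 \<le> q" and h: "0 \<le> h"
  shows "(\<lambda>t. LINT y:{q..q + h}|lborel. F (max 0 t) y) \<in> borel_measurable borel"
proof -
  have "(\<lambda>G. LINT y:{q..q + h}|lborel. G y) \<in> borel_measurable borel_Dsub"
  proof (rule borel_measurableI)
    fix U :: "real set" assume "open U"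
    have sub: "{U. openin (Metric_space.mtopology Dsub dL1loc) U} \<subseteq> Pow Dsub"
      using openin_subset[of "Metric_space.mtopology Dsub dL1loc"]
      by (auto simp: Metric_space.topspace_mtopology[OF Metric_space_Dsub])
    have "{G \<in> Dsub. (LINT y:{q..q + h}|lborel. G y) \<in> U} \<in> sets borel_Dsub"
      unfolding borel_Dsub_def using openin_Dsub_integral[OF q h \<open>open U\<close>] sub
      by (intro in_measure_of) auto
    moreover have "space borel_Dsub = Dsub" by (simp add: borel_Dsub_def space_measure_of_conv)
    ultimately show "(\<lambda>G. LINT y:{q..q + h}|lborel. G y) -` U \<inter> space borel_Dsub \<in> sets borel_Dsub"
      by (simp add: vimage_def Int_def conj_commute)
  qed
  moreover have "(\<lambda>t. max 0 t) \<in> borel \<rightarrow>\<^sub>M restrict_space borel {0::real..}"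
    by (intro measurable_restrict_space2) auto
  moreover have "F \<in> restrict_space borel {0..} \<rightarrow>\<^sub>M borel_Dsub" using F by (simp add: flows_def)
  ultimately show ?thesis by measurable
qed

lemma right_cont_seq:
  assumes "continuous (at_right x) G" "\<And>n. x < X n" "X \<longlonglongrightarrow> x"
  shows "(\<lambda>n. G (X n)) \<longlonglongrightarrow> G (x::real)"
proof -
  have "filterlim X (at_right x) sequentially"
    unfolding filterlim_at using assms by (auto simp: less_imp_neq[symmetric] intro!: always_eventually)
  with assms(1) show ?thesis
    unfolding continuous_within by (rule filterlim_compose)
qed

text \<open>Monotonicity places the average over \<open>{q..q + h}\<close> between the values at
  \<open>q\<close> and \<open>q + h\<close>, and right continuity lets \<open>h\<close> tend to
  \<open>0\<close>.\<close>

lemma flow_value_measurable: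
  assumes F: "F \<in> flows" and q: "0 \<le> q"
  shows "(\<lambda>t. F (max 0 t) q) \<in> borel_measurable borel"
proof (rule borel_measurable_LIMSEQ_real)
  show "(\<lambda>t. (LINT y:{q..q + 1 / real (Suc n)}|lborel. F (max 0 t) y) * real (Suc n)) \<in> borel_measurable borel" for n
    using flow_average_measurable[OF F q, of "1 / real (Suc n)"] by measurable
  fix t
  define G where "G = F (max 0 t)"
  have G: "G \<in> Dsub" unfolding G_def by (rule flow_in_Dsub[OF F]) simp
  have int: "set_integrable lborel {q..b} G" for b
  proof -
    have "set_integrable lborel {0..max 0 b} G" using G by (auto simp: Dsub_def L1loc_def)
    then show ?thesis by (rule set_integrable_subset) (use q in auto)
  qed
  have const: "(LINT y:{q..q + h}|lborel. c) = c * h" "set_integrable lborel {q..q + h} (\<lambda>_. c)" if "0 \<le> h" for c h :: real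
    using that by (simp_all add: set_lebesgue_integral_def set_integrable_def)
  have low: "G q \<le> (LINT y:{q..q + h}|lborel. G y) / h" and up: "(LINT y:{q..q + h}|lborel. G y) / h \<le> G (q + h)" if h: "0 < h" for h
  proof -
    have "(LINT y:{q..q + h}|lborel. G q) \<le> (LINT y:{q..q + h}|lborel. G y)"
      by (intro set_integral_mono int const) (use h Dsub_mono[OF G] in auto)
    then show "G q \<le> (LINT y:{q..q + h}|lborel. G y) / h"
      unfolding const(1)[OF less_imp_le[OF h]] using h by (simp add: field_simps)
    have "(LINT y:{q..q + h}|lborel. G y) \<le> (LINT y:{q..q + h}|lborel. G (q + h))"
      by (intro set_integral_mono int const) (use h Dsub_mono[OF G] in auto)
    then show "(LINT y:{q..q + h}|lborel. G y) / h \<le> G (q + h)"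
      unfolding const(1)[OF less_imp_le[OF h]] using h by (simp add: field_simps)
  qed
  have lim: "(\<lambda>n. q + 1 / real (Suc n)) \<longlonglongrightarrow> q"
    using tendsto_add[OF tendsto_const[of q] LIMSEQ_inverse_real_of_nat] by (simp add: inverse_eq_divide)
  have upper: "(\<lambda>n. G (q + 1 / real (Suc n))) \<longlonglongrightarrow> G q"
    by (rule right_cont_seq[OF Dsub_right_cont[OF G] _ lim]) simp
  have "(\<lambda>n. (LINT y:{q..q + 1 / real (Suc n)}|lborel. G y) * real (Suc n)) \<longlonglongrightarrow> G q"
  proof (rule tendsto_sandwich[OF _ _ tendsto_const upper])
    show "eventually (\<lambda>n. G q \<le> (LINT y:{q..q + 1 / real (Suc n)}|lborel. G y) * real (Suc n)) sequentially"
      using low[of "1 / real (Suc _)"] by simp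
    show "eventually (\<lambda>n. (LINT y:{q..q + 1 / real (Suc n)}|lborel. G y) * real (Suc n) \<le> G (q + 1 / real (Suc n))) sequentially"
      using up[of "1 / real (Suc _)"] by simp
  qed
  then show "(\<lambda>n. (LINT y:{q..q + 1 / real (Suc n)}|lborel. F (max 0 t) y) * real (Suc n)) \<longlonglongrightarrow> F (max 0 t) q"
    unfolding G_def .
qed

text \<open>The space variable is rounded to a countable grid, where measurability in time suffices,
  and right continuity recovers the exact point in the limit.\<close>

lemma flow_jointly_measurable:
  assumes F: "F \<in> flows"
  shows "(\<lambda>p. F (max 0 (fst p)) (exp (snd p))) \<in> borel_measurable (borel \<Otimes>\<^sub>M borel)"
proof (rule borel_measurable_LIMSEQ_real)
  \<comment> \<open>The shift \<open>i + 1\<close> places the grid point strictly above the point it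
    approximates, as right continuity requires; \<open>max 0\<close> covers the negative
    indices.\<close>
  let ?r = "\<lambda>n i. real_of_int (i + 1) / real (Suc n)"
  show "(\<lambda>p. F (max 0 (fst p)) (max 0 (?r n \<lfloor>exp (snd p) * real (Suc n)\<rfloor>))) \<in> borel_measurable (borel \<Otimes>\<^sub>M borel)" for n
  proof (rule measurable_compose_countable[where f="\<lambda>i p. F (max 0 (fst p)) (max 0 (?r n i))" and g="\<lambda>p. \<lfloor>exp (snd p) * real (Suc n)\<rfloor>"])
    show "(\<lambda>p. F (max 0 (fst p)) (max 0 (?r n i))) \<in> borel_measurable (borel \<Otimes>\<^sub>M borel)" for i
      by (rule measurable_compose[OF measurable_fst flow_value_measurable[OF F]]) simp
  qed measurable
  fix p :: "real \<times> real"
  let ?y = "exp (snd p)"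
  have D: "F (max 0 (fst p)) \<in> Dsub" by (rule flow_in_Dsub[OF F]) simp
  have gt: "?y < ?r n \<lfloor>?y * real (Suc n)\<rfloor>" for n
    by (simp add: pos_less_divide_eq del: of_nat_Suc)
  have le: "?r n \<lfloor>?y * real (Suc n)\<rfloor> \<le> ?y + 1 / real (Suc n)" for n
  proof -
    have "?r n \<lfloor>?y * real (Suc n)\<rfloor> \<le> (?y * real (Suc n) + 1) / real (Suc n)"
      by (intro divide_right_mono) (auto simp del: of_nat_Suc)
    then show ?thesis by (simp add: add_divide_distrib del: of_nat_Suc)
  qed
  have lim: "(\<lambda>n. ?r n \<lfloor>?y * real (Suc n)\<rfloor>) \<longlonglongrightarrow> ?y"
  proof (rule tendsto_sandwich[OF _ _ tendsto_const])
    show "(\<lambda>n. ?y + 1 / real (Suc n)) \<longlonglongrightarrow> ?y"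
      using tendsto_add[OF tendsto_const[of ?y] LIMSEQ_inverse_real_of_nat] by (simp add: inverse_eq_divide)
  qed (use gt le in \<open>auto intro!: always_eventually less_imp_le\<close>)
  have max: "max 0 (?r n \<lfloor>?y * real (Suc n)\<rfloor>) = ?r n \<lfloor>?y * real (Suc n)\<rfloor>" for n
    using gt[of n] exp_gt_zero[of "snd p"] by (simp only: max_def) (meson less_le_trans less_imp_le order_less_trans)
  show "(\<lambda>n. F (max 0 (fst p)) (max 0 (?r n \<lfloor>?y * real (Suc n)\<rfloor>))) \<longlonglongrightarrow> F (max 0 (fst p)) ?y"
    unfolding max by (rule right_cont_seq[OF Dsub_right_cont[OF D] gt lim])
qed

section \<open>The stationary law\<close>

lemma nn_integral_atMost_tendsto:
  fixes f :: "real \<Rightarrow> ennreal"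
  assumes f [measurable]: "f \<in> borel_measurable borel"
  shows "(\<lambda>n. \<integral>\<^sup>+z. f z * indicator {x - real n..x} z \<partial>lborel) \<longlonglongrightarrow> (\<integral>\<^sup>+z. f z * indicator {..x} z \<partial>lborel)"
proof (rule nn_integral_LIMSEQ)
  show "incseq (\<lambda>n z. f z * indicator {x - real n..x} z)"
    by (auto simp: incseq_def le_fun_def indicator_def)
  fix z
  obtain n where n: "x - z \<le> real n" using real_arch_simple by blast
  have "eventually (\<lambda>i. f z * indicator {x - real i..x} z = f z * indicator {..x} z) sequentially"
    using eventually_ge_at_top[of n]
    by eventually_elim (use n in \<open>auto simp: indicator_def\<close>)
  then show "(\<lambda>i. f z * indicator {x - real i..x} z) \<longlonglongrightarrow> f z * indicator {..x} z"
    by (rule tendsto_eventually)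
qed measurable

text \<open>The law in the logarithmic coordinate. It is applied to laws with no mass on
  \<open>{..0}\<close>, so the values of \<open>ln\<close> there do not matter.\<close>

definition logm :: "(real \<Rightarrow> real) \<Rightarrow> real measure" where
  "logm G = distr (interval_measure G) borel ln"

lemma sets_logm [simp, measurable_cong]: "sets (logm G) = sets borel"
  by (simp add: logm_def)

lemma logm_Iic:
  assumes G: "df G"
  shows "emeasure (logm G) {..x} = ennreal (G (exp x))"
proof -
  have "emeasure (logm G) {..x} = emeasure (interval_measure G) (ln -` {..x} \<inter> space (interval_measure G))"
    unfolding logm_def by (intro emeasure_distr) auto
  also have "\<dots> = emeasure (interval_measure G) {..exp x}"
  proof (rule emeasure_eq_AE)
    show "AE z in interval_measure G. (z \<in> ln -` {..x} \<inter> space (interval_measure G)) = (z \<in> {..exp x})"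
      using df_AE_pos[OF G]
    proof eventually_elim
      case (elim z)
      then show ?case using ln_le_cancel_iff[of z "exp x"] by simp
    qed
  qed (use measurable_sets[of ln borel borel "{..x}"] in auto)
  finally show ?thesis by (simp add: df_emeasure_Iic[OF G])
qed

lemma nn_integral_interval_measure:
  assumes G: "df G" and f [measurable]: "f \<in> borel_measurable borel"
  shows "(\<integral>\<^sup>+z. f z \<partial>interval_measure G) = (\<integral>\<^sup>+w. f (exp w) \<partial>logm G)"
proof -
  have "(\<integral>\<^sup>+z. f z \<partial>interval_measure G) = (\<integral>\<^sup>+z. f (exp (ln z)) \<partial>interval_measure G)"
    by (rule nn_integral_cong_AE) (use df_AE_pos[OF G] in \<open>auto elim!: eventually_mono\<close>)
  also have "\<dots> = (\<integral>\<^sup>+w. f (exp w) \<partial>logm G)"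
    unfolding logm_def by (rule nn_integral_distr[symmetric]) auto
  finally show ?thesis .
qed

text \<open>The inner integral of the equation at the point \<open>exp x\<close>; for the stationary
  law it is the function \<open>H\<close> of \<open>stationary_profile\<close>.\<close>

definition tail_rate :: "(real \<Rightarrow> real) \<Rightarrow> (real \<Rightarrow> real) \<Rightarrow> real \<Rightarrow> ennreal" where
  "tail_rate R G x = (\<integral>\<^sup>+z. ennreal (R z / z) * indicator {exp x<..} z \<partial>interval_measure G)"

lemma solution_log_equation:
  assumes F: "F \<in> solutions R" and t: "0 \<le> t"
  shows "ennreal (F t (exp x)) = ennreal (F 0 (exp (x - t))) +
    (\<integral>\<^sup>+s. indicator {0..t} s * (ennreal (exp (2 * (x - t + s))) * tail_rate R (F s) (x - t + s)) \<partial>lborel)"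
proof -
  have 1: "exp (- t) * exp x = exp (x - t)" "\<And>s. exp (s - t) * exp x = exp (x - t + s)"
    by (simp_all add: exp_add[symmetric])
  have 2: "(exp y)\<^sup>2 = exp (2 * y)" for y :: real by (simp add: exp_double)
  have "ennreal (F t (exp x)) = ennreal (F 0 (exp (- t) * exp x)) +
          (\<integral>\<^sup>+s\<in>{0..t}. ennreal ((exp (s - t) * exp x)\<^sup>2) *
             (\<integral>\<^sup>+z\<in>{exp (s - t) * exp x<..}. ennreal (R z / z) \<partial>interval_measure (F s)) \<partial>lborel)"
    using F t exp_gt_zero[of x] unfolding solutions_def by blast
  then show ?thesis unfolding 1 2 tail_rate_def by (simp add: mult.commute)
qed

locale stationary_law =
  fixes R G :: "real \<Rightarrow> real"
  assumes R: "rate_function R" and stationary: "(\<lambda>t. G) \<in> solutions R"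
begin

text \<open>The rate is measurable only on the restricted space, so it is extended by
  \<open>0\<close> to a Borel function on the whole line.\<close>

definition R' :: "real \<Rightarrow> real" where "R' z = (if 0 \<le> z then R z else 0)"

lemma R'_measurable [measurable]: "R' \<in> borel_measurable borel"
proof -
  have "(\<lambda>z. if 0 \<le> z then R z else 0) \<in> borel_measurable borel"
  proof (subst measurable_If_restrict_space_iff)
    have "{x::real. 0 \<le> x} = {0..}" by auto
    then show "R \<in> borel_measurable (restrict_space borel {x. 0 \<le> x}) \<and>
        (\<lambda>_. 0::real) \<in> borel_measurable (restrict_space borel {x. \<not> 0 \<le> x})"
      using R by (simp add: rate_function_def)
  qed simp
  then show ?thesis by (simp add: R'_def[abs_def])
qed

lemma R'_nonneg: "0 \<le> R' z"
  using R by (auto simp: R'_def rate_function_def)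

lemma tail_rate_log:
  assumes F: "df F"
  shows "tail_rate R F x = (\<integral>\<^sup>+w. ennreal (R' (exp w) / exp w) * indicator {x<..} w \<partial>logm F)"
proof -
  have "tail_rate R F x = (\<integral>\<^sup>+z. ennreal (R' z / z) * indicator {exp x<..} z \<partial>interval_measure F)"
    unfolding tail_rate_def
    by (intro nn_integral_cong) (auto simp: indicator_def R'_def, metis exp_gt_zero less_trans not_less less_imp_le)
  also have "\<dots> = (\<integral>\<^sup>+w. ennreal (R' (exp w) / exp w) * indicator {exp x<..} (exp w) \<partial>logm F)"
    by (rule nn_integral_interval_measure[OF F]) measurable
  finally show ?thesis by (simp add: indicator_def)
qed

abbreviation H :: "real \<Rightarrow> ennreal" where "H \<equiv> tail_rate R G"

definition k :: "real \<Rightarrow> ennreal" where "k w = ennreal (R' (exp w) * exp w) * H w"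

lemma G_df: "df G"
  using solution_df[OF stationary, of 0] by simp

lemma H_anti: assumes "x \<le> y" shows "H y \<le> H x"
proof -
  have "exp x \<le> exp y" using assms by simp
  then show ?thesis
    unfolding tail_rate_def
    by (intro nn_integral_mono mult_left_mono) (auto simp: indicator_def simp del: exp_le_cancel_iff)
qed

lemma H_meas [measurable]: "H \<in> borel_measurable borel"
  unfolding tail_rate_log[OF G_df, abs_def]
proof -
  interpret real_distribution "interval_measure G" by (rule df_real_distribution[OF G_df])
  interpret L: prob_space "logm G" unfolding logm_def by (rule prob_space_distr) auto
  show "(\<lambda>x. \<integral>\<^sup>+w. ennreal (R' (exp w) / exp w) * indicator {x<..} w \<partial>logm G) \<in> borel_measurable borel"
    by measurable
qed

text \<open>For a constant flow the time integral over \<open>[0, y - x]\<close> runs along the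
  characteristic from \<open>x\<close> to \<open>y\<close>, so it becomes a space integral and
  exhibits the density of the stationary law.\<close>

lemma G_increment:
  assumes xy: "x \<le> y"
  shows "ennreal (G (exp y)) = ennreal (G (exp x)) + (\<integral>\<^sup>+z. ennreal (exp (2 * z)) * H z * indicator {x..y} z \<partial>lborel)"
proof -
  have "(\<integral>\<^sup>+s. indicator {0..y - x} s * (ennreal (exp (2 * (y - (y - x) + s))) * H (y - (y - x) + s)) \<partial>lborel)
     = (\<integral>\<^sup>+s. ennreal (exp (2 * (s + x))) * H (s + x) * indicator {x..y} (s + x) \<partial>lborel)"
    by (intro nn_integral_cong) (auto simp: indicator_def add.commute)
  also have "\<dots> = (\<integral>\<^sup>+z. ennreal (exp (2 * z)) * H z * indicator {x..y} z \<partial>lborel)"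
    by (rule nn_integral_shift[of "\<lambda>z. ennreal (exp (2 * z)) * H z * indicator {x..y} z"]) measurable
  finally show ?thesis
    using solution_log_equation[OF stationary, of "y - x" y] xy by simp
qed

text \<open>By monotonicity an infinite value would persist to the left, and
  \<open>G_increment\<close> over an interval of length \<open>1\<close> would make \<open>G\<close>
  infinite.\<close>

lemma H_fin: "H x < top"
proof (rule ccontr)
  assume "\<not> H x < top"
  then have "H x = top" by (simp add: less_top[symmetric])
  then have top: "H z = top" if "z \<le> x" for z using H_anti[OF that] by (simp add: top_unique)
  have "(\<integral>\<^sup>+z. ennreal (exp (2 * z)) * H z * indicator {x - 1..x} z \<partial>lborel) = (\<integral>\<^sup>+z. top * indicator {x - 1..x} z \<partial>lborel)"
    by (intro nn_integral_cong) (auto simp: indicator_def top ennreal_mult_top)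
  also have "\<dots> = top * emeasure lborel {x - 1..x}" by (rule nn_integral_cmult_indicator) simp
  also have "\<dots> = top" by (simp add: ennreal_top_mult)
  finally have "ennreal (G (exp x)) = top" using G_increment[of "x - 1" x] by simp
  then show False by simp
qed

text \<open>The lower end in \<open>G_increment\<close> is sent to minus infinity; its contribution
  tends to \<open>G 0 = 0\<close> by right continuity at \<open>0\<close>.\<close>

lemma logm_eq: "logm G = density lborel (\<lambda>x. ennreal (exp (2 * x)) * H x)"
proof (rule measure_eqI_atMost)
  fix x
  let ?f = "\<lambda>z. ennreal (exp (2 * z)) * H z"
  have lim: "(\<lambda>n. exp (x - real n)) \<longlonglongrightarrow> 0"
    by real_asymp
  have "G \<in> Dsub" using G_df by (simp add: df_def)
  then have "(\<lambda>n. G (exp (x - real n))) \<longlonglongrightarrow> G 0"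
    by (intro right_cont_seq[OF _ _ lim] Dsub_right_cont exp_gt_zero)
  then have "(\<lambda>n. ennreal (G (exp (x - real n)))) \<longlonglongrightarrow> ennreal (G 0)" by (rule tendsto_ennrealI)
  then have "(\<lambda>n. ennreal (G (exp (x - real n))) + (\<integral>\<^sup>+z. ?f z * indicator {x - real n..x} z \<partial>lborel))
      \<longlonglongrightarrow> ennreal (G 0) + (\<integral>\<^sup>+z. ?f z * indicator {..x} z \<partial>lborel)"
    by (intro tendsto_add nn_integral_atMost_tendsto) measurable
  moreover have "ennreal (G (exp (x - real n))) + (\<integral>\<^sup>+z. ?f z * indicator {x - real n..x} z \<partial>lborel) = ennreal (G (exp x))" for n
    using G_increment[of "x - real n" x] by simp
  ultimately have "(\<lambda>n::nat. ennreal (G (exp x))) \<longlonglongrightarrow> (\<integral>\<^sup>+z. ?f z * indicator {..x} z \<partial>lborel)"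
    using G_df by (simp add: df_def)
  then have "ennreal (G (exp x)) = (\<integral>\<^sup>+z. ?f z * indicator {..x} z \<partial>lborel)"
    by (simp add: LIMSEQ_const_iff)
  then show "emeasure (logm G) {..x} = emeasure (density lborel ?f) {..x}"
    by (simp add: logm_Iic[OF G_df] emeasure_density)
  show "emeasure (logm G) {..x} < top" by (simp add: logm_Iic[OF G_df])
qed auto

lemma logm_prob: "df F \<Longrightarrow> prob_space (logm F)"
  unfolding logm_def
  by (intro prob_space.prob_space_distr) (auto simp: real_distribution_def dest!: df_real_distribution)

lemma H_mass: "(\<integral>\<^sup>+x. ennreal (exp (2 * x)) * H x \<partial>lborel) = 1"
  using prob_space.emeasure_space_1[OF logm_prob[OF G_df]]
  unfolding logm_eq by (simp add: emeasure_density)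

text \<open>Inserting the density just found into the definition of \<open>H\<close> closes the
  loop: \<open>H\<close> is the tail integral of a multiple of itself. The factor
  \<open>exp w\<close> in \<open>k\<close> combines the weight \<open>exp (2 * w)\<close> with the
  division by \<open>exp w\<close>.\<close>

lemma H_tail: "H x = (\<integral>\<^sup>+w. k w * indicator {x<..} w \<partial>lborel)"
proof -
  have "H x = (\<integral>\<^sup>+w. ennreal (exp (2 * w)) * H w * (ennreal (R' (exp w) / exp w) * indicator {x<..} w) \<partial>lborel)"
    unfolding tail_rate_log[OF G_df, of x] unfolding logm_eq by (subst nn_integral_density) auto
  also have "\<dots> = (\<integral>\<^sup>+w. k w * indicator {x<..} w \<partial>lborel)"
  proof (rule nn_integral_cong)
    fix w
    have "ennreal (exp (2 * w)) * ennreal (R' (exp w) / exp w) = ennreal (R' (exp w) * exp w)"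
      using R'_nonneg[of "exp w"] by (subst ennreal_mult[symmetric]) (auto simp: exp_double power2_eq_square)
    then have "ennreal (R' (exp w) * exp w) * H w * indicator {x<..} w
        = (ennreal (exp (2 * w)) * ennreal (R' (exp w) / exp w)) * H w * indicator {x<..} w" by simp
    then show "ennreal (exp (2 * w)) * H w * (ennreal (R' (exp w) / exp w) * indicator {x<..} w) = k w * indicator {x<..} w"
      unfolding k_def by (simp only: mult_ac)
  qed
  finally show ?thesis .
qed

lemma k_meas [measurable]: "k \<in> borel_measurable borel"
  unfolding k_def by measurable

lemma rate_integral_finite: "(\<integral>\<^sup>+w. ennreal (R' (exp w) * exp w) * indicator {a..b} w \<partial>lborel) < top"
proof (cases "a \<le> b")
  case True
  have "(\<integral>\<^sup>+w. ennreal (R' (exp w) * exp w) * indicator {a..b} w \<partial>lborel)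
      = (\<integral>\<^sup>+w. ennreal (R' (exp w) * exp w * indicator {a..b} w) \<partial>lborel)"
    by (intro nn_integral_cong) (auto simp: indicator_def)
  also have "\<dots> = (\<integral>\<^sup>+z. ennreal (R' z * indicator {exp a..exp b} z) \<partial>lborel)"
    by (rule nn_integral_substitution[symmetric, of exp a b R' exp])
       (auto simp: True set_borel_measurable_def intro!: continuous_intros derivative_eq_intros)
  also have "\<dots> \<le> (\<integral>\<^sup>+z\<in>{0..exp b}. ennreal (R z) \<partial>lborel)"
    using exp_gt_zero[of a] by (intro nn_integral_mono) (auto simp: indicator_def R'_def)
  also have "\<dots> < top" using R unfolding rate_function_def by (auto simp: less_top[symmetric])
  finally show ?thesis .
qed simp

text \<open>
  On an interval ending at the leftmost zero \<open>s\<close> of \<open>H\<close> the rate integrates to less than \<open>1\<close> once the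
  interval is short, which forces \<open>H\<close> to vanish there too.
\<close>

lemma H_vanish_left:
  assumes H0: "H x = 0"
  shows "H y = 0"
proof (rule ccontr)
  assume Hy: "H y \<noteq> 0"
  have anti: "H b = 0" if "H a = 0" "a \<le> b" for a b using H_anti[OF that(2)] that(1) by simp
  have yx: "y < x" using anti[OF H0, of y] Hy by fastforce
  define X where "X = {a. y \<le> a \<and> H a = 0}"
  define s where "s = Inf X"
  have X: "x \<in> X" "bdd_below X" unfolding X_def using H0 yx by (auto intro!: bdd_belowI[of _ y])
  have ys: "y \<le> s" unfolding s_def using X by (intro cInf_greatest) (auto simp: X_def)
  have above: "H z = 0" if "s < z" for z
  proof -
    have "X \<noteq> {}" using X(1) by auto
    from cInf_lessD[OF this that[unfolded s_def]] obtain a where "a \<in> X" "a < z" by auto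
    then show ?thesis using anti[of a z] by (auto simp: X_def)
  qed
  \<comment> \<open>The infimum is attained: \<open>H s\<close> integrates only over points strictly
    above \<open>s\<close>, where \<open>H\<close> already vanishes.\<close>
  have "H s = (\<integral>\<^sup>+(w::real). 0 \<partial>lborel)"
    unfolding H_tail[of s] by (intro nn_integral_cong) (auto simp: k_def indicator_def above)
  then have Hs: "H s = 0" by simp
  then have ys': "y < s" using ys Hy by (cases "y = s") auto
  define \<mu> where "\<mu> = density lborel (\<lambda>w. ennreal (R' (exp w) * exp w) * indicator {y..s} w)"
  have \<mu>_fin: "emeasure \<mu> A \<noteq> \<infinity>" if [measurable]: "A \<in> sets borel" for A
  proof -
    have "emeasure \<mu> A \<le> (\<integral>\<^sup>+w. ennreal (R' (exp w) * exp w) * indicator {y..s} w \<partial>lborel)"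
      unfolding \<mu>_def by (subst emeasure_density) (auto simp: indicator_def intro!: nn_integral_mono)
    then show ?thesis using rate_integral_finite[of y s] by (auto simp: top_unique)
  qed
  have "(\<lambda>n. emeasure \<mu> {s - 1 / real (Suc n)<..<s}) \<longlonglongrightarrow> emeasure \<mu> (\<Inter>n. {s - 1 / real (Suc n)<..<s})"
  proof (rule Lim_emeasure_decseq)
    show "decseq (\<lambda>n. {s - 1 / real (Suc n)<..<s})"
    proof -
      have "1 / real (Suc m) \<le> 1 / real (Suc n)" if "n \<le> m" for m n
        using that by (intro divide_left_mono) auto
      then show ?thesis unfolding decseq_def by (fastforce simp del: of_nat_Suc)
    qed
  qed (use \<mu>_fin in \<open>auto simp: \<mu>_def\<close>)
  also have "(\<Inter>n. {s - 1 / real (Suc n)<..<s}) = {}"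
  proof -
    have "w \<notin> (\<Inter>n. {s - 1 / real (Suc n)<..<s})" for w
    proof (cases "w < s")
      case True
      then obtain n where "1 / real (Suc n) < s - w" using nat_approx_posE[of "s - w"] by auto
      then have "w \<notin> {s - 1 / real (Suc n)<..<s}" by auto
      then show ?thesis by blast
    qed auto
    then show ?thesis by blast
  qed
  finally have "eventually (\<lambda>n. emeasure \<mu> {s - 1 / real (Suc n)<..<s} < 1) sequentially"
    by (intro order_tendstoD) auto
  then obtain n where n: "emeasure \<mu> {s - 1 / real (Suc n)<..<s} < 1"
    by (auto simp: eventually_sequentially)
  \<comment> \<open>Taking the maximum with \<open>y\<close> ensures that \<open>a\<close> belongs
    to \<open>X\<close> as soon as \<open>H a = 0\<close>, which contradicts
    \<open>a < s\<close>.\<close>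
  define a where "a = max y (s - 1 / real (Suc n))"
  have a: "y \<le> a" "a < s" "s - 1 / real (Suc n) \<le> a" using ys' by (auto simp: a_def)
  have "H a = (\<integral>\<^sup>+w. k w * indicator {a<..} w \<partial>lborel)" by (rule H_tail)
  also have "\<dots> \<le> (\<integral>\<^sup>+w. H a * (ennreal (R' (exp w) * exp w) * indicator {y..s} w * indicator {s - 1 / real (Suc n)<..<s} w) \<partial>lborel)"
  proof (rule nn_integral_mono)
    fix w
    show "k w * indicator {a<..} w \<le> H a * (ennreal (R' (exp w) * exp w) * indicator {y..s} w * indicator {s - 1 / real (Suc n)<..<s} w)"
    proof (cases "a < w \<and> w < s")
      case True
      then have "w \<in> {y..s}" "w \<in> {s - 1 / real (Suc n)<..<s}" using a by auto
      moreover have "ennreal (R' (exp w) * exp w) * H w \<le> ennreal (R' (exp w) * exp w) * H a"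
        using True by (intro mult_left_mono H_anti) auto
      ultimately show ?thesis using True unfolding k_def
        by (simp add: mult.commute[of "H a"] del: greaterThanLessThan_iff of_nat_Suc)
    next
      case False
      then have "k w * indicator {a<..} w = 0" using above[of w] Hs by (cases "w = s") (auto simp: k_def indicator_def)
      then show ?thesis by (simp only: zero_le)
    qed
  qed
  also have "\<dots> = H a * emeasure \<mu> {s - 1 / real (Suc n)<..<s}"
    unfolding \<mu>_def by (subst emeasure_density, simp, simp, rule nn_integral_cmult) measurable
  finally have le: "H a \<le> H a * emeasure \<mu> {s - 1 / real (Suc n)<..<s}" .
  have "H a = 0"
  proof (rule ccontr)
    assume "H a \<noteq> 0"
    then have "H a * emeasure \<mu> {s - 1 / real (Suc n)<..<s} < H a * 1"
      using n H_fin[of a] by (intro ennreal_mult_strict_left_mono) (auto simp: zero_less_iff_neq_zero)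
    with le show False by simp
  qed
  then have "a \<in> X" using a by (simp add: X_def)
  then have "s \<le> a" unfolding s_def using X by (intro cInf_lower)
  with a show False by simp
qed

lemma H_positive: "0 < H x"
proof (rule ccontr)
  assume "\<not> 0 < H x"
  then have "H y = 0" for y using H_vanish_left[of x y] by simp
  then show False using H_mass by simp
qed

sublocale stationary_profile k H
  by standard (auto simp: H_tail[symmetric] H_positive H_fin H_mass)

lemma stat_eq_logm: "stat = logm G"
  by (simp add: stat_def logm_eq)

end

section \<open>Convergence to equilibrium\<close>

lemma logm_Ioc:
  assumes F: "df F" and xy: "x \<le> y"
  shows "emeasure (logm F) {x<..y} = ennreal (F (exp y) - F (exp x))"
proof -
  have "{x<..y} = {..y} - {..x}" by auto
  then have "emeasure (logm F) {x<..y} = emeasure (logm F) {..y} - emeasure (logm F) {..x}"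
    using xy by (simp add: emeasure_Diff logm_Iic[OF F])
  also have "\<dots> = ennreal (F (exp y) - F (exp x))"
    unfolding logm_Iic[OF F] using F by (intro ennreal_minus) (auto simp: df_def Dsub_range)
  finally show ?thesis .
qed

context stationary_law
begin

text \<open>Capping the Radon-Nikodym derivative at \<open>K\<close> changes it only on a null set
  and makes the bound hold at every point.\<close>

lemma logm_density:
  assumes F: "df F" and ac: "absolutely_continuous (interval_measure G) (interval_measure F)"
    and K: "AE z in interval_measure G. RN_deriv (interval_measure G) (interval_measure F) z \<le> K"
  shows "\<exists>r. r \<in> borel_measurable borel \<and> (\<forall>x. r x \<le> K) \<and> logm F = density stat r"
proof -
  interpret G: real_distribution "interval_measure G" by (rule df_real_distribution[OF G_df])
  define \<rho> where "\<rho> = RN_deriv (interval_measure G) (interval_measure F)"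
  have [measurable]: "\<rho> \<in> borel_measurable borel"
    using borel_measurable_RN_deriv[of "interval_measure G" "interval_measure F"] by (simp add: \<rho>_def)
  define r where "r w = min K (\<rho> (exp w))" for w
  have [measurable]: "r \<in> borel_measurable borel" unfolding r_def by measurable
  have dens: "density (interval_measure G) \<rho> = interval_measure F"
    unfolding \<rho>_def using ac by (intro G.density_RN_deriv) auto
  have "logm F = density stat r"
  proof (rule measure_eqI)
    fix A assume "A \<in> sets (logm F)"
    then have [measurable]: "A \<in> sets borel" by simp
    have "emeasure (logm F) A = (\<integral>\<^sup>+w. indicator A (ln (exp w)) \<partial>logm F)" by simp
    also have "\<dots> = (\<integral>\<^sup>+z. indicator A (ln z) \<partial>interval_measure F)"
      by (rule nn_integral_interval_measure[OF F, symmetric]) measurable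
    also have "\<dots> = (\<integral>\<^sup>+z. \<rho> z * indicator A (ln z) \<partial>interval_measure G)"
      unfolding dens[symmetric] by (rule nn_integral_density) auto
    also have "\<dots> = (\<integral>\<^sup>+z. min K (\<rho> z) * indicator A (ln z) \<partial>interval_measure G)"
      by (rule nn_integral_cong_AE) (use K in \<open>auto simp: \<rho>_def min_absorb2 elim!: eventually_mono\<close>)
    also have "\<dots> = (\<integral>\<^sup>+w. min K (\<rho> (exp w)) * indicator A (ln (exp w)) \<partial>logm G)"
      by (rule nn_integral_interval_measure[OF G_df]) measurable
    also have "\<dots> = emeasure (density stat r) A"
      by (simp add: emeasure_density r_def stat_eq_logm)
    finally show "emeasure (logm F) A = emeasure (density stat r) A" .
  qed simp
  then show ?thesis by (intro exI[of _ r]) (auto simp: r_def)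
qed

text \<open>The densities supplied by \<open>dens\<close> are unrelated for different times. The
  upper limit of difference quotients of the jointly measurable \<open>\<Phi>\<close> is measurable
  whether or not it is a limit, and it agrees almost everywhere with each of them after division by
  the stationary density. The cap at \<open>K\<close> keeps the bound on the exceptional
  sets.\<close>

lemma flow_density:
  assumes F: "F \<in> flows" "\<And>t. 0 \<le> t \<Longrightarrow> df (F t)" and K: "K < \<infinity>"
    and dens: "\<And>t. 0 \<le> t \<Longrightarrow> \<exists>r. r \<in> borel_measurable borel \<and> (\<forall>x. r x \<le> K) \<and> logm (F t) = density stat r"
  shows "\<exists>u. meas2 u \<and> (\<forall>t x. u t x \<le> K) \<and> (\<forall>t\<ge>0. logm (F t) = density stat (u t))"
proof -
  define \<Phi> where "\<Phi> t x = F (max 0 t) (exp x)" for t x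
  have \<Phi>: "(\<lambda>p. \<Phi> (fst p) (snd p)) \<in> borel_measurable (borel \<Otimes>\<^sub>M borel)"
    unfolding \<Phi>_def by (rule flow_jointly_measurable[OF F(1)])
  have [measurable (raw)]: "(\<lambda>p. \<Phi> (f p) (g p)) \<in> borel_measurable M"
    if "f \<in> borel_measurable M" "g \<in> borel_measurable M" for f g :: "'a \<Rightarrow> real" and M
    using measurable_compose[OF measurable_Pair[OF that] \<Phi>] by simp
  define d where "d t x = limsup (\<lambda>n. ennreal (\<Phi> t (x + 1 / real (Suc n)) - \<Phi> t x) * ennreal (real (Suc n)))" for t x
  define u where "u t x = min K (d t x / (ennreal (exp (2 * x)) * H x))" for t x
  have "meas2 u" unfolding u_def d_def
    by (intro borel_measurable_min borel_measurable_divide_ennreal borel_measurable_limsup) measurable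
  moreover have "logm (F t) = density stat (u t)" if t: "0 \<le> t" for t
  proof -
    obtain r where r [measurable]: "r \<in> borel_measurable borel" and rK: "\<And>x. r x \<le> K"
      and eq: "logm (F t) = density stat r" using dens[OF t] by auto
    let ?h = "\<lambda>x. ennreal (exp (2 * x)) * H x"
    have eq': "logm (F t) = density lborel (\<lambda>x. ?h x * r x)"
      unfolding eq stat_def by (rule density_density_eq) auto
    have fin: "(\<integral>\<^sup>+x. ?h x * r x \<partial>lborel) < top"
    proof -
      interpret L: prob_space "logm (F t)" by (rule logm_prob[OF F(2)[OF t]])
      have "(\<integral>\<^sup>+x. ?h x * r x \<partial>lborel) = emeasure (logm (F t)) (space (logm (F t)))"
        unfolding eq' by (simp add: emeasure_density)
      then show ?thesis by (simp add: L.emeasure_space_1)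
    qed
    have "AE x in lborel. (\<lambda>n. emeasure (logm (F t)) {x<..x + 1 / real (Suc n)} * ennreal (real (Suc n))) \<longlonglongrightarrow> ?h x * r x"
      unfolding eq' using fin by (intro lebesgue_differentiation_density) auto
    then have "AE x in lborel. u t x = r x"
    proof eventually_elim
      case (elim x)
      have "(\<lambda>n. ennreal (\<Phi> t (x + 1 / real (Suc n)) - \<Phi> t x) * ennreal (real (Suc n))) \<longlonglongrightarrow> ?h x * r x"
        using elim t by (simp add: logm_Ioc[OF F(2)[OF t]] \<Phi>_def del: of_nat_Suc)
      then have "d t x = ?h x * r x" unfolding d_def by (intro lim_imp_Limsup) auto
      moreover have "?h x \<noteq> 0" "?h x \<noteq> top" by (auto simp: ennreal_mult_eq_top_iff)
      then have "?h x * r x / ?h x = r x"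
        by (simp add: ennreal_mult_divide_eq mult.commute[of "?h x"])
      ultimately show ?case using rK[of x] by (simp add: u_def min_absorb2)
    qed
    then have "AE x in stat. r x = u t x"
      unfolding stat_def by (subst AE_density) (auto elim!: eventually_mono)
    then show ?thesis
      unfolding eq using measurable_slice[OF \<open>meas2 u\<close>, of t] by (intro density_cong) auto
  qed
  ultimately show ?thesis by (intro exI[of _ u]) (auto simp: u_def)
qed

lemma tail_rate_density:
  assumes F: "df F" and f [measurable]: "f \<in> borel_measurable borel" and dens: "logm F = density stat f"
  shows "tail_rate R F x = H x * Q f x"
proof -
  have "tail_rate R F x = (\<integral>\<^sup>+w. f w * (ennreal (R' (exp w) / exp w) * indicator {x<..} w) \<partial>stat)"
    unfolding tail_rate_log[OF F] dens by (rule nn_integral_density) auto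
  also have "\<dots> = (\<integral>\<^sup>+w. ennreal (exp (2 * w)) * H w * (f w * (ennreal (R' (exp w) / exp w) * indicator {x<..} w)) \<partial>lborel)"
    by (rule nn_integral_stat) measurable
  also have "\<dots> = (\<integral>\<^sup>+w. f w * k w * indicator {x<..} w \<partial>lborel)"
  proof (rule nn_integral_cong)
    fix w
    have "ennreal (exp (2 * w)) * ennreal (R' (exp w) / exp w) = ennreal (R' (exp w) * exp w)"
      using R'_nonneg[of "exp w"] by (subst ennreal_mult[symmetric]) (auto simp: exp_double power2_eq_square)
    then have "f w * k w * indicator {x<..} w = f w * ((ennreal (exp (2 * w)) * ennreal (R' (exp w) / exp w)) * H w) * indicator {x<..} w"
      by (simp add: k_def)
    then show "ennreal (exp (2 * w)) * H w * (f w * (ennreal (R' (exp w) / exp w) * indicator {x<..} w)) = f w * k w * indicator {x<..} w"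
      by (simp only: mult_ac)
  qed
  finally show ?thesis by (simp add: H_Q)
qed

text \<open>The equation is first obtained almost everywhere for each time, then made pointwise by
  changing the density on null sets.\<close>

lemma solution_mild:
  assumes F: "F \<in> solutions_ac R (interval_measure G)"
  shows "\<exists>K u. mild K u \<and> (\<forall>t\<ge>0. logm (F t) = density stat (u t))"
proof -
  have sol: "F \<in> solutions R" and ac: "\<And>t. 0 \<le> t \<Longrightarrow> absolutely_continuous (interval_measure G) (interval_measure (F t))"
    using F by (auto simp: solutions_ac_def)
  have F_df: "df (F t)" if "0 \<le> t" for t using solution_df[OF sol that] .
  define K where "K = (SUP t\<in>{0..}. esssup (interval_measure G) (RN_deriv (interval_measure G) (interval_measure (F t))))"
  have K: "K < \<infinity>" using F by (simp add: K_def solutions_ac_def)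
  have "AE z in interval_measure G. RN_deriv (interval_measure G) (interval_measure (F t)) z \<le> K" if "0 \<le> t" for t
  proof -
    have "esssup (interval_measure G) (RN_deriv (interval_measure G) (interval_measure (F t))) \<le> K"
      unfolding K_def using that by (intro SUP_upper) auto
    with esssup_AE[of "RN_deriv (interval_measure G) (interval_measure (F t))" "interval_measure G"]
    show ?thesis by (auto elim!: eventually_mono)
  qed
  then have dens: "\<exists>r. r \<in> borel_measurable borel \<and> (\<forall>x. r x \<le> K) \<and> logm (F t) = density stat r" if "0 \<le> t" for t
    using that by (intro logm_density F_df ac) auto
  have "F \<in> flows" using sol by (simp add: solutions_def)
  from flow_density[OF this F_df K dens] obtain u where m: "meas2 u" and uK: "\<And>t x. u t x \<le> K"
    and u: "\<And>t. 0 \<le> t \<Longrightarrow> logm (F t) = density stat (u t)" by auto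
  note slice [measurable] = measurable_slice[OF m]
  have cdf: "(\<integral>\<^sup>+y. u t y * indicator {..x} y \<partial>stat) = ennreal (F t (exp x))" if "0 \<le> t" for t x
    using logm_Iic[OF F_df[OF that], of x] unfolding u[OF that] by (simp add: emeasure_density)
  have ae: "AE x in lborel. u t x = S t (u 0) x + J u t x" if t: "0 \<le> t" for t
  proof (rule mild_from_integrated[OF m K uK _ t])
    fix t x :: real assume t: "0 \<le> t"
    have "(\<integral>\<^sup>+s. indicator {0..t} s * (ennreal (exp (2 * (x - t + s))) * tail_rate R (F s) (x - t + s)) \<partial>lborel)
       = (\<integral>\<^sup>+s. indicator {0..t} s * (ennreal (exp (2 * (x - t + s))) * (H (x - t + s) * Q (u s) (x - t + s))) \<partial>lborel)"
      by (intro nn_integral_cong) (auto simp: indicator_def tail_rate_density[OF F_df slice u])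
    then show "(\<integral>\<^sup>+y. u t y * indicator {..x} y \<partial>stat) = (\<integral>\<^sup>+y. u 0 y * indicator {..x - t} y \<partial>stat) +
       (\<integral>\<^sup>+s. indicator {0..t} s * (ennreal (exp (2 * (x - t + s))) * (H (x - t + s) * Q (u s) (x - t + s))) \<partial>lborel)"
      using solution_log_equation[OF sol t, of x] t by (simp add: cdf)
  qed
  \<comment> \<open>\<open>Q\<close> sees a density only up to null sets, so
    \<open>J u = J v\<close>, and a \<open>v\<close> defined by the right-hand side solves the
    equation everywhere. At time \<open>0\<close> the integral in \<open>J\<close> runs over a
    single point and vanishes.\<close>
  define v where "v t x = (if t \<le> 0 then u 0 x else S t (u 0) x + J u t x)" for t x
  note [measurable (raw)] = borel_measurable_curried[OF meas2_J[OF m]] borel_measurable_curried[OF meas2_S[OF slice]]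
  have mv: "meas2 v" unfolding v_def by measurable
  have uv: "AE x in lborel. u t x = v t x" if "0 \<le> t" for t
    using ae[OF that] that by (cases "t = 0") (auto simp: v_def)
  have Q_eq: "Q (u t) x = Q (v t) x" if "0 \<le> t" for t x
  proof -
    have "(\<integral>\<^sup>+z. u t z * k z * indicator {x<..} z \<partial>lborel) = (\<integral>\<^sup>+z. v t z * k z * indicator {x<..} z \<partial>lborel)"
      by (rule nn_integral_cong_AE) (use uv[OF that] in \<open>auto elim!: eventually_mono\<close>)
    then show ?thesis by (simp add: Q_def)
  qed
  have J_eq: "J u t x = J v t x" for t x
    unfolding J_def S_def by (intro nn_integral_cong) (auto simp: indicator_def Q_eq)
  have v0: "v 0 = u 0" by (simp add: v_def fun_eq_iff)
  have J0: "J v 0 x = 0" for x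
  proof -
    have "J v 0 x = (\<integral>\<^sup>+(s::real). 0 \<partial>lborel)"
      unfolding J_def
    proof (rule nn_integral_cong_AE)
      show "AE s in lborel. indicator {0..0} s * (2 * S (0 - s) (Q (v s)) x) = 0"
        using AE_lborel_singleton[of 0] by eventually_elim (auto simp: indicator_def)
    qed
    then show ?thesis by simp
  qed
  have v_eq: "v t x = S t (v 0) x + J v t x" if "0 \<le> t" for t x
  proof (cases "t = 0")
    case True
    then show ?thesis unfolding v0 by (simp add: J0) (simp add: v_def S_def)
  next
    case False
    then show ?thesis using that unfolding v0 J_eq[symmetric] by (simp add: v_def)
  qed
  have "v t x \<le> K" if "0 \<le> t" for t x
  proof (cases "t = 0")
    case False
    have "S t (u 0) x + J u t x \<le> S t (\<lambda>_. K) x + J (\<lambda>_ _. K) t x"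
      by (intro add_mono S_mono J_mono uK)
    then show ?thesis using False that const_mild[OF that, of K x] by (simp add: v_def)
  qed (simp add: v_def uK)
  then have "mild K v" unfolding mild_def using mv K v_eq by blast
  moreover have "logm (F t) = density stat (v t)" if "0 \<le> t" for t
  proof -
    have "AE x in stat. u t x = v t x"
      unfolding stat_def by (subst AE_density) (use uv[OF that] in \<open>auto elim!: eventually_mono\<close>)
    then show ?thesis
      unfolding u[OF that] using measurable_slice[OF mv, of t] by (intro density_cong) auto
  qed
  ultimately show ?thesis by blast
qed

text \<open>From \<open>f \<le> 1 + (f - 1)\<close> the law of \<open>F\<close> exceeds the
  stationary one on any set by at most the integral of \<open>f - 1\<close>; complements give the
  reverse inequality since both have mass \<open>1\<close>.\<close>

lemma tv_dist_le_excess: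
  assumes F: "df F" and f [measurable]: "f \<in> borel_measurable borel" and dens: "logm F = density stat f"
    and e: "(\<integral>\<^sup>+x. f x - 1 \<partial>stat) \<le> ennreal e" "0 \<le> e"
  shows "tv_dist (interval_measure F) (interval_measure G) \<le> e"
    and "0 \<le> tv_dist (interval_measure F) (interval_measure G)"
proof -
  interpret F: real_distribution "interval_measure F" by (rule df_real_distribution[OF F])
  interpret G: real_distribution "interval_measure G" by (rule df_real_distribution[OF G_df])
  have up: "measure (interval_measure F) A \<le> measure (interval_measure G) A + e" if [measurable]: "A \<in> sets borel" for A
  proof -
    have "emeasure (interval_measure F) A = (\<integral>\<^sup>+z. indicator A z \<partial>interval_measure F)" by simp
    also have "\<dots> = (\<integral>\<^sup>+w. indicator A (exp w) \<partial>logm F)"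
      by (rule nn_integral_interval_measure[OF F]) measurable
    also have "\<dots> = (\<integral>\<^sup>+w. f w * indicator A (exp w) \<partial>stat)"
      unfolding dens by (rule nn_integral_density) auto
    also have "\<dots> \<le> (\<integral>\<^sup>+w. indicator A (exp w) + (f w - 1) \<partial>stat)"
      by (intro nn_integral_mono) (auto simp: indicator_def ennreal_le_add_diff)
    also have "\<dots> = (\<integral>\<^sup>+w. indicator A (exp w) \<partial>stat) + (\<integral>\<^sup>+w. f w - 1 \<partial>stat)"
      by (rule nn_integral_add) measurable
    also have "(\<integral>\<^sup>+w. indicator A (exp w) \<partial>stat) = (\<integral>\<^sup>+z. indicator A z \<partial>interval_measure G)"
      unfolding stat_eq_logm by (rule nn_integral_interval_measure[OF G_df, symmetric]) measurable
    finally have "emeasure (interval_measure F) A \<le> emeasure (interval_measure G) A + ennreal e"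
      using e by (auto intro: order_trans add_left_mono)
    then show ?thesis
      using e(2) by (simp add: F.emeasure_eq_measure G.emeasure_eq_measure ennreal_plus[symmetric] del: ennreal_plus)
  qed
  have abs: "\<bar>measure (interval_measure F) A - measure (interval_measure G) A\<bar> \<le> e" if A: "A \<in> sets borel" for A
    using up[OF A] up[of "- A"] A F.prob_compl[of A] G.prob_compl[of A] by (simp add: Compl_eq_Diff_UNIV)
  show "tv_dist (interval_measure F) (interval_measure G) \<le> e"
    unfolding tv_dist_def by (rule cSUP_least) (use abs in auto)
  have bdd: "bdd_above ((\<lambda>A. \<bar>measure (interval_measure F) A - measure (interval_measure G) A\<bar>) ` sets (interval_measure F))"
    by (rule bdd_aboveI2[where M=e]) (rule abs, simp)
  have "\<bar>measure (interval_measure F) {} - measure (interval_measure G) {}\<bar> \<le> tv_dist (interval_measure F) (interval_measure G)"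
    unfolding tv_dist_def by (rule cSUP_upper[OF _ bdd]) simp
  then show "0 \<le> tv_dist (interval_measure F) (interval_measure G)" by simp
qed

text \<open>The logarithm maps a compact subset of the open half-line into a bounded interval, so
  mass near \<open>0\<close> and near infinity is controlled together.\<close>

lemma tight_log:
  assumes tight: "tight_on_positive \<M>" and e: "0 < e"
  shows "\<exists>a b. \<forall>F. df F \<and> interval_measure F \<in> \<M> \<longrightarrow> emeasure (logm F) (- {a..b}) \<le> ennreal e"
proof -
  from tight[unfolded tight_on_positive_def, rule_format, OF e]
  obtain C where C: "compact C" "C \<subseteq> {0<..}" and small: "\<And>\<mu>. \<mu> \<in> \<M> \<Longrightarrow> measure \<mu> ({0<..} - C) < e"
    by (elim exE conjE) simp
  have "compact (ln ` C)"
    using C by (intro compact_continuous_image continuous_on_ln continuous_on_id) auto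
  then obtain a b where ab: "ln ` C \<subseteq> {a..b}"
    using bounded_subset_cbox_symmetric[OF compact_imp_bounded] by (metis cbox_interval)
  have "emeasure (logm F) (- {a..b}) \<le> ennreal e" if F: "df F" and FM: "interval_measure F \<in> \<M>" for F
  proof -
    interpret F: real_distribution "interval_measure F" by (rule df_real_distribution[OF F])
    have [measurable]: "C \<in> sets borel" using C(1) by (simp add: compact_imp_closed borel_closed)
    have "emeasure (logm F) (- {a..b}) = emeasure (interval_measure F) (ln -` (- {a..b}) \<inter> space (interval_measure F))"
      unfolding logm_def by (intro emeasure_distr) auto
    also have "\<dots> \<le> emeasure (interval_measure F) ({0<..} - C)"
    proof (rule emeasure_mono_AE)
      show "AE z in interval_measure F. z \<in> ln -` (- {a..b}) \<inter> space (interval_measure F) \<longrightarrow> z \<in> {0<..} - C"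
        using df_AE_pos[OF F] by eventually_elim (use ab in auto)
    qed simp
    also have "\<dots> \<le> ennreal e"
      using small[OF FM] by (simp add: F.emeasure_eq_measure ennreal_leI)
    finally show ?thesis .
  qed
  then show ?thesis by blast
qed

lemma uniform_convergence:
  assumes tight: "tight_on_positive \<M>" and e: "0 < e"
  shows "\<exists>T\<ge>0. \<forall>F\<in>solutions_ac R (interval_measure G). interval_measure (F 0) \<in> \<M> \<longrightarrow>
    (\<forall>t\<ge>T. tv_dist (interval_measure (F t)) (interval_measure G) \<in> {0..e})"
proof -
  \<comment> \<open>All mild densities of the admissible flows are collected, so that the uniform
    decay applies whichever version \<open>solution_mild\<close> later supplies.\<close>
  define U where "U = {u. \<exists>F\<in>solutions_ac R (interval_measure G). interval_measure (F 0) \<in> \<M> \<and>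
    (\<exists>K. mild K u) \<and> (\<forall>t\<ge>0. logm (F t) = density stat (u t))}"
  have df: "df (F t)" if "F \<in> solutions_ac R (interval_measure G)" "0 \<le> t" for F t
    using that by (intro solution_df[of F R]) (auto simp: solutions_ac_def)
  have "\<exists>T\<ge>0. \<forall>u\<in>U. \<forall>t\<ge>T. (\<integral>\<^sup>+x. u t x - 1 \<partial>stat) < ennreal e"
  proof (rule excess_uniformly_tendsto_0)
    fix d :: real assume "0 < d"
    then obtain a b where ab: "\<And>F. df F \<Longrightarrow> interval_measure F \<in> \<M> \<Longrightarrow> emeasure (logm F) (- {a..b}) \<le> ennreal d"
      using tight_log[OF tight] by blast
    show "\<exists>a b. \<forall>u\<in>U. (\<integral>\<^sup>+x. u 0 x * indicator (- {a..b}) x \<partial>stat) \<le> ennreal d"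
    proof (intro exI ballI)
      fix u assume "u \<in> U"
      then obtain F K where F: "F \<in> solutions_ac R (interval_measure G)" "interval_measure (F 0) \<in> \<M>"
        and K: "mild K u" and dens: "logm (F 0) = density stat (u 0)" unfolding U_def by auto
      show "(\<integral>\<^sup>+x. u 0 x * indicator (- {a..b}) x \<partial>stat) \<le> ennreal d"
        using ab[OF df[OF F(1)] F(2)] measurable_slice[OF mildD(1)[OF K], of 0]
        unfolding dens by (simp add: emeasure_density)
    qed
  next
    show "\<exists>K. mild K u" if "u \<in> U" for u using that unfolding U_def by auto
    fix u and t :: real assume "u \<in> U" and t: "0 \<le> t"
    then obtain F K where F: "F \<in> solutions_ac R (interval_measure G)"
      and K: "mild K u" and dens: "logm (F t) = density stat (u t)" unfolding U_def by auto
    show "(\<integral>\<^sup>+x. u t x \<partial>stat) = 1"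
      using prob_space.emeasure_space_1[OF logm_prob[OF df[OF F t]]] measurable_slice[OF mildD(1)[OF K], of t]
      unfolding dens by (simp add: emeasure_density stat_def[THEN arg_cong[where f=space]])
  qed (rule e)
  then obtain T where T: "0 \<le> T" "\<And>u t. u \<in> U \<Longrightarrow> T \<le> t \<Longrightarrow> (\<integral>\<^sup>+x. u t x - 1 \<partial>stat) < ennreal e" by blast
  have "tv_dist (interval_measure (F t)) (interval_measure G) \<in> {0..e}"
    if F: "F \<in> solutions_ac R (interval_measure G)" and FM: "interval_measure (F 0) \<in> \<M>" and t: "T \<le> t" for F t
  proof -
    obtain K u where K: "mild K u" and dens: "\<And>t. 0 \<le> t \<Longrightarrow> logm (F t) = density stat (u t)"
      using solution_mild[OF F] by auto
    then have "u \<in> U" using F FM unfolding U_def by auto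
    then have "(\<integral>\<^sup>+x. u t x - 1 \<partial>stat) \<le> ennreal e" using T(2) t by (auto intro: less_imp_le)
    then show ?thesis
      using tv_dist_le_excess[OF df[OF F] measurable_slice[OF mildD(1)[OF K]] dens] T(1) t e by auto
  qed
  then show ?thesis using T(1) by blast
qed

end

section \<open>Initial laws and the final statement\<close>

lemma solution_ac_initial:
  assumes "F \<in> solutions_ac R \<pi>"
  shows "positive_distribution (interval_measure (F 0))"
proof -
  have F: "df (F 0)" using assms by (intro solution_df[of F R]) (auto simp: solutions_ac_def)
  interpret F: real_distribution "interval_measure (F 0)" by (rule df_real_distribution[OF F])
  have "AE z in interval_measure (F 0). z \<in> {0<..}" using df_AE_pos[OF F] by simp
  then have "measure (interval_measure (F 0)) {0<..} = 1" by (intro F.prob_eq_1[THEN iffD2]) auto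
  then show ?thesis by (simp add: positive_distribution_def F.real_distribution_axioms)
qed

text \<open>Reduces convergence of a single flow to the uniform statement, applied to the family
  whose only member is its initial law.\<close>

lemma tight_singleton:
  assumes \<mu>: "positive_distribution \<mu>"
  shows "tight_on_positive {\<mu>}"
  unfolding tight_on_positive_def
proof (intro allI impI)
  fix e :: real assume e: "0 < e"
  interpret real_distribution \<mu> using \<mu> by (simp add: positive_distribution_def)
  let ?A = "\<lambda>n. {0<..} - {1 / real (Suc n)..real n}"
  have "(\<lambda>n. measure \<mu> (?A n)) \<longlonglongrightarrow> measure \<mu> (\<Inter>n. ?A n)"
  proof (rule finite_Lim_measure_decseq)
    show "decseq ?A"
    proof -
      have "1 / real (Suc m) \<le> 1 / real (Suc n)" if "n \<le> m" for m n
        using that by (intro divide_left_mono) auto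
      then show ?thesis unfolding decseq_def by (fastforce simp del: of_nat_Suc)
    qed
  qed auto
  also have "(\<Inter>n. ?A n) = {}"
  proof -
    have "x \<notin> (\<Inter>n. ?A n)" for x
    proof (cases "0 < x")
      case True
      obtain n m where n: "1 / real (Suc n) < x" and m: "x \<le> real m"
        using nat_approx_posE[OF True] real_arch_simple by metis
      have "1 / real (Suc (max n m)) \<le> 1 / real (Suc n)" by (intro divide_left_mono) auto
      then have "x \<in> {1 / real (Suc (max n m))..real (max n m)}" using n m by (auto simp del: of_nat_Suc)
      then show ?thesis by blast
    qed auto
    then show ?thesis by blast
  qed
  finally have "eventually (\<lambda>n. measure \<mu> (?A n) < e) sequentially"
    using e by (intro order_tendstoD) auto
  then obtain n where "measure \<mu> (?A n) < e" by (auto simp: eventually_sequentially)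
  then show "\<exists>K. compact K \<and> K \<subseteq> {0<..} \<and> (\<forall>\<mu>'\<in>{\<mu>}. measure \<mu>' ({0<..} - K) < e)"
    by (intro exI[of _ "{1 / real (Suc n)..real n}"]) (auto intro: less_le_trans[rotated] simp del: of_nat_Suc)
qed

theorem proposition3p2:
  fixes R G :: "real \<Rightarrow> real" and \<pi> :: "real measure"
  assumes R: "rate_function R"
    and stationarity: "(\<lambda>t. G) \<in> solutions R"
    and pi: "\<pi> = interval_measure G"
  shows "(\<forall>F \<in> solutions_ac R \<pi>.
            ((\<lambda>t. tv_dist (interval_measure (F t)) \<pi>) \<longlongrightarrow> 0) at_top) \<and>
         (\<forall>\<M>. (\<forall>\<mu>\<in>\<M>. positive_distribution \<mu>) \<and> tight_on_positive \<M> \<longrightarrow>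
            uniform_limit {F \<in> solutions_ac R \<pi>. interval_measure (F 0) \<in> \<M>}
              (\<lambda>t F. tv_dist (interval_measure (F t)) \<pi>) (\<lambda>F. 0) at_top)"
proof -
  interpret stationary_law R G using R stationarity by unfold_locales
  have unif: "uniform_limit {F \<in> solutions_ac R \<pi>. interval_measure (F 0) \<in> \<M>}
      (\<lambda>t F. tv_dist (interval_measure (F t)) \<pi>) (\<lambda>F. 0) at_top"
    if tight: "tight_on_positive \<M>" for \<M>
  proof (rule uniform_limitI)
    fix e :: real assume "0 < e"
    then obtain T where T: "\<And>F t. F \<in> solutions_ac R \<pi> \<Longrightarrow> interval_measure (F 0) \<in> \<M> \<Longrightarrow> T \<le> t \<Longrightarrow>
        tv_dist (interval_measure (F t)) \<pi> \<in> {0..e / 2}"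
      using uniform_convergence[OF tight, of "e / 2"] unfolding pi by auto
    show "\<forall>\<^sub>F t in at_top. \<forall>F\<in>{F \<in> solutions_ac R \<pi>. interval_measure (F 0) \<in> \<M>}.
        dist (tv_dist (interval_measure (F t)) \<pi>) 0 < e"
      using eventually_ge_at_top[of T]
    proof eventually_elim
      case (elim t)
      show ?case using T[OF _ _ elim] \<open>0 < e\<close> by (force simp: dist_real_def)
    qed
  qed
  have "((\<lambda>t. tv_dist (interval_measure (F t)) \<pi>) \<longlongrightarrow> 0) at_top" if F: "F \<in> solutions_ac R \<pi>" for F
  proof -
    have "uniform_limit {F' \<in> solutions_ac R \<pi>. interval_measure (F' 0) \<in> {interval_measure (F 0)}}
      (\<lambda>t F. tv_dist (interval_measure (F t)) \<pi>) (\<lambda>F. 0) at_top"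
      by (intro unif tight_singleton solution_ac_initial[OF F])
    from tendsto_uniform_limitI[OF this, of F] F show ?thesis by simp
  qed
  with unif show ?thesis by blast
qed

end
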